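(* Let $M\ge 0$ and let $\mathbb{D}$ be the symmetric operator in $L^2((-\pi/2,\pi/2),\mathbb{C}^2)$ with domain $C_c^\infty((-\pi/2,\pi/2),\mathbb{C}^2)$ given by $$\mathbb{D}=\begin{pmatrix}0&-\frac{d}{d\rho}+M\sec\rho\\ \frac{d}{d\rho}+M\sec\rho&0\end{pmatrix}.$$ Let $n_\pm=\dim\ker(\mathbb{D}^\dagger\mp i)$ be its deficiency indices. Then: (i) if $0\le M<1/2$, then $n_+=n_-=2$; (ii) if $M\ge 1/2$, then $n_+=n_-=0$, so $\mathbb{D}$ is essentially self-adjoint and its unique self-adjoint extension is its closure $\overline{\mathbb{D}}$.
   Context: The Hilbert space $L^2((-\pi/2,\pi/2),\mathbb{C}^2)$ carries the inner product $\langle\Phi,\Phi'\rangle=\int_{-\pi/2}^{\pi/2}\Phi(\rho)^\dagger\Phi'(\rho)\,d\rho$. $\mathbb{D}^\dagger$ denotes the Hilbert-space adjoint of $\mathbb{D}$. (The operator $\mathbb{D}$ is the spatial part of the Dirac operator of mass $M$ on two-dimensional anti-de Sitter space with metric $\sec^2\rho(-dt^2+d\rho^2)$.) *)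

theory Defs
  imports "HOL-Analysis.Analysis" "HOL-Library.Extended_Nat"
begin

section \<open>The Hilbert space of square-integrable two-component functions\<close>

abbreviation I0 :: "real set" where
  "I0 \<equiv> {-(pi/2)<..<pi/2}"

definition cdot :: "complex ^ 2 \<Rightarrow> complex ^ 2 \<Rightarrow> complex" where
  "cdot u v = (\<Sum>i\<in>UNIV. cnj (u $ i) * v $ i)"

definition square_integrable :: "(real \<Rightarrow> complex ^ 2) \<Rightarrow> bool" where
  "square_integrable f \<longleftrightarrow> f \<in> borel_measurable (lebesgue_on I0) \<and>
     integrable (lebesgue_on I0) (\<lambda>x. (norm (f x))\<^sup>2)"

definition L2_rel :: "(real \<Rightarrow> complex ^ 2) \<Rightarrow> (real \<Rightarrow> complex ^ 2) \<Rightarrow> bool" where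
  "L2_rel f g \<longleftrightarrow> square_integrable f \<and> square_integrable g \<and> (AE x in lebesgue_on I0. f x = g x)"

lemma inner_eq_Re_cdot: "u \<bullet> v = Re (cdot u v)"
  by (simp add: cdot_def inner_vec_def inner_complex_def)

lemma cdot_self: "cdot u u = of_real ((norm u)\<^sup>2)"
proof -
  have "cdot u u = (\<Sum>i\<in>UNIV. of_real ((norm (u $ i))\<^sup>2))"
    unfolding cdot_def by (intro sum.cong refl) (metis complex_norm_square mult.commute)
  also have "\<dots> = of_real ((norm u)\<^sup>2)"
    unfolding norm_vec_def L2_set_def by (simp add: real_sqrt_pow2 sum_nonneg)
  finally show ?thesis .
qed

lemma norm_vec2_sq: "(norm (u :: complex ^ 2))\<^sup>2 = (norm (u $ 1))\<^sup>2 + (norm (u $ 2))\<^sup>2"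
  unfolding norm_vec_def L2_set_def by (simp add: sum_2)

lemma norm_cdot_le: "norm (cdot u v) \<le> (norm u)\<^sup>2 + (norm v)\<^sup>2"
proof -
  have *: "a * b \<le> a\<^sup>2 + b\<^sup>2" if "a \<ge> 0" "b \<ge> 0" for a b :: real
    using sum_squares_bound[of a b] that mult_nonneg_nonneg[OF that] by linarith
  have "norm (cdot u v) \<le> norm (u$1) * norm (v$1) + norm (u$2) * norm (v$2)"
    unfolding cdot_def sum_2
    by (rule order_trans[OF norm_triangle_ineq]) (simp add: norm_mult)
  also have "\<dots> \<le> ((norm (u$1))\<^sup>2 + (norm (v$1))\<^sup>2) + ((norm (u$2))\<^sup>2 + (norm (v$2))\<^sup>2)"
    by (intro add_mono *) auto
  finally show ?thesis by (simp add: norm_vec2_sq)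
qed

lemma cdot_add_left: "cdot (u + v) w = cdot u w + cdot v w"
  and cdot_add_right: "cdot w (u + v) = cdot w u + cdot w v"
  by (simp_all add: cdot_def sum_2 algebra_simps)

lemma square_integrable_measurable [measurable_dest]:
  "square_integrable f \<Longrightarrow> f \<in> borel_measurable (lebesgue_on I0)"
  by (simp add: square_integrable_def)

lemma measurable_vec_nth' [measurable (raw)]:
  "f \<in> borel_measurable N \<Longrightarrow> (\<lambda>x. (f x :: complex ^ 2) $ i) \<in> borel_measurable N"
  by (rule borel_measurable_continuous_on[where f="\<lambda>u. u $ i"]) (auto intro: continuous_intros)

lemma square_integrable_cdot:
  assumes f: "square_integrable f" and g: "square_integrable g"
  shows "integrable (lebesgue_on I0) (\<lambda>x. cdot (f x) (g x))"
proof (rule Bochner_Integration.integrable_bound)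
  show "integrable (lebesgue_on I0) (\<lambda>x. (norm (f x))\<^sup>2 + (norm (g x))\<^sup>2)"
    using f g by (auto simp: square_integrable_def)
  note [measurable] = square_integrable_measurable[OF f] square_integrable_measurable[OF g]
  have [measurable]: "(\<lambda>x. cnj (f x $ i)) \<in> borel_measurable (lebesgue_on I0)" for i
    by (rule borel_measurable_continuous_on[where f=cnj]) (auto intro: continuous_intros)
  show "(\<lambda>x. cdot (f x) (g x)) \<in> borel_measurable (lebesgue_on I0)"
    unfolding cdot_def by measurable
qed (use norm_cdot_le in auto)

lemma square_integrable_zero: "square_integrable (\<lambda>x. 0)"
  by (simp add: square_integrable_def)

lemma square_integrable_add:
  assumes f: "square_integrable f" and g: "square_integrable g"
  shows "square_integrable (\<lambda>x. f x + g x)"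
proof -
  note [measurable] = square_integrable_measurable[OF f] square_integrable_measurable[OF g]
  have eq: "(norm (f x + g x))\<^sup>2
      = (norm (f x))\<^sup>2 + (norm (g x))\<^sup>2 + 2 * Re (cdot (f x) (g x))" for x
    by (simp add: inner_eq_Re_cdot[symmetric] dot_norm field_simps)
  have "integrable (lebesgue_on I0) (\<lambda>x. Re (cdot (f x) (g x)))"
    using square_integrable_cdot[OF f g] by (rule integrable_Re)
  then show ?thesis
    using f g unfolding square_integrable_def eq by (auto intro!: borel_measurable_add)
qed

lemma square_integrable_scaleC:
  assumes f: "square_integrable f"
  shows "square_integrable (\<lambda>x. c *s f x)"
proof -
  have eq: "(norm (c *s f x))\<^sup>2 = (norm c)\<^sup>2 * (norm (f x))\<^sup>2" for x
    by (simp add: norm_vec2_sq norm_mult power_mult_distrib algebra_simps)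
  have "continuous_on UNIV (\<lambda>u::complex^2. c *s u)"
    unfolding vector_scalar_mult_def
    by (auto intro!: continuous_intros simp: continuous_on_vec_lambda)
  from borel_measurable_continuous_on[OF this square_integrable_measurable[OF f]]
  show ?thesis using f unfolding square_integrable_def eq by auto
qed

quotient_type L2 = "real \<Rightarrow> complex ^ 2" / partial: L2_rel
proof (rule part_equivpI)
  show "\<exists>x. L2_rel x x"
    by (rule exI[of _ "\<lambda>x. 0"]) (simp add: L2_rel_def square_integrable_zero)
  show "symp L2_rel" by (auto simp: symp_def L2_rel_def eq_commute)
  show "transp L2_rel" by (auto simp: transp_def L2_rel_def)
qed

lift_definition cinner :: "L2 \<Rightarrow> L2 \<Rightarrow> complex" is
  "\<lambda>f g. \<integral>x. cdot (f x) (g x) \<partial>lebesgue_on I0"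
proof -
  fix f f' g g' assume a: "L2_rel f f'" "L2_rel g g'"
  show "(\<integral>x. cdot (f x) (g x) \<partial>lebesgue_on I0) = (\<integral>x. cdot (f' x) (g' x) \<partial>lebesgue_on I0)"
  proof (rule integral_cong_AE)
    show "AE x in lebesgue_on I0. cdot (f x) (g x) = cdot (f' x) (g' x)"
      using a unfolding L2_rel_def by auto
  qed (use a square_integrable_cdot in \<open>auto simp: L2_rel_def intro!: borel_measurable_integrable\<close>)
qed

lift_definition scaleC :: "complex \<Rightarrow> L2 \<Rightarrow> L2" (infixr "*\<^sub>C" 75) is
  "\<lambda>c f x. c *s f x"
  unfolding L2_rel_def by (auto intro: square_integrable_scaleC)

instantiation L2 :: real_inner
begin

lift_definition zero_L2 :: L2 is "\<lambda>x. 0"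
  by (simp add: L2_rel_def square_integrable_zero)

lift_definition plus_L2 :: "L2 \<Rightarrow> L2 \<Rightarrow> L2" is "\<lambda>f g x. f x + g x"
  unfolding L2_rel_def by (auto intro: square_integrable_add)

definition uminus_L2 :: "L2 \<Rightarrow> L2" where "- \<phi> = (-1) *\<^sub>C \<phi>"
definition minus_L2 :: "L2 \<Rightarrow> L2 \<Rightarrow> L2" where "\<phi> - \<psi> = \<phi> + - (\<psi> :: L2)"
definition scaleR_L2 :: "real \<Rightarrow> L2 \<Rightarrow> L2" where "r *\<^sub>R \<phi> = of_real r *\<^sub>C \<phi>"
definition inner_L2 :: "L2 \<Rightarrow> L2 \<Rightarrow> real" where "\<phi> \<bullet> \<psi> = Re (cinner \<phi> \<psi>)"
definition norm_L2 :: "L2 \<Rightarrow> real" where "norm \<phi> = sqrt (\<phi> \<bullet> (\<phi> :: L2))"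
definition dist_L2 :: "L2 \<Rightarrow> L2 \<Rightarrow> real" where "dist \<phi> \<psi> = norm (\<phi> - \<psi> :: L2)"
definition sgn_L2 :: "L2 \<Rightarrow> L2" where "sgn \<phi> = inverse (norm \<phi>) *\<^sub>R (\<phi> :: L2)"
definition uniformity_L2 :: "(L2 \<times> L2) filter" where
  "uniformity_L2 = (INF e\<in>{0<..}. principal {(x, y). dist x y < e})"
definition open_L2 :: "L2 set \<Rightarrow> bool" where
  "open_L2 U \<longleftrightarrow> (\<forall>x\<in>U. eventually (\<lambda>(x', y). x' = x \<longrightarrow> y \<in> U) uniformity)"

lemma scaleC_one_L2: "1 *\<^sub>C (\<phi> :: L2) = \<phi>"
  by transfer (auto simp: L2_rel_def)

lemma scaleC_scaleC_L2: "a *\<^sub>C b *\<^sub>C (\<phi> :: L2) = (a * b) *\<^sub>C \<phi>"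
  by transfer (auto simp: L2_rel_def vector_smult_assoc intro!: square_integrable_scaleC)

lemma scaleC_add_right_L2: "a *\<^sub>C (\<phi> + \<psi> :: L2) = a *\<^sub>C \<phi> + a *\<^sub>C \<psi>"
  by transfer (auto simp: L2_rel_def vector_add_ldistrib intro!: square_integrable_scaleC square_integrable_add)

lemma scaleC_add_left_L2: "(a + b) *\<^sub>C (\<phi> :: L2) = a *\<^sub>C \<phi> + b *\<^sub>C \<phi>"
  by transfer (auto simp: L2_rel_def vector_sadd_rdistrib intro!: square_integrable_scaleC square_integrable_add)

lemma cinner_self: "cinner \<phi> \<phi> = of_real (\<phi> \<bullet> \<phi>)" and inner_L2_nonneg: "0 \<le> \<phi> \<bullet> (\<phi> :: L2)"
  and inner_L2_zero: "\<phi> \<bullet> \<phi> = 0 \<longleftrightarrow> \<phi> = (0 :: L2)"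
proof -
  have 1: "\<exists>r\<ge>0. cinner \<phi> \<phi> = of_real r \<and> (r = 0 \<longleftrightarrow> \<phi> = 0)"
  proof transfer
    fix f assume f: "L2_rel f f"
    let ?r = "\<integral>x. (norm (f x))\<^sup>2 \<partial>lebesgue_on I0"
    have int: "integrable (lebesgue_on I0) (\<lambda>x. (norm (f x))\<^sup>2)"
      using f by (simp add: L2_rel_def square_integrable_def)
    have "?r = 0 \<longleftrightarrow> (AE x in lebesgue_on I0. (norm (f x))\<^sup>2 = 0)"
      by (rule integral_nonneg_eq_0_iff_AE[OF int]) auto
    also have "\<dots> \<longleftrightarrow> L2_rel f (\<lambda>x. 0)"
      using f square_integrable_zero by (simp add: L2_rel_def)
    finally show "\<exists>r\<ge>0. (\<integral>x. cdot (f x) (f x) \<partial>lebesgue_on I0) = of_real r \<and> (r = 0 \<longleftrightarrow> L2_rel f (\<lambda>x. 0))"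
      by (intro exI[of _ ?r]) (simp add: cdot_self integral_complex_of_real del: of_real_power)
  qed
  show "cinner \<phi> \<phi> = of_real (\<phi> \<bullet> \<phi>)" "0 \<le> \<phi> \<bullet> \<phi>" "\<phi> \<bullet> \<phi> = 0 \<longleftrightarrow> \<phi> = 0"
    using 1 by (auto simp: inner_L2_def)
qed

lemma cinner_commute: "cinner \<phi> \<psi> = cnj (cinner \<psi> \<phi>)"
  by transfer (simp add: cdot_def sum_2 mult.commute flip: Bochner_Integration.integral_cnj)

lemma cinner_add_left: "cinner (\<phi> + \<psi>) \<xi> = cinner \<phi> \<xi> + cinner \<psi> \<xi>"
  by transfer (simp add: cdot_add_left L2_rel_def square_integrable_cdot)

lemma cinner_scaleC_left: "cinner (c *\<^sub>C \<phi>) \<psi> = cnj c * cinner \<phi> \<psi>"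
proof transfer
  fix c and f g :: "real \<Rightarrow> complex ^ 2"
  have "cdot (c *s f x) (g x) = cnj c * cdot (f x) (g x)" for x
    by (simp add: cdot_def sum_2 algebra_simps)
  then show "(\<integral>x. cdot (c *s f x) (g x) \<partial>lebesgue_on I0)
      = cnj c * (\<integral>x. cdot (f x) (g x) \<partial>lebesgue_on I0)"
    by simp
qed

instance
proof
  fix x y z :: L2 and a b :: real
  show "x + y + z = x + (y + z)"
    by transfer (auto simp: L2_rel_def add.assoc intro!: square_integrable_add)
  show "x + y = y + x"
    by transfer (auto simp: L2_rel_def add.commute intro!: square_integrable_add)
  show "0 + x = x"
    by transfer (auto simp: L2_rel_def)
  show "- x + x = 0" unfolding uminus_L2_def
    by transfer (auto simp: L2_rel_def intro!: square_integrable_add square_integrable_scaleC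
        square_integrable_zero simp: vec_eq_iff)
  show "x - y = x + - y" by (rule minus_L2_def)
  show "a *\<^sub>R (x + y) = a *\<^sub>R x + a *\<^sub>R y" "(a + b) *\<^sub>R x = a *\<^sub>R x + b *\<^sub>R x"
    "a *\<^sub>R b *\<^sub>R x = (a * b) *\<^sub>R x" "1 *\<^sub>R x = x"
    by (simp_all add: scaleR_L2_def scaleC_add_right_L2 scaleC_add_left_L2 scaleC_scaleC_L2 scaleC_one_L2)
  show "dist x y = norm (x - y)" "sgn x = inverse (norm x) *\<^sub>R x" "norm x = sqrt (x \<bullet> x)"
    by (simp_all add: dist_L2_def sgn_L2_def norm_L2_def)
  show "uniformity = (INF e\<in>{0<..}. principal {(x :: L2, y). dist x y < e})"
    by (rule uniformity_L2_def)
  show "open U \<longleftrightarrow> (\<forall>x\<in>U. eventually (\<lambda>(x', y). x' = x \<longrightarrow> y \<in> U) uniformity)" for U :: "L2 set"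
    by (rule open_L2_def)
  show "x \<bullet> y = y \<bullet> x" unfolding inner_L2_def by (subst cinner_commute) simp
  show "(x + y) \<bullet> z = x \<bullet> z + y \<bullet> z" by (simp add: inner_L2_def cinner_add_left)
  show "(a *\<^sub>R x) \<bullet> y = a * (x \<bullet> y)"
    by (simp add: inner_L2_def scaleR_L2_def cinner_scaleC_left)
  show "0 \<le> x \<bullet> x" "(x \<bullet> x = 0) = (x = 0)" by (rule inner_L2_nonneg inner_L2_zero)+
qed

end

global_interpretation L2: vector_space scaleC
  by unfold_locales
    (simp_all add: scaleC_add_right_L2 scaleC_add_left_L2 scaleC_scaleC_L2 scaleC_one_L2)

text \<open>The library dimension is 0 for spaces without a finite basis; the following one is
  \<open>\<infinity>\<close> there.\<close>

definition edim :: "L2 set \<Rightarrow> enat" where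
  "edim V = (if \<exists>B. finite B \<and> V \<subseteq> L2.span B then enat (L2.dim V) else \<infinity>)"


section \<open>Unbounded operators\<close>

text \<open>An operator is identified with its graph.\<close>

type_synonym op_graph = "(L2 \<times> L2) set"

definition linear_graph :: "op_graph \<Rightarrow> bool" where
  "linear_graph T \<longleftrightarrow> (0, 0) \<in> T \<and>
     (\<forall>(\<phi>, \<phi>') \<in> T. \<forall>(\<psi>, \<psi>') \<in> T. (\<phi> + \<psi>, \<phi>' + \<psi>') \<in> T) \<and>
     (\<forall>(\<phi>, \<phi>') \<in> T. \<forall>c. (c *\<^sub>C \<phi>, c *\<^sub>C \<phi>') \<in> T)"

definition densely_defined_op :: "op_graph \<Rightarrow> bool" where
  "densely_defined_op T \<longleftrightarrow> linear_graph T \<and> single_valued T \<and> closure (Domain T) = UNIV"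

definition adjoint_op :: "op_graph \<Rightarrow> op_graph" where
  "adjoint_op T = {(\<psi>, \<eta>). \<forall>(\<phi>, \<phi>') \<in> T. cinner \<psi> \<phi>' = cinner \<eta> \<phi>}"

definition symmetric_op :: "op_graph \<Rightarrow> bool" where
  "symmetric_op T \<longleftrightarrow> densely_defined_op T \<and>
     (\<forall>(\<phi>, \<phi>') \<in> T. \<forall>(\<psi>, \<psi>') \<in> T. cinner \<psi> \<phi>' = cinner \<psi>' \<phi>)"

definition self_adjoint_op :: "op_graph \<Rightarrow> bool" where
  "self_adjoint_op T \<longleftrightarrow> densely_defined_op T \<and> adjoint_op T = T"

text \<open>The closure of an operator is the topological closure of its graph.\<close>

definition essentially_self_adjoint_op :: "op_graph \<Rightarrow> bool" where
  "essentially_self_adjoint_op T \<longleftrightarrow> symmetric_op T \<and> self_adjoint_op (closure T)"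

definition shift_op :: "op_graph \<Rightarrow> complex \<Rightarrow> op_graph" where
  "shift_op T z = {(\<phi>, \<phi>' - z *\<^sub>C \<phi>) | \<phi> \<phi>'. (\<phi>, \<phi>') \<in> T}"

definition ker_op :: "op_graph \<Rightarrow> L2 set" where
  "ker_op T = {\<phi>. (\<phi>, 0) \<in> T}"

definition deficiency_plus :: "op_graph \<Rightarrow> enat" where
  "deficiency_plus T = edim (ker_op (shift_op (adjoint_op T) \<i>))"

definition deficiency_minus :: "op_graph \<Rightarrow> enat" where
  "deficiency_minus T = edim (ker_op (shift_op (adjoint_op T) (- \<i>)))"


section \<open>The Dirac operator\<close>

definition smooth :: "(real \<Rightarrow> complex ^ 2) \<Rightarrow> bool" where
  "smooth f \<longleftrightarrow> (\<exists>F. F 0 = f \<and> (\<forall>n::nat. \<forall>x. (F n has_vector_derivative F (Suc n) x) (at x)))"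

text \<open>Compactly supported smooth functions on the interval, extended by zero to the real line.\<close>

definition test_function :: "(real \<Rightarrow> complex ^ 2) \<Rightarrow> bool" where
  "test_function f \<longleftrightarrow> smooth f \<and> compact (closure {x. f x \<noteq> 0}) \<and> closure {x. f x \<noteq> 0} \<subseteq> I0"

definition dirac_expr :: "real \<Rightarrow> (real \<Rightarrow> complex ^ 2) \<Rightarrow> real \<Rightarrow> complex ^ 2" where
  "dirac_expr M \<Phi> \<rho> = (let \<Phi>' = vector_derivative \<Phi> (at \<rho>); m = complex_of_real (M * (1 / cos \<rho>)) in
     vector [- \<Phi>' $ 2 + m * \<Phi> \<rho> $ 2, \<Phi>' $ 1 + m * \<Phi> \<rho> $ 1])"

definition dirac_op :: "real \<Rightarrow> op_graph" where
  "dirac_op M = {(abs_L2 \<Phi>, abs_L2 (dirac_expr M \<Phi>)) | \<Phi>. test_function \<Phi>}"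

text \<open>\<^const>\<open>abs_L2\<close> is only meaningful on square-integrable functions; it is applied to no others
  in \<^const>\<open>dirac_op\<close>.\<close>

lemma square_integrable_compact_support:
  assumes c: "continuous_on I0 f" and K: "compact K" "K \<subseteq> I0" and z: "\<And>x. x \<notin> K \<Longrightarrow> f x = 0"
  shows "square_integrable f"
proof -
  have m: "f \<in> borel_measurable (lebesgue_on I0)"
    by (rule continuous_imp_measurable_on_sets_lebesgue[OF c]) simp
  have "bounded (f ` K)"
    using compact_continuous_image[OF continuous_on_subset[OF c K(2)] K(1)] by (rule compact_imp_bounded)
  then obtain B where B: "\<forall>x\<in>K. norm (f x) \<le> B" by (auto simp: bounded_iff)
  have b: "norm (f x) \<le> max B 0" for x using B z[of x] by (cases "x \<in> K") (force simp: le_max_iff_disj)+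
  have "integrable (lebesgue_on I0) (\<lambda>x. (norm (f x))\<^sup>2)"
  proof (rule Bochner_Integration.integrable_bound)
    show "integrable (lebesgue_on I0) (\<lambda>x. (max B 0)\<^sup>2)"
      by (intro integrable_const_ivl finite_measure.integrable_const finite_measure_lebesgue_on) auto
    show "(\<lambda>x. (norm (f x))\<^sup>2) \<in> borel_measurable (lebesgue_on I0)" using m by measurable
    show "AE x in lebesgue_on I0. norm ((norm (f x))\<^sup>2) \<le> norm ((max B 0)\<^sup>2)"
      using b by (auto intro!: AE_I2 power_mono)
  qed
  with m show ?thesis by (simp add: square_integrable_def)
qed

lemma smooth_continuous:
  assumes "smooth f"
  shows "continuous_on S f" "continuous_on S (\<lambda>x. vector_derivative f (at x))"
proof -
  obtain F where F: "F 0 = f" "\<And>n x. (F n has_vector_derivative F (Suc n) x) (at x)"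
    using assms unfolding smooth_def by blast
  have c: "continuous_on S (F n)" for n
    using F(2) by (intro continuous_at_imp_continuous_on ballI) (blast intro: has_vector_derivative_continuous)
  have "(\<lambda>x. vector_derivative f (at x)) = F (Suc 0)"
    using F by (intro ext vector_derivative_at) metis
  with c[of 0] c[of "Suc 0"] F(1)
  show "continuous_on S f" "continuous_on S (\<lambda>x. vector_derivative f (at x))" by metis+
qed

lemma test_function_square_integrable:
  assumes "test_function \<Phi>"
  shows "square_integrable \<Phi>" "square_integrable (dirac_expr M \<Phi>)"
proof -
  let ?K = "closure {x. \<Phi> x \<noteq> 0}"
  have K: "compact ?K" "?K \<subseteq> I0" and s: "smooth \<Phi>" using assms by (auto simp: test_function_def)
  have z: "\<Phi> x = 0" if "x \<notin> ?K" for x using that closure_subset[of "{x. \<Phi> x \<noteq> 0}"] by auto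
  show "square_integrable \<Phi>"
    by (rule square_integrable_compact_support[OF smooth_continuous(1)[OF s] K z])
  have z': "vector_derivative \<Phi> (at x) = 0" if "x \<notin> ?K" for x
  proof (rule vector_derivative_at)
    have "((\<lambda>x. 0) has_vector_derivative 0) (at x)" by simp
    moreover have "0 = \<Phi> y" if "y \<in> - ?K" for y using z[of y] that by simp
    ultimately show "(\<Phi> has_vector_derivative 0) (at x)"
      using that by (intro has_vector_derivative_transform_within_open[of "\<lambda>x. 0" 0 x "- ?K" \<Phi>]) (auto simp only: open_Compl closed_closure Compl_iff)
  qed
  have cos: "cos x \<noteq> 0" if "x \<in> I0" for x using cos_gt_zero_pi[of x] that by auto
  have "continuous_on I0 (dirac_expr M \<Phi>)"
  proof -
    note c = smooth_continuous[OF s, of I0]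
    have 1: "continuous_on I0 (\<lambda>x. dirac_expr M \<Phi> x $ i)" for i
    proof (cases "i = 1")
      case True
      show ?thesis unfolding True dirac_expr_def Let_def vector_2
        by (intro continuous_intros c) (use cos in auto)
    next
      case False
      then have i: "i = 2" using exhaust_2 by blast
      show ?thesis unfolding i dirac_expr_def Let_def vector_2
        by (intro continuous_intros c) (use cos in auto)
    qed
    then have "continuous_on I0 (\<lambda>x. \<chi> i. dirac_expr M \<Phi> x $ i)"
      by (intro continuous_on_vec_lambda)
    then show ?thesis by simp
  qed
  then show "square_integrable (dirac_expr M \<Phi>)"
  proof (rule square_integrable_compact_support[OF _ K])
    fix x assume "x \<notin> ?K"
    from z[OF this] z'[OF this] show "dirac_expr M \<Phi> x = 0"
      by (simp add: dirac_expr_def Let_def vec_eq_iff forall_2)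
  qed
qed

end

theory Submission
  imports Defs
begin

text \<open>
  Write \<open>\<psi> = (u, v)\<close> and \<open>m = M sec x\<close>. A vector \<open>\<psi>\<close> with \<open>D\<^sup>\<dagger> \<psi> = z \<psi>\<close>, \<open>z = \<plusminus>\<i>\<close>, is a weak and hence
  a classical solution of \<open>u' = z v - m u\<close>, \<open>v' = m v - z u\<close>. The flux \<open>w = Re (cnj u * z v)\<close> then satisfies
  \<open>w' = |u|\<^sup>2 + |v|\<^sup>2\<close>, and \<open>(|v|\<^sup>2)' = 2 m |v|\<^sup>2 + 2 w\<close>.

  If \<open>M \<ge> 1/2\<close> and \<open>w > 0\<close> at some point, then \<open>w > 0\<close> to the right of it, so that \<open>(\<pi>/2 - x) |v|\<^sup>2\<close> increases
  and \<open>v\<close> is not square integrable. By reflection, \<open>w < 0\<close> is impossible too. Hence \<open>w = 0\<close>, and \<open>w' = 0\<close>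
  gives \<open>\<psi> = 0\<close>.

  If \<open>M < 1/2\<close>, solutions are determined by their value at 0, so \<open>n\<^sub>\<plusminus> \<le> 2\<close>. No solution is constructed for
  the lower bound. Every \<open>(\<psi>, \<eta>)\<close> in the graph of \<open>D\<^sup>\<dagger>\<close> splits into an element of the closure of \<open>D\<close> and
  eigenvectors \<open>k\<^sub>+\<close>, \<open>k\<^sub>-\<close>, and the imaginary part of \<open>\<langle>\<psi>, \<eta>\<rangle>\<close> vanishes on the closure and equals \<open>\<plusminus>|k\<^sub>\<plusminus>|\<^sup>2\<close> on
  the eigenvectors. The solutions of \<open>D\<^sup>\<dagger> \<psi> = 0\<close>, cut off near either endpoint, span a plane on which this
  form is positive definite (and another one on which it is negative definite), so the projection of that
  plane to \<open>k\<^sub>+\<close> (respectively \<open>k\<^sub>-\<close>) is injective.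
\<close>

text \<open>The value 1/2 comes from the eigenvalue 0, where the system decouples:
  \<open>u' = - m u\<close> and \<open>v' = m v\<close> are solved by powers with exponents -M and M
  of a function that grows like \<open>2 / (pi/2 - x)\<close> at the right endpoint and is inverted
  by reflection. Their squares have exponents -2M and 2M, so both are integrable exactly if 2M < 1.
  In that case the ratio of the two components can be prescribed at each endpoint separately. This
  freedom gives the imaginary part of \<open>cinner \<psi> \<eta>\<close>, which is a difference of
  boundary terms, either sign on a whole plane.

  The other obstacle is that an element of the adjoint is only a class of functions modulo null
  sets, known through its inner products with test functions. Differential equations become
  available only after a regularity argument on compact subintervals, since the mass term is
  unbounded at the endpoints. The same tools show that the test functions are dense. The splitting
  of the adjoint graph is an orthogonal projection in the product of two copies of
  \<open>L2\<close>, and therefore rests on the completeness of \<open>L2\<close>.\<close>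

subsection \<open>Smooth bump functions\<close>

text \<open>Coinduction stands in for the sequence of iterated derivatives: a function is smooth as
  soon as it lies in some set of functions that is closed under differentiation, which is the form
  given in \<open>smooth_real_coinduct_set\<close>.\<close>

coinductive smooth_real :: "(real \<Rightarrow> real) \<Rightarrow> bool" where
  "(\<And>x. (f has_real_derivative f' x) (at x)) \<Longrightarrow> smooth_real f' \<Longrightarrow> smooth_real f"

lemma smooth_real_deriv:
  assumes "smooth_real f"
  shows "(f has_real_derivative deriv f x) (at x)" "smooth_real (deriv f)"
proof -
  obtain f' where f': "\<And>x. (f has_real_derivative f' x) (at x)" "smooth_real f'"
    using assms by (metis smooth_real.cases)
  then have "deriv f = f'" by (auto intro!: DERIV_imp_deriv)
  then show "(f has_real_derivative deriv f x) (at x)" "smooth_real (deriv f)"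
    using f' by auto
qed

lemma smooth_real_isCont: "smooth_real f \<Longrightarrow> isCont f x"
  using smooth_real_deriv(1) DERIV_isCont by blast

lemma smooth_real_coinduct_set:
  assumes "h \<in> S" "\<And>f. f \<in> S \<Longrightarrow> \<exists>f'\<in>S. \<forall>x. (f has_real_derivative f' x) (at x)"
  shows "smooth_real h"
  using assms(1)
proof (coinduction arbitrary: h)
  case smooth_real
  with assms(2) show ?case by blast
qed

text \<open>Products alone are not closed under differentiation, but finite sums of products are, by
  the Leibniz rule. A list of pairs represents such a sum, and differentiating doubles the
  list.\<close>

lemma smooth_real_mult:
  assumes "smooth_real f" "smooth_real g"
  shows "smooth_real (\<lambda>x. f x * g x)"
proof -
  define S where "S = {h :: real \<Rightarrow> real. \<exists>L :: ((real \<Rightarrow> real) \<times> (real \<Rightarrow> real)) list. (\<forall>(a,b)\<in>set L. smooth_real a \<and> smooth_real b) \<and>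
      h = (\<lambda>x. \<Sum>(a,b)\<leftarrow>L. a x * b x)}"
  have "(\<lambda>x. f x * g x) \<in> S"
    unfolding S_def using assms by (intro CollectI exI[of _ "[(f,g)]"]) auto
  then show ?thesis
  proof (rule smooth_real_coinduct_set)
    fix h assume "h \<in> S"
    then obtain L where L: "\<And>a b. (a,b) \<in> set L \<Longrightarrow> smooth_real a \<and> smooth_real b"
      and h: "h = (\<lambda>x. \<Sum>(a,b)\<leftarrow>L. a x * b x)"
      unfolding S_def by blast
    define L' where "L' = map (\<lambda>(a,b). (deriv a, b)) L @ map (\<lambda>(a,b). (a, deriv b)) L"
    define h' where "h' = (\<lambda>x. \<Sum>(a,b)\<leftarrow>L'. a x * b x)"
    have "((\<lambda>x. \<Sum>(a,b)\<leftarrow>L. a x * b x) has_real_derivative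
        (\<Sum>(a,b)\<leftarrow>map (\<lambda>(a,b). (deriv a, b)) L. a x * b x) +
        (\<Sum>(a,b)\<leftarrow>map (\<lambda>(a,b). (a, deriv b)) L. a x * b x)) (at x)" for x
      using L
    proof (induction L)
      case (Cons ab L)
      obtain a b where ab: "ab = (a,b)" by force
      have "smooth_real a" "smooth_real b" using Cons.prems[of a b] ab by auto
      then have 1: "((\<lambda>x. a x * b x) has_real_derivative deriv a x * b x + deriv b x * a x) (at x)"
        by (intro DERIV_mult smooth_real_deriv)
      have "smooth_real a \<and> smooth_real b" if "(a, b) \<in> set L" for a b
        using Cons.prems that by auto
      from DERIV_add[OF 1 Cons.IH[OF this]] show ?case
        by (simp add: ab algebra_simps)
    qed simp
    then have "(h has_real_derivative h' x) (at x)" for x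
      unfolding h h'_def L'_def by simp
    moreover have "h' \<in> S"
      unfolding S_def h'_def using L
      by (intro CollectI exI[of _ L']) (auto simp: L'_def intro: smooth_real_deriv)
    ultimately show "\<exists>h'\<in>S. \<forall>x. (h has_real_derivative h' x) (at x)" by blast
  qed
qed

lemma smooth_real_affine:
  assumes "smooth_real f"
  shows "smooth_real (\<lambda>x. c * f (a * x + b))"
proof (rule smooth_real_coinduct_set)
  \<comment> \<open>The factor \<open>c\<close> ranges over all reals because every derivative
    contributes another factor \<open>a\<close>.\<close>
  let ?S = "{\<lambda>x. c * f (a * x + b) | f c. smooth_real f}"
  show "(\<lambda>x. c * f (a * x + b)) \<in> ?S" using assms by blast
  fix h assume "h \<in> ?S"
  then obtain f c where h: "h = (\<lambda>x. c * f (a * x + b))" and f: "smooth_real f" by blast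
  have "(h has_real_derivative (c * a) * deriv f (a * x + b)) (at x)" for x
  proof -
    have "((\<lambda>x. a * x + b) has_real_derivative a) (at x)"
      by (auto intro!: derivative_eq_intros)
    from DERIV_cmult[OF DERIV_chain2[OF smooth_real_deriv(1)[OF f] this], of c]
    show ?thesis unfolding h by (simp add: mult_ac)
  qed
  then show "\<exists>h'\<in>?S. \<forall>x. (h has_real_derivative h' x) (at x)" using smooth_real_deriv(2)[OF f]
    by (intro bexI[of _ "\<lambda>x. (c * a) * deriv f (a * x + b)"]) blast+
qed

lemma smooth_real_diff:
  assumes "smooth_real f" "smooth_real g"
  shows "smooth_real (\<lambda>x. f x - g x)"
proof (rule smooth_real_coinduct_set)
  let ?S = "{\<lambda>x. f x - g x | f g. smooth_real f \<and> smooth_real g}"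
  show "(\<lambda>x. f x - g x) \<in> ?S" using assms by blast
  fix h assume "h \<in> ?S"
  then obtain f g where h: "h = (\<lambda>x. f x - g x)" and fg: "smooth_real f" "smooth_real g" by blast
  have "(h has_real_derivative deriv f x - deriv g x) (at x)" for x
    unfolding h by (intro DERIV_diff smooth_real_deriv fg)
  then show "\<exists>h'\<in>?S. \<forall>x. (h has_real_derivative h' x) (at x)"
    using smooth_real_deriv(2)[OF fg(1)] smooth_real_deriv(2)[OF fg(2)]
    by (intro bexI[of _ "\<lambda>x. deriv f x - deriv g x"]) blast+
qed

text \<open>This family is closed under differentiation: \<open>p(y) e\<^sup>-\<^sup>y\<close> with \<open>y = 1/x\<close> has the derivative
  \<open>y\<^sup>2 (p(y) - p'(y)) e\<^sup>-\<^sup>y\<close>.\<close>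

definition flat :: "real poly \<Rightarrow> real \<Rightarrow> real" where
  "flat p x = (if x \<le> 0 then 0 else poly p (1/x) * exp (-(1/x)))"

lemma tendsto_poly_exp_neg: "((\<lambda>y. poly p y * exp (- y)) \<longlongrightarrow> (0::real)) at_top"
proof -
  have "((\<lambda>y. \<Sum>i\<le>degree p. coeff p i * (y ^ i / exp y)) \<longlongrightarrow> (\<Sum>i\<le>degree p. coeff p i * 0)) at_top"
    by (intro tendsto_intros tendsto_power_div_exp_0)
  moreover have "(\<Sum>i\<le>degree p. coeff p i * (y ^ i / exp y)) = poly p y * exp (- y)" for y :: real
    by (simp add: poly_altdef exp_minus sum_distrib_right divide_inverse mult.assoc)
  ultimately show ?thesis by simp
qed

lemma flat_deriv: "(flat p has_real_derivative flat ([:0,0,1:] * (p - pderiv p)) x) (at x)"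
proof -
  let ?q = "[:0,0,1:] * (p - pderiv p)"
  consider "x < 0" | "x = 0" | "x > 0" by linarith
  then show ?thesis
  proof cases
    case 1
    have "((\<lambda>x. 0) has_real_derivative 0) (at x)" by simp
    then have "(flat p has_real_derivative 0) (at x)"
      by (rule has_field_derivative_transform_within_open[of _ _ _ "{..<0}"]) (use 1 in \<open>auto simp: flat_def\<close>)
    with 1 show ?thesis by (simp add: flat_def)
  next
    case 3
    have "((\<lambda>x. poly p (1/x) * exp (-(1/x))) has_real_derivative
        poly ?q (1/x) * exp (-(1/x))) (at x)"
      using 3
      by (auto intro!: derivative_eq_intros DERIV_chain2[OF poly_DERIV] simp: field_simps power2_eq_square)
    then have "(flat p has_real_derivative poly ?q (1/x) * exp (-(1/x))) (at x)"
      by (rule has_field_derivative_transform_within_open[of _ _ _ "{0<..}"]) (use 3 in \<open>auto simp: flat_def\<close>)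
    with 3 show ?thesis by (simp add: flat_def)
  next
    case 2
    have "((\<lambda>h. flat p h / h) \<longlongrightarrow> 0) (at 0)"
    proof (rule filterlim_split_at_real)
      show "((\<lambda>h. flat p h / h) \<longlongrightarrow> 0) (at_left 0)"
        by (rule tendsto_eventually) (auto simp: eventually_at_left_field flat_def intro!: exI[of _ "-1"])
      \<comment> \<open>With y = 1/h the difference quotient at 0 is y p(y) exp(-y). The additional
        factor y is absorbed into the polynomial.\<close>
      have "((\<lambda>h. poly ([:0,1:] * p) (inverse h) * exp (- inverse h)) \<longlongrightarrow> (0::real)) (at_right 0)"
        by (rule filterlim_compose[OF tendsto_poly_exp_neg filterlim_inverse_at_top_right])
      moreover have "\<forall>\<^sub>F h in at_right 0. poly ([:0,1:] * p) (inverse h) * exp (- inverse h) = flat p h / h"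
        by (auto simp: eventually_at_right_field flat_def divide_inverse intro!: exI[of _ 1])
      ultimately show "((\<lambda>h. flat p h / h) \<longlongrightarrow> 0) (at_right 0)"
        by (rule Lim_transform_eventually)
    qed
    then have "(flat p has_real_derivative 0) (at 0)"
      by (simp add: DERIV_def flat_def)
    with 2 show ?thesis by (simp add: flat_def)
  qed
qed

lemma smooth_real_flat: "smooth_real (flat p)"
  by (rule smooth_real_coinduct_set[of _ "range flat"]) (use flat_deriv in blast)+

lemma flat_one_limit: "(\<lambda>n. flat 1 (real n * x)) \<longlonglongrightarrow> (if x \<le> 0 then 0 else 1)"
proof (cases "x \<le> 0")
  case True
  then show ?thesis by (simp add: flat_def mult_nonneg_nonpos)
next
  case False
  have "(\<lambda>n. exp (- ((1 / x) * inverse (real n)))) \<longlonglongrightarrow> exp (- ((1 / x) * 0))"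
    by (intro tendsto_intros lim_inverse_n)
  then have "(\<lambda>n. exp (- (1 / (real n * x)))) \<longlonglongrightarrow> 1" by (simp add: divide_inverse mult.commute)
  moreover have "\<forall>\<^sub>F n in sequentially. exp (- (1 / (real n * x))) = flat 1 (real n * x)"
    using eventually_gt_at_top[of 0] by eventually_elim (use False in \<open>auto simp: flat_def mult_le_0_iff\<close>)
  ultimately show ?thesis using False by (auto intro: Lim_transform_eventually)
qed

lemma flat_one_bounds: "0 \<le> flat 1 x" "flat 1 x \<le> 1" "x \<le> 0 \<Longrightarrow> flat 1 x = 0"
  by (auto simp: flat_def)

text \<open>Since \<open>exp (-1/(n x)) \<longlonglongrightarrow> 1\<close> for \<open>x > 0\<close>, these functions tend boundedly to the indicator function of
  \<open>(0, h)\<close> without any normalisation.\<close>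

definition bump :: "real \<Rightarrow> nat \<Rightarrow> real \<Rightarrow> real" where
  "bump h n x = flat 1 (real n * x) * flat 1 (real n * (h - x))"

lemma smooth_real_bump: "smooth_real (bump h n)"
proof -
  have "smooth_real (\<lambda>x. (1 * flat 1 (real n * x + 0)) * (1 * flat 1 ((- real n) * x + real n * h)))"
    by (intro smooth_real_mult smooth_real_affine smooth_real_flat)
  then show ?thesis by (simp add: bump_def[abs_def] algebra_simps)
qed

lemma bump_bounds: "0 \<le> bump h n x" "bump h n x \<le> 1"
  using flat_one_bounds by (auto simp: bump_def mult_le_one)

lemma bump_eq_0: "x \<notin> {0<..<h} \<Longrightarrow> bump h n x = 0"
  unfolding bump_def
  by (cases "x \<le> 0") (auto simp: flat_one_bounds(3) mult_nonneg_nonpos)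

lemma bump_limit: "(\<lambda>n. bump h n x) \<longlonglongrightarrow> indicator {0<..<h} x"
proof -
  have "(\<lambda>n. bump h n x) \<longlonglongrightarrow> (if x \<le> 0 then 0 else 1) * (if h - x \<le> 0 then 0 else 1)"
    unfolding bump_def by (intro tendsto_mult flat_one_limit)
  then show ?thesis by (auto simp: indicator_def split: if_splits)
qed

lemma smooth_real_antideriv:
  assumes "smooth_real f"
  obtains F where "smooth_real F" "\<And>x. (F has_real_derivative f x) (at x)" "F 0 = 0"
proof -
  have "\<exists>F. \<forall>x::real. - \<infinity> < ereal x \<longrightarrow> ereal x < \<infinity> \<longrightarrow> (F has_vector_derivative f x) (at x)"
    by (rule einterval_antiderivative) (auto intro: smooth_real_isCont assms)
  then obtain F where F: "\<And>x. (F has_real_derivative f x) (at x)"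
    by (auto simp: has_real_derivative_iff_has_vector_derivative)
  have F': "((\<lambda>x. F x - F 0) has_real_derivative f x) (at x)" for x
    using F[of x] by (auto intro!: derivative_eq_intros)
  moreover have "smooth_real (\<lambda>x. F x - F 0)"
    using smooth_real.intros[OF F' assms] .
  ultimately show ?thesis using that by force
qed

subsection \<open>Weak derivatives\<close>

text \<open>For positive \<open>h\<close> this is the primitive of the indicator function of (0, h)
  that vanishes on the left.\<close>

definition ramp :: "real \<Rightarrow> real \<Rightarrow> real" where
  "ramp h x = max 0 (min x h)"

text \<open>The primitives that vanish at 0 are constant outside (0, h). Hence the difference of two
  translates of \<open>B n\<close> has compact support and is an admissible smooth approximation of
  a trapezoid. The pointwise limit is dominated convergence with the bound 1.\<close>

lemma bump_primitive:
  assumes h: "h > 0"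
  obtains B where "\<And>n. smooth_real (B n)" "\<And>n x. (B n has_real_derivative bump h n x) (at x)"
    "\<And>n x. x \<le> 0 \<Longrightarrow> B n x = 0" "\<And>n x. x \<ge> h \<Longrightarrow> B n x = B n h"
    "\<And>n x. 0 \<le> B n x" "\<And>n x. B n x \<le> h" "\<And>x. (\<lambda>n. B n x) \<longlonglongrightarrow> ramp h x"
proof -
  have "\<exists>F. smooth_real F \<and> (\<forall>x. (F has_real_derivative bump h n x) (at x)) \<and> F 0 = 0" for n
    using smooth_real_antideriv[OF smooth_real_bump] by metis
  then obtain B where B: "\<And>n. smooth_real (B n)" "\<And>n x. (B n has_real_derivative bump h n x) (at x)"
    "\<And>n. B n 0 = 0" by metis
  have const: "B n x = B n y" if "x \<le> y" "\<And>z. x < z \<Longrightarrow> z < y \<Longrightarrow> z \<notin> {0<..<h}" for n x y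
  proof (cases "x = y")
    case False
    then show ?thesis
      using DERIV_isconst_end[of x y "B n"] that B(2) bump_eq_0
      by (metis DERIV_isCont continuous_at_imp_continuous_on less_eq_real_def)
  qed simp
  have neg: "B n x = 0" if "x \<le> 0" for n x
    using const[of x 0] that B(3) by auto
  have ge: "B n x = B n h" if "x \<ge> h" for n x
    using const[of h x] that by auto
  have int: "(bump h n has_integral B n x) {0..x}" if "x \<ge> 0" for n x
    using fundamental_theorem_of_calculus[of 0 x "B n" "bump h n"] that B
    by (auto simp: has_real_derivative_iff_has_vector_derivative[symmetric] intro: DERIV_subset)
  have nonneg: "0 \<le> B n x" for n x
    using has_integral_nonneg[OF int[of x n]] neg[of x n] bump_bounds by (cases "x \<ge> 0") auto
  have le': "B n x \<le> h" if "0 \<le> x" "x \<le> h" for n x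
  proof -
    have "((\<lambda>x. 1) has_integral (x - 0)) {0..x}"
      using has_integral_const_real[of "1::real" 0 x] that by simp
    then have "B n x \<le> x - 0"
      by (rule has_integral_le[OF int[OF that(1)]]) (rule bump_bounds)
    with that show ?thesis by simp
  qed
  have le: "B n x \<le> h" for n x
  proof -
    consider "x \<le> 0" | "0 \<le> x \<and> x \<le> h" | "x \<ge> h" by linarith
    then show ?thesis
      by cases (use neg[of x n] le'[of x n] le'[of h n] ge[of x n] h in linarith)+
  qed
  have lim': "(\<lambda>n. B n x) \<longlonglongrightarrow> x" if "0 \<le> x" "x \<le> h" for x
  proof -
    have "(\<lambda>n. integral {0..x} (bump h n)) \<longlonglongrightarrow> integral {0..x} (indicator {0<..<h})"
    proof (rule dominated_convergence(2))
      show "bump h n integrable_on {0..x}" for n using int that by blast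
      show "(\<lambda>x. 1::real) integrable_on {0..x}" by auto
    qed (use bump_bounds bump_limit in auto)
    moreover have "integral {0..x} (bump h n) = B n x" for n using int that by blast
    moreover have "integral {0..x} (indicator {0<..<h}) = integral {0..x} (\<lambda>x. 1::real)"
      by (rule integral_spike[of "{0,h}"]) (use that in auto)
    ultimately show ?thesis using that by simp
  qed
  have lim: "(\<lambda>n. B n x) \<longlonglongrightarrow> ramp h x" for x
  proof -
    consider "x \<le> 0" | "0 \<le> x \<and> x \<le> h" | "x \<ge> h" by linarith
    then show ?thesis
    proof cases
      case 1 then show ?thesis using h by (simp add: neg ramp_def)
    next
      case 2 then show ?thesis using lim'[of x] by (simp add: ramp_def)
    next
      case 3 then show ?thesis using lim'[of h] h ge[of x] by (simp add: ramp_def)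
    qed
  qed
  show ?thesis by (rule that[OF B(1,2) neg ge nonneg le lim])
qed

lemma absolutely_integrable_scaleR_continuous:
  fixes f :: "real \<Rightarrow> 'a :: euclidean_space"
  assumes f: "f absolutely_integrable_on {c..d}" and g: "continuous_on {c..d} g"
  shows "(\<lambda>x. g x *\<^sub>R f x) absolutely_integrable_on {c..d}"
proof (rule absolutely_integrable_bounded_measurable_product[where h="(*\<^sub>R)"])
  show "bilinear ((*\<^sub>R) :: real \<Rightarrow> 'a \<Rightarrow> 'a)"
    by (simp add: bilinear_conv_bounded_bilinear bounded_bilinear_scaleR)
  show "g \<in> borel_measurable (lebesgue_on {c..d})"
    using g by (rule continuous_imp_measurable_on_sets_lebesgue) auto
  show "bounded (g ` {c..d})"
    using compact_continuous_image[OF g] by (auto intro: compact_imp_bounded)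
qed (use f in auto)

lemma continuous_on_ramp: "continuous_on S (\<lambda>x. ramp h (x - a))"
  unfolding ramp_def by (intro continuous_intros)

text \<open>Testing with primitives of \<open>bump h n (x - a) - bump h n (x - b)\<close> and letting \<open>n \<rightarrow> \<infinity>\<close> replaces the smooth test
  functions by trapezoids. The limit \<open>h \<rightarrow> 0\<close> has to be separate, because the points where one-sided averages
  converge need not be Lebesgue points for the smooth kernels.\<close>

lemma weak_derivative_differences:
  fixes f g :: "real \<Rightarrow> 'a::euclidean_space"
  assumes f: "f absolutely_integrable_on {c..d}" and g: "g absolutely_integrable_on {c..d}"
    and weak: "\<And>\<phi> \<phi>'. \<lbrakk>smooth_real \<phi>; \<And>x. (\<phi> has_real_derivative \<phi>' x) (at x);
        \<And>x. x \<notin> {c..d} \<Longrightarrow> \<phi> x = 0\<rbrakk> \<Longrightarrow>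
        integral {c..d} (\<lambda>x. \<phi>' x *\<^sub>R f x) = - integral {c..d} (\<lambda>x. \<phi> x *\<^sub>R g x)"
    and ab: "c \<le> a" "a < b" "b + h \<le> d" "h > 0"
  shows "integral {b..b+h} f - integral {a..a+h} f =
    integral {c..d} (\<lambda>x. (ramp h (x - a) - ramp h (x - b)) *\<^sub>R g x)"
proof -
  obtain B where B: "\<And>n. smooth_real (B n)" "\<And>n x. (B n has_real_derivative bump h n x) (at x)"
    "\<And>n x. x \<le> 0 \<Longrightarrow> B n x = 0" "\<And>n x. x \<ge> h \<Longrightarrow> B n x = B n h"
    "\<And>n x. 0 \<le> B n x" "\<And>n x. B n x \<le> h" "\<And>x. (\<lambda>n. B n x) \<longlonglongrightarrow> ramp h x"
    using bump_primitive[OF ab(4)] by blast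
  have cB: "isCont (B n) x" for n x using B(2) DERIV_isCont by blast
  have cb: "isCont (bump h n) x" for n x by (rule smooth_real_isCont[OF smooth_real_bump])
  have cont: "continuous_on S (\<lambda>x. B n (x - a))" "continuous_on S (\<lambda>x. bump h n (x - a))" for S n a
    by (auto intro!: continuous_at_imp_continuous_on isCont_o2[where g="B n"] isCont_o2[where g="bump h n"] cB cb)
  define \<phi> where "\<phi> n x = B n (x - a) - B n (x - b)" for n x
  define \<phi>' where "\<phi>' n x = bump h n (x - a) - bump h n (x - b)" for n x
  have eq: "integral {c..d} (\<lambda>x. \<phi>' n x *\<^sub>R f x) = - integral {c..d} (\<lambda>x. \<phi> n x *\<^sub>R g x)" for n
  proof (rule weak)
    have "smooth_real (\<lambda>x. 1 * B n (1 * x + - a) - 1 * B n (1 * x + - b))"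
      by (intro smooth_real_diff smooth_real_affine B)
    then show "smooth_real (\<phi> n)" by (simp add: \<phi>_def[abs_def])
    have "((\<lambda>x. B n (x - a)) has_real_derivative bump h n (x - a)) (at x)" for a x
    proof -
      have "((\<lambda>x. x - a) has_real_derivative 1) (at x)" by (auto intro!: derivative_eq_intros)
      from DERIV_chain2[OF B(2) this] show ?thesis by simp
    qed
    then show "(\<phi> n has_real_derivative \<phi>' n x) (at x)" for x
      unfolding \<phi>_def \<phi>'_def by (intro DERIV_diff)
    show "\<phi> n x = 0" if "x \<notin> {c..d}" for x
      using that ab B(3)[of "x-a" n] B(3)[of "x-b" n] B(4)[of "x-a" n] B(4)[of "x-b" n]
      by (auto simp: \<phi>_def)
  qed
  have "(\<lambda>n. integral {c..d} (\<lambda>x. \<phi>' n x *\<^sub>R f x)) \<longlonglongrightarrow>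
      integral {c..d} (\<lambda>x. (indicator {0<..<h} (x-a) - indicator {0<..<h} (x-b)) *\<^sub>R f x)"
  proof (rule dominated_convergence(2))
    show "(\<lambda>x. \<phi>' n x *\<^sub>R f x) integrable_on {c..d}" for n
      unfolding \<phi>'_def
      by (intro absolutely_integrable_scaleR_continuous[OF f, THEN set_lebesgue_integral_eq_integral(1)] continuous_intros cont)
    show "(\<lambda>x. norm (f x)) integrable_on {c..d}"
      using f by (auto simp: absolutely_integrable_on_def)
    show "norm (\<phi>' n x *\<^sub>R f x) \<le> norm (f x)" for n x
    proof -
      have "\<bar>\<phi>' n x\<bar> \<le> 1"
        using bump_bounds[of h n "x-a"] bump_bounds[of h n "x-b"] by (auto simp: \<phi>'_def abs_le_iff)
      then show ?thesis by (simp add: mult_left_le_one_le)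
    qed
    show "(\<lambda>n. \<phi>' n x *\<^sub>R f x) \<longlonglongrightarrow> (indicator {0<..<h} (x-a) - indicator {0<..<h} (x-b)) *\<^sub>R f x" for x
      unfolding \<phi>'_def by (intro tendsto_intros bump_limit)
  qed
  moreover have "(\<lambda>n. - integral {c..d} (\<lambda>x. \<phi> n x *\<^sub>R g x)) \<longlonglongrightarrow>
      - integral {c..d} (\<lambda>x. (ramp h (x-a) - ramp h (x-b)) *\<^sub>R g x)"
  proof (intro tendsto_minus dominated_convergence(2))
    show "(\<lambda>x. \<phi> n x *\<^sub>R g x) integrable_on {c..d}" for n
      unfolding \<phi>_def
      by (intro absolutely_integrable_scaleR_continuous[OF g, THEN set_lebesgue_integral_eq_integral(1)] continuous_intros cont)
    show "(\<lambda>x. h * norm (g x)) integrable_on {c..d}"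
      using g integrable_cmul[of "\<lambda>x. norm (g x)" _ h] by (auto simp: absolutely_integrable_on_def)
    show "norm (\<phi> n x *\<^sub>R g x) \<le> h * norm (g x)" for n x
    proof -
      have "\<bar>\<phi> n x\<bar> \<le> h"
        using B(5)[of n "x-a"] B(5)[of n "x-b"] B(6)[of n "x-a"] B(6)[of n "x-b"]
        by (auto simp: \<phi>_def abs_le_iff)
      then show ?thesis by (auto intro: mult_right_mono)
    qed
    show "(\<lambda>n. \<phi> n x *\<^sub>R g x) \<longlonglongrightarrow> (ramp h (x-a) - ramp h (x-b)) *\<^sub>R g x" for x
      unfolding \<phi>_def by (intro tendsto_intros B)
  qed
  ultimately have "integral {c..d} (\<lambda>x. (indicator {0<..<h} (x-a) - indicator {0<..<h} (x-b)) *\<^sub>R f x)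
    = - integral {c..d} (\<lambda>x. (ramp h (x-a) - ramp h (x-b)) *\<^sub>R g x)"
    unfolding eq by (rule LIMSEQ_unique)
  moreover have "((\<lambda>x. (indicator {0<..<h} (x-a) - indicator {0<..<h} (x-b)) *\<^sub>R f x) has_integral
      integral {a..a+h} f - integral {b..b+h} f) {c..d}"
  proof -
    have 1: "((\<lambda>x. indicator {0<..<h} (x-a) *\<^sub>R f x) has_integral integral {a..a+h} f) {c..d}"
      if "c \<le> a" "a + h \<le> d" for a
    proof -
      have "f integrable_on {a..a+h}"
        using integrable_on_subinterval[of f "{c..d}" a "a+h"] f that by (auto simp: absolutely_integrable_on_def)
      then have "((\<lambda>x. if x \<in> {a..a+h} then f x else 0) has_integral integral {a..a+h} f) {c..d}"
        using has_integral_restrict[of "{a..a+h}" "{c..d}" f] that by (auto simp: has_integral_integral)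
      then show ?thesis
        by (rule has_integral_spike[of "{a,a+h}", rotated 2]) (auto simp: indicator_def)
    qed
    show ?thesis
      using has_integral_diff[OF 1[of a] 1[of b]] ab by (simp add: scaleR_left_diff_distrib)
  qed
  ultimately have "integral {a..a+h} f - integral {b..b+h} f =
      - integral {c..d} (\<lambda>x. (ramp h (x - a) - ramp h (x - b)) *\<^sub>R g x)"
    by (simp add: integral_unique)
  from arg_cong[OF this, of uminus] show ?thesis by simp
qed

lemma ramp_bounds: "h > 0 \<Longrightarrow> 0 \<le> ramp h x" "h > 0 \<Longrightarrow> ramp h x \<le> h"
  by (auto simp: ramp_def)

lemma ramp_limit:
  assumes "\<And>n. h n > 0" "h \<longlonglongrightarrow> 0"
  shows "(\<lambda>n. ramp (h n) x / h n) \<longlonglongrightarrow> (if x \<le> 0 then 0 else 1)"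
proof (cases "x \<le> 0")
  case True
  then have "ramp (h n) x = 0" for n using assms(1)[of n] by (simp add: ramp_def)
  with True show ?thesis by simp
next
  case False
  then have "\<forall>\<^sub>F n in sequentially. h n < x"
    using order_tendstoD(2)[OF assms(2)] by auto
  then have "\<forall>\<^sub>F n in sequentially. ramp (h n) x / h n = 1"
  proof eventually_elim
    case (elim n)
    then show ?case using assms(1)[of n] by (simp add: ramp_def)
  qed
  with False show ?thesis by (simp add: tendsto_eventually)
qed

text \<open>Lebesgue differentiation with one-sided averages, in the form of
  \<open>integrable_ccontinuous_explicit\<close>, applied to the extension of \<open>f\<close> by
  zero. The condition \<open>x + h n \<le> d\<close> keeps each average inside the interval, where
  the extension agrees with \<open>f\<close>.\<close>

lemma ae_right_derivative:
  fixes f :: "real \<Rightarrow> 'a::euclidean_space"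
  assumes f: "f absolutely_integrable_on {c..d}"
  obtains N where "negligible N"
    "\<And>x h. \<lbrakk>c < x; x < d; x \<notin> N; \<And>n. h n > 0; \<And>n. x + h n \<le> d; h \<longlonglongrightarrow> 0\<rbrakk> \<Longrightarrow>
       (\<lambda>n. integral {x..x + h n} f /\<^sub>R h n) \<longlonglongrightarrow> f x"
proof -
  let ?f = "\<lambda>x. if x \<in> {c..d} then f x else 0"
  have "?f absolutely_integrable_on UNIV"
    using f by (simp only: absolutely_integrable_restrict_UNIV)
  then have "?f integrable_on cbox a b" for a b
    by (rule integrable_on_subcbox[OF set_lebesgue_integral_eq_integral(1)]) auto
  then obtain N where N: "negligible N" "\<And>x e. \<lbrakk>x \<notin> N; 0 < e\<rbrakk> \<Longrightarrow>
      \<exists>\<delta>>0. \<forall>h. 0 < h \<and> h < \<delta> \<longrightarrow> norm (integral (cbox x (x + h *\<^sub>R One)) ?f /\<^sub>R h ^ DIM(real) - ?f x) < e"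
    by (rule integrable_ccontinuous_explicit[of ?f]) blast
  show ?thesis
  proof (rule that[OF N(1)])
    fix x and h :: "nat \<Rightarrow> real"
    assume x: "c < x" "x < d" "x \<notin> N" and h: "\<And>n. h n > 0" "\<And>n. x + h n \<le> d" "h \<longlonglongrightarrow> 0"
    show "(\<lambda>n. integral {x..x + h n} f /\<^sub>R h n) \<longlonglongrightarrow> f x"
    proof (rule tendstoI)
      fix e :: real assume "e > 0"
      from N(2)[OF x(3) this] obtain \<delta> where "\<delta> > 0"
        and \<delta>: "\<And>h. 0 < h \<Longrightarrow> h < \<delta> \<Longrightarrow> norm (integral {x..x + h} ?f /\<^sub>R h - ?f x) < e"
        by auto
      have eq: "integral {x..x + h n} ?f = integral {x..x + h n} f" for n
        using x h(2)[of n] by (intro integral_cong) auto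
      have "\<forall>\<^sub>F n in sequentially. h n < \<delta>" using order_tendstoD(2)[OF h(3) \<open>\<delta> > 0\<close>] .
      then show "\<forall>\<^sub>F n in sequentially. dist (integral {x..x + h n} f /\<^sub>R h n) (f x) < e"
      proof eventually_elim
        case (elim n)
        have "norm (integral {x..x + h n} f /\<^sub>R h n - f x) < e"
          using \<delta>[OF h(1) elim, unfolded eq] x by simp
        then show ?case by (simp add: dist_norm)
      qed
    qed
  qed
qed

text \<open>Divide the identity of \<open>weak_derivative_differences\<close> by h and let h tend to
  0. The averages on the left converge to values of \<open>f\<close> off a null set, and on the
  right the trapezoids divided by h are bounded by 1 and tend to the indicator function of the
  interval from a to b.\<close>

lemma weak_derivative_imp_primitive:
  fixes f g :: "real \<Rightarrow> 'a::euclidean_space"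
  assumes f: "f absolutely_integrable_on {c..d}" and g: "g absolutely_integrable_on {c..d}"
    and weak: "\<And>\<phi> \<phi>'. \<lbrakk>smooth_real \<phi>; \<And>x. (\<phi> has_real_derivative \<phi>' x) (at x);
        \<And>x. x \<notin> {c..d} \<Longrightarrow> \<phi> x = 0\<rbrakk> \<Longrightarrow>
        integral {c..d} (\<lambda>x. \<phi>' x *\<^sub>R f x) = - integral {c..d} (\<lambda>x. \<phi> x *\<^sub>R g x)"
  obtains N where "negligible N"
    "\<And>a b. \<lbrakk>c < a; a < b; b < d; a \<notin> N; b \<notin> N\<rbrakk> \<Longrightarrow> f b - f a = integral {a..b} g"
proof -
  obtain N where N: "negligible N"
    "\<And>x h. \<lbrakk>c < x; x < d; x \<notin> N; \<And>n. h n > 0; \<And>n. x + h n \<le> d; h \<longlonglongrightarrow> 0\<rbrakk> \<Longrightarrow>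
       (\<lambda>n. integral {x..x + h n} f /\<^sub>R h n) \<longlonglongrightarrow> f x"
    using ae_right_derivative[OF f] by blast
  show ?thesis
  proof (rule that[OF N(1)])
    fix a b assume ab: "c < a" "a < b" "b < d" "a \<notin> N" "b \<notin> N"
    \<comment> \<open>The factor \<open>d - b\<close> ensures \<open>b + h n \<le> d\<close> already
      for n = 0.\<close>
    define h where "h n = (d - b) * inverse (real (Suc n))" for n
    have h0: "h n > 0" for n using ab by (simp add: h_def)
    have hd: "h n \<le> d - b" for n
      using mult_left_mono[of "inverse (real (Suc n))" 1 "d - b"] ab
      by (simp add: h_def inverse_le_1_iff)
    have "h \<longlonglongrightarrow> (d - b) * 0"
      unfolding h_def by (intro tendsto_intros LIMSEQ_inverse_real_of_nat)
    then have hlim: "h \<longlonglongrightarrow> 0" by simp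
    have hb: "b + h n \<le> d" "a + h n \<le> d" for n using hd[of n] ab by auto
    let ?r = "\<lambda>n x. (ramp (h n) (x - a) - ramp (h n) (x - b)) / h n"
    have 1: "(\<lambda>n. integral {b..b + h n} f /\<^sub>R h n - integral {a..a + h n} f /\<^sub>R h n) \<longlonglongrightarrow> f b - f a"
      by (intro tendsto_diff N(2)) (use ab h0 hb hlim in auto)
    have 2: "integral {b..b + h n} f /\<^sub>R h n - integral {a..a + h n} f /\<^sub>R h n =
        integral {c..d} (\<lambda>x. ?r n x *\<^sub>R g x)" for n
    proof -
      have "integral {b..b + h n} f - integral {a..a + h n} f =
          integral {c..d} (\<lambda>x. (ramp (h n) (x - a) - ramp (h n) (x - b)) *\<^sub>R g x)"
        by (rule weak_derivative_differences[OF f g weak]) (use ab hb h0 in auto)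
      then have "inverse (h n) *\<^sub>R (integral {b..b + h n} f - integral {a..a + h n} f) =
          integral {c..d} (\<lambda>x. inverse (h n) *\<^sub>R ((ramp (h n) (x - a) - ramp (h n) (x - b)) *\<^sub>R g x))"
        by (simp only: integral_cmul)
      then show ?thesis by (simp add: scaleR_diff_right divide_inverse mult.commute)
    qed
    have 3: "(\<lambda>n. integral {c..d} (\<lambda>x. ?r n x *\<^sub>R g x)) \<longlonglongrightarrow>
        integral {c..d} (\<lambda>x. ((if x - a \<le> 0 then 0 else 1) - (if x - b \<le> 0 then 0 else 1)) *\<^sub>R g x)"
    proof (rule dominated_convergence(2))
      show "(\<lambda>x. ?r n x *\<^sub>R g x) integrable_on {c..d}" for n
        using h0[of n] by (intro absolutely_integrable_scaleR_continuous[OF g, THEN set_lebesgue_integral_eq_integral(1)]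
            continuous_intros continuous_on_ramp) auto
      show "(\<lambda>x. norm (g x)) integrable_on {c..d}"
        using g by (auto simp: absolutely_integrable_on_def)
      show "norm (?r n x *\<^sub>R g x) \<le> norm (g x)" for n x
      proof -
        have "\<bar>?r n x\<bar> \<le> 1"
          using h0[of n] ramp_bounds[of "h n" "x - a"] ramp_bounds[of "h n" "x - b"]
          by (simp add: abs_divide abs_le_iff)
        then show ?thesis unfolding norm_scaleR by (rule mult_left_le_one_le[OF norm_ge_zero abs_ge_zero])
      qed
      show "(\<lambda>n. ?r n x *\<^sub>R g x) \<longlonglongrightarrow> ((if x - a \<le> 0 then 0 else 1) - (if x - b \<le> 0 then 0 else 1)) *\<^sub>R g x" for x
        unfolding diff_divide_distrib by (intro tendsto_intros ramp_limit h0 hlim)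
    qed
    have 4: "integral {c..d} (\<lambda>x. ((if x - a \<le> 0 then 0 else 1) - (if x - b \<le> 0 then 0 else 1)) *\<^sub>R g x) =
        integral {a..b} g"
    proof -
      have "g integrable_on {a..b}"
        using integrable_on_subinterval[of g "{c..d}" a b] g ab by (auto simp: absolutely_integrable_on_def)
      then have "((\<lambda>x. if x \<in> {a..b} then g x else 0) has_integral integral {a..b} g) {c..d}"
        using has_integral_restrict[of "{a..b}" "{c..d}" g] ab by (auto simp: has_integral_integral)
      \<comment> \<open>The limit of the trapezoids is the indicator function of the half-open
        interval (a, b], which differs from that of \<open>{a..b}\<close> at the point
        \<open>a\<close> only.\<close>
      then have "((\<lambda>x. ((if x - a \<le> 0 then 0 else 1) - (if x - b \<le> 0 then 0 else 1)) *\<^sub>R g x) has_integral integral {a..b} g) {c..d}"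
        by (rule has_integral_spike[of "{a}", rotated 2]) (use ab in auto)
      then show ?thesis by (rule integral_unique)
    qed
    show "f b - f a = integral {a..b} g"
      using LIMSEQ_unique[OF 1[unfolded 2] 3] unfolding 4 .
  qed
qed

subsection \<open>Completeness of the Hilbert space\<close>

lemma L2_cases:
  obtains f where "square_integrable f" "\<phi> = abs_L2 f"
proof -
  have "L2_rel (rep_L2 \<phi>) (rep_L2 \<phi>)" "abs_L2 (rep_L2 \<phi>) = \<phi>"
    using Quotient_rep_reflp[OF Quotient_L2] Quotient_abs_rep[OF Quotient_L2] by auto
  then show ?thesis using that[of "rep_L2 \<phi>"] by (auto simp: L2_rel_def)
qed

lemma L2_rel_refl: "square_integrable f \<Longrightarrow> L2_rel f f"
  by (simp add: L2_rel_def)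

lemma abs_L2_eq_iff:
  assumes "square_integrable f" "square_integrable g"
  shows "abs_L2 f = abs_L2 g \<longleftrightarrow> (AE x in lebesgue_on I0. f x = g x)"
  using Quotient_rel[OF Quotient_L2, of f g] assms by (auto simp: L2_rel_def)

lemma abs_L2_add:
  "square_integrable f \<Longrightarrow> square_integrable g \<Longrightarrow> abs_L2 f + abs_L2 g = abs_L2 (\<lambda>x. f x + g x)"
  by (simp add: plus_L2.abs_eq L2_rel_refl)

lemma abs_L2_scaleC: "square_integrable f \<Longrightarrow> c *\<^sub>C abs_L2 f = abs_L2 (\<lambda>x. c *s f x)"
  by (simp add: scaleC.abs_eq L2_rel_refl)

lemma cinner_abs_L2:
  "square_integrable f \<Longrightarrow> square_integrable g \<Longrightarrow>
    cinner (abs_L2 f) (abs_L2 g) = (\<integral>x. cdot (f x) (g x) \<partial>lebesgue_on I0)"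
  by (simp add: cinner.abs_eq L2_rel_refl)

lemma square_integrable_diff:
  assumes "square_integrable f" "square_integrable g"
  shows "square_integrable (\<lambda>x. f x - g x)"
  using square_integrable_add[OF assms(1) square_integrable_scaleC[OF assms(2), of "-1"]]
  by (simp add: vector_smult_lneg)

lemma abs_L2_diff:
  assumes "square_integrable f" "square_integrable g"
  shows "abs_L2 f - abs_L2 g = abs_L2 (\<lambda>x. f x - g x)"
proof -
  have "abs_L2 f - abs_L2 g = abs_L2 f + (-1) *\<^sub>C abs_L2 g"
    by (simp only: minus_L2_def uminus_L2_def)
  also have "\<dots> = abs_L2 (\<lambda>x. f x + (-1) *s g x)"
    by (simp only: abs_L2_scaleC[OF assms(2)] abs_L2_add[OF assms(1) square_integrable_scaleC[OF assms(2)]])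
  finally show ?thesis by (simp add: vector_smult_lneg)
qed

lemma abs_L2_zero: "abs_L2 (\<lambda>x. 0) = 0"
  by (simp add: zero_L2_def)

lemma norm_abs_L2:
  assumes "square_integrable f"
  shows "(norm (abs_L2 f))\<^sup>2 = (\<integral>x. (norm (f x))\<^sup>2 \<partial>lebesgue_on I0)"
proof -
  have "complex_of_real ((norm (abs_L2 f))\<^sup>2) = cinner (abs_L2 f) (abs_L2 f)"
    by (simp add: cinner_self power2_norm_eq_inner)
  also have "\<dots> = of_real (\<integral>x. (norm (f x))\<^sup>2 \<partial>lebesgue_on I0)"
    by (simp add: cinner_abs_L2 assms cdot_self integral_complex_of_real del: of_real_power)
  finally show ?thesis by (simp only: of_real_eq_iff)
qed

lemma nn_integral_norm_abs_L2:
  assumes "square_integrable f"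
  shows "(\<integral>\<^sup>+x. ennreal ((norm (f x))\<^sup>2) \<partial>lebesgue_on I0) = ennreal ((norm (abs_L2 f))\<^sup>2)"
  using assms by (subst nn_integral_eq_integral) (auto simp: square_integrable_def norm_abs_L2)

text \<open>The squared norms of the increments are at most \<open>(1/4)^n\<close>, so they remain
  summable after multiplication by \<open>2^n\<close>. By monotone convergence the weighted sum of
  the squared increments is finite at almost every point, and the weight is what turns this into
  absolute convergence of the increments themselves.\<close>

lemma L2_fast_Cauchy_AE_convergent:
  assumes F: "\<And>n. square_integrable (F n)"
    and fast: "\<And>n. norm (abs_L2 (F (Suc n)) - abs_L2 (F n)) \<le> (1/2) ^ n"
  shows "AE x in lebesgue_on I0. convergent (\<lambda>n. F n x)"
proof -
  let ?M = "lebesgue_on I0"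
  define d where "d n x = F (Suc n) x - F n x" for n x
  have sd: "square_integrable (d n)" for n
    unfolding d_def by (intro square_integrable_diff F)
  note [measurable] = square_integrable_measurable[OF sd]
  have nd: "(norm (abs_L2 (d n)))\<^sup>2 \<le> (1/4) ^ n" for n
  proof -
    have "(norm (abs_L2 (d n)))\<^sup>2 \<le> ((1/2) ^ n)\<^sup>2"
      using fast[of n] F by (intro power_mono) (auto simp: abs_L2_diff d_def[abs_def])
    also have "\<dots> = (1/4) ^ n"
      by (simp add: power2_eq_square flip: power_mult_distrib)
    finally show ?thesis .
  qed
  have "(\<integral>\<^sup>+x. (\<Sum>n. ennreal (2 ^ n * (norm (d n x))\<^sup>2)) \<partial>?M)
      = (\<Sum>n. \<integral>\<^sup>+x. ennreal (2 ^ n * (norm (d n x))\<^sup>2) \<partial>?M)"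
    by (rule nn_integral_suminf) measurable
  also have "\<dots> = (\<Sum>n. ennreal (2 ^ n) * ennreal ((norm (abs_L2 (d n)))\<^sup>2))"
  proof (rule suminf_cong)
    fix n
    have "(\<integral>\<^sup>+x. ennreal (2 ^ n * (norm (d n x))\<^sup>2) \<partial>?M)
        = (\<integral>\<^sup>+x. ennreal (2 ^ n) * ennreal ((norm (d n x))\<^sup>2) \<partial>?M)"
      by (intro nn_integral_cong ennreal_mult) auto
    also have "\<dots> = ennreal (2 ^ n) * (\<integral>\<^sup>+x. ennreal ((norm (d n x))\<^sup>2) \<partial>?M)"
      by (rule nn_integral_cmult) measurable
    finally show "(\<integral>\<^sup>+x. ennreal (2 ^ n * (norm (d n x))\<^sup>2) \<partial>?M)
        = ennreal (2 ^ n) * ennreal ((norm (abs_L2 (d n)))\<^sup>2)"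
      unfolding nn_integral_norm_abs_L2[OF sd] .
  qed
  also have "\<dots> \<le> (\<Sum>n. ennreal ((1/2) ^ n))"
  proof (rule suminf_le)
    fix n
    have "2 ^ n * (norm (abs_L2 (d n)))\<^sup>2 \<le> 2 ^ n * (1/4) ^ n"
      using nd[of n] by (intro mult_left_mono) auto
    also have "\<dots> = (1/2::real) ^ n" by (simp flip: power_mult_distrib)
    finally have "ennreal (2 ^ n * (norm (abs_L2 (d n)))\<^sup>2) \<le> ennreal ((1/2) ^ n)"
      by (rule ennreal_leI)
    then show "ennreal (2 ^ n) * ennreal ((norm (abs_L2 (d n)))\<^sup>2) \<le> ennreal ((1/2) ^ n)"
      by (subst ennreal_mult[symmetric]) auto
  qed auto
  also have "\<dots> < \<infinity>"
  proof -
    have "(\<lambda>n. (1/2::real) ^ n) sums 2" using geometric_sums[of "1/2::real"] by simp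
    then have "(\<Sum>n. ennreal ((1/2) ^ n)) = ennreal 2" by (intro suminf_ennreal_eq) auto
    then show ?thesis by (simp only: ennreal_less_top infinity_ennreal_def)
  qed
  finally have "AE x in ?M. (\<Sum>n. ennreal (2 ^ n * (norm (d n x))\<^sup>2)) \<noteq> \<infinity>"
    by (intro nn_integral_noteq_infinite) auto
  then show ?thesis
  proof eventually_elim
    case (elim x)
    then have s: "summable (\<lambda>n. 2 ^ n * (norm (d n x))\<^sup>2)"
      by (intro summable_suminf_not_top) auto
    have "summable (\<lambda>n. norm (d n x))"
    proof (rule summable_comparison_test')
      show "summable (\<lambda>n. (1/2) ^ n + 2 ^ n * (norm (d n x))\<^sup>2)"
        using s by (intro summable_add summable_geometric) auto
      fix n
      let ?a = "norm (d n x)"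
      \<comment> \<open>The weighted inequality between the geometric and the arithmetic mean,
        bounding the increment by a geometric term plus the weighted square.\<close>
      have "0 \<le> (1 / 2 ^ n) * (1 - 2 ^ n * ?a)\<^sup>2" by simp
      also have "\<dots> = (1/2) ^ n + 2 ^ n * ?a\<^sup>2 - 2 * ?a"
        by (simp add: power2_eq_square field_simps)
      finally have "?a \<le> (1/2) ^ n + 2 ^ n * ?a\<^sup>2"
        using norm_ge_zero[of "d n x"] by linarith
      then show "norm ?a \<le> (1/2) ^ n + 2 ^ n * ?a\<^sup>2" by simp
    qed
    then have "summable (\<lambda>n. d n x)" by (rule summable_norm_cancel)
    then have "convergent (\<lambda>n. \<Sum>k<n. d k x)"
      by (simp add: summable_iff_convergent)
    moreover have "(\<Sum>k<n. d k x) = F n x - F 0 x" for n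
      by (induction n) (auto simp: d_def)
    ultimately have "convergent (\<lambda>n. F n x - F 0 x)" by simp
    then show ?case
      using convergent_add[of "\<lambda>n. F n x - F 0 x" "\<lambda>n. F 0 x"] by (simp add: convergent_const)
  qed
qed

text \<open>Fatou's lemma yields the membership of the limit in the space together with the norm
  bound. Applied to \<open>f m - f (s n)\<close> with \<open>m\<close> fixed, it estimates the
  distance of \<open>f m\<close> to the limit function.\<close>

lemma L2_Fatou:
  assumes F: "\<And>n. square_integrable (F n)" and g: "g \<in> borel_measurable (lebesgue_on I0)"
    and lim: "AE x in lebesgue_on I0. (\<lambda>n. F n x) \<longlonglongrightarrow> g x"
    and le: "\<And>n. n \<ge> N \<Longrightarrow> norm (abs_L2 (F n)) \<le> e"
  shows "square_integrable g" "norm (abs_L2 g) \<le> e"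
proof -
  let ?M = "lebesgue_on I0"
  have e: "e \<ge> 0" using order_trans[OF norm_ge_zero le[of N]] by simp
  note [measurable] = square_integrable_measurable[OF F] g
  have "(\<integral>\<^sup>+x. ennreal ((norm (g x))\<^sup>2) \<partial>?M) = (\<integral>\<^sup>+x. liminf (\<lambda>n. ennreal ((norm (F n x))\<^sup>2)) \<partial>?M)"
  proof (rule nn_integral_cong_AE)
    show "AE x in ?M. ennreal ((norm (g x))\<^sup>2) = liminf (\<lambda>n. ennreal ((norm (F n x))\<^sup>2))"
      using lim
    proof eventually_elim
      case (elim x)
      then have "(\<lambda>n. ennreal ((norm (F n x))\<^sup>2)) \<longlonglongrightarrow> ennreal ((norm (g x))\<^sup>2)"
        by (intro tendsto_intros)
      from lim_imp_Liminf[OF _ this] show ?case by simp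
    qed
  qed
  also have "\<dots> \<le> liminf (\<lambda>n. \<integral>\<^sup>+x. ennreal ((norm (F n x))\<^sup>2) \<partial>?M)"
    by (rule nn_integral_liminf) measurable
  also have "\<dots> \<le> limsup (\<lambda>n. \<integral>\<^sup>+x. ennreal ((norm (F n x))\<^sup>2) \<partial>?M)"
    by (rule Liminf_le_Limsup) simp
  also have "\<dots> \<le> ennreal (e\<^sup>2)"
  proof (rule Limsup_bounded)
    show "\<forall>\<^sub>F n in sequentially. (\<integral>\<^sup>+x. ennreal ((norm (F n x))\<^sup>2) \<partial>?M) \<le> ennreal (e\<^sup>2)"
      using eventually_ge_at_top[of N]
    proof eventually_elim
      case (elim n)
      then show ?case
        unfolding nn_integral_norm_abs_L2[OF F] by (intro ennreal_leI power_mono le) auto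
    qed
  qed
  finally have le': "(\<integral>\<^sup>+x. ennreal ((norm (g x))\<^sup>2) \<partial>?M) \<le> ennreal (e\<^sup>2)" .
  have "integrable ?M (\<lambda>x. (norm (g x))\<^sup>2)"
    by (rule integrableI_bounded) (use le' in \<open>auto intro: le_less_trans simp: ennreal_less_top\<close>)
  then show sq: "square_integrable g" using g by (simp add: square_integrable_def)
  from le' have "(norm (abs_L2 g))\<^sup>2 \<le> e\<^sup>2"
    using e by (simp add: nn_integral_norm_abs_L2[OF sq])
  then show "norm (abs_L2 g) \<le> e" using e by (rule power2_le_imp_le)
qed

text \<open>The Riesz-Fischer theorem. It supplies the orthogonal projections, onto the closure of
  the domain to prove density and onto the closure of the graph to split the adjoint.\<close>

instance L2 :: complete_space
proof
  fix X :: "nat \<Rightarrow> L2" assume X: "Cauchy X"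
  have "\<exists>f. square_integrable f \<and> X n = abs_L2 f" for n by (metis L2_cases)
  then obtain f where f: "\<And>n. square_integrable (f n)" "\<And>n. X n = abs_L2 (f n)" by metis
  have "\<exists>N. \<forall>m\<ge>N. \<forall>n\<ge>N. norm (X m - X n) < (1/2) ^ k" for k
    using X unfolding Cauchy_iff by (auto dest: spec[of _ "(1/2)^k"])
  then obtain N where N: "\<And>k m n. m \<ge> N k \<Longrightarrow> n \<ge> N k \<Longrightarrow> norm (X m - X n) < (1/2) ^ k" by metis
  \<comment> \<open>The maximum makes \<open>s\<close> monotone with \<open>s k \<ge> N k\<close>,
    so consecutive terms are within \<open>(1/2)^k\<close>. The summand \<open>k\<close> gives
    \<open>s n \<ge> n\<close>, so that \<open>s n\<close> exceeds \<open>N k\<close> whenever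
    \<open>n\<close> does.\<close>
  define s where "s k = Max (N ` {..k}) + k" for k
  have sN: "s k \<ge> N k" for k
    using Max_ge[of "N ` {..k}" "N k"] by (simp add: s_def trans_le_add1)
  have ss: "s k \<ge> k" and smono: "k \<le> l \<Longrightarrow> s k \<le> s l" for k l
    by (auto simp: s_def intro!: add_mono Max_mono)
  have fast: "norm (abs_L2 (f (s (Suc n))) - abs_L2 (f (s n))) \<le> (1/2) ^ n" for n
    using N[of n "s (Suc n)" "s n"] sN[of n] smono[of n "Suc n"] by (simp add: f)
  define g where "g x = lim (\<lambda>n. f (s n) x)" for x
  have lim: "AE x in lebesgue_on I0. (\<lambda>n. f (s n) x) \<longlonglongrightarrow> g x"
    using L2_fast_Cauchy_AE_convergent[of "\<lambda>n. f (s n)", OF f(1) fast]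
    unfolding g_def convergent_LIMSEQ_iff .
  have g: "g \<in> borel_measurable (lebesgue_on I0)"
    unfolding g_def by (rule borel_measurable_lim_metric) (use f in \<open>auto dest: square_integrable_measurable\<close>)
  have *: "square_integrable (\<lambda>x. f m x - g x) \<and> norm (abs_L2 (\<lambda>x. f m x - g x)) \<le> (1/2)^k"
    if "m \<ge> N k" for m k
  proof -
    have le: "norm (abs_L2 (\<lambda>x. f m x - f (s n) x)) \<le> (1/2)^k" if "n \<ge> N k" for n
      using N[of k m "s n"] \<open>m \<ge> N k\<close> that ss[of n] by (auto simp: f abs_L2_diff intro: less_imp_le)
    have "AE x in lebesgue_on I0. (\<lambda>n. f m x - f (s n) x) \<longlonglongrightarrow> f m x - g x"
      using lim by eventually_elim (intro tendsto_intros)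
    from L2_Fatou[OF square_integrable_diff[OF f(1)[of m] f(1)[of "s _"]] _ this le] show ?thesis
      using g square_integrable_measurable[OF f(1)] by auto
  qed
  have gs: "square_integrable g"
    using square_integrable_diff[OF f(1)[of "N 0"] conjunct1[OF *[OF order_refl[of "N 0"]]]] by simp
  have "X \<longlonglongrightarrow> abs_L2 g"
  proof (rule LIMSEQ_I)
    fix r :: real assume "r > 0"
    then obtain k where k: "(1/2) ^ k < r" using real_arch_pow_inv[of r "1/2"] by auto
    show "\<exists>no. \<forall>n\<ge>no. norm (X n - abs_L2 g) < r"
    proof (intro exI[of _ "N k"] allI impI)
      fix n assume "n \<ge> N k"
      from *[OF this] k show "norm (X n - abs_L2 g) < r" by (simp add: f abs_L2_diff gs)
    qed
  qed
  then show "convergent X" by (auto simp: convergent_def)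
qed

subsection \<open>Adjoints and the von Neumann decomposition\<close>

text \<open>A minimising sequence for the distance is Cauchy by the parallelogram law, and its limit
  is the foot of the perpendicular. The real inner product is used so that the statement covers both
  \<open>L2\<close> and the product space that contains the graphs.\<close>

lemma closed_subspace_projection:
  fixes S :: "'a::{real_inner, complete_space} set"
  assumes S: "subspace S" "closed S"
  obtains y where "y \<in> S" "\<And>s. s \<in> S \<Longrightarrow> (x - y) \<bullet> s = 0"
proof -
  define D where "D = (INF s\<in>S. (norm (x - s))\<^sup>2)"
  have S0: "0 \<in> S" using S(1) by (rule subspace_0)
  have bdd: "bdd_below ((\<lambda>s. (norm (x - s))\<^sup>2) ` S)" by (rule bdd_belowI2[of _ 0]) simp
  have D: "D \<le> (norm (x - s))\<^sup>2" if "s \<in> S" for s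
    unfolding D_def using bdd that by (rule cINF_lower)
  have "\<exists>s\<in>S. (norm (x - s))\<^sup>2 < D + inverse (real (Suc n))" for n
    using cINF_less_iff[of S "\<lambda>s. (norm (x - s))\<^sup>2" "D + inverse (real (Suc n))"] S0 bdd
    by (auto simp: D_def)
  then obtain y where y: "\<And>n. y n \<in> S" "\<And>n. (norm (x - y n))\<^sup>2 < D + inverse (real (Suc n))"
    by metis
  have par: "(norm (y m - y n))\<^sup>2 \<le> 2 * inverse (real (Suc m)) + 2 * inverse (real (Suc n))" for m n
  proof -
    have "(1/2) *\<^sub>R (y m + y n) \<in> S" using y(1) S(1) by (intro subspace_scale subspace_add)
    from D[OF this] have "4 * D \<le> (2 * norm (x - (1/2) *\<^sub>R (y m + y n)))\<^sup>2" by simp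
    also have "2 * norm (x - (1/2) *\<^sub>R (y m + y n)) = norm ((x - y m) + (x - y n))"
    proof -
      have "2 * norm (x - (1/2) *\<^sub>R (y m + y n)) = norm (2 *\<^sub>R (x - (1/2) *\<^sub>R (y m + y n)))" by simp
      also have "2 *\<^sub>R (x - (1/2) *\<^sub>R (y m + y n)) = (x - y m) + (x - y n)"
        by (simp add: scaleR_diff_right scaleR_2)
      finally show ?thesis .
    qed
    also have "(norm ((x - y m) + (x - y n)))\<^sup>2 =
        2 * (norm (x - y m))\<^sup>2 + 2 * (norm (x - y n))\<^sup>2 - (norm ((x - y n) - (x - y m)))\<^sup>2"
      by (simp only: power2_norm_eq_inner inner_add_left inner_add_right inner_diff_left inner_diff_right)
        (simp add: inner_commute)
    also have "(x - y n) - (x - y m) = y m - y n" by simp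
    finally show ?thesis using y(2)[of m] y(2)[of n] by linarith
  qed
  have "Cauchy y"
  proof (rule CauchyI)
    fix e :: real assume e: "e > 0"
    obtain N where N: "inverse (real (Suc N)) < e\<^sup>2 / 4"
      using reals_Archimedean[of "e\<^sup>2 / 4"] e by auto
    show "\<exists>M. \<forall>m\<ge>M. \<forall>n\<ge>M. norm (y m - y n) < e"
    proof (intro exI[of _ N] allI impI)
      fix m n assume "m \<ge> N" "n \<ge> N"
      then have "inverse (real (Suc m)) \<le> inverse (real (Suc N))" "inverse (real (Suc n)) \<le> inverse (real (Suc N))"
        by (auto intro!: le_imp_inverse_le)
      with par[of m n] N have "(norm (y m - y n))\<^sup>2 < e\<^sup>2" by linarith
      then show "norm (y m - y n) < e" using e power2_less_imp_less[of "norm (y m - y n)" e] by simp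
    qed
  qed
  then obtain l where l: "y \<longlonglongrightarrow> l" using Cauchy_convergent by (auto simp: convergent_def)
  have lS: "l \<in> S" using closed_sequentially[OF S(2) _ l] y(1) by blast
  have lim1: "(\<lambda>n. (norm (x - y n))\<^sup>2) \<longlonglongrightarrow> (norm (x - l))\<^sup>2" by (intro tendsto_intros l)
  have lim2: "(\<lambda>n. D + inverse (real (Suc n))) \<longlonglongrightarrow> D + 0"
    by (intro tendsto_intros LIMSEQ_inverse_real_of_nat)
  have min: "(norm (x - l))\<^sup>2 \<le> D"
    using LIMSEQ_le[OF lim1 lim2] y(2) by (auto intro: less_imp_le)
  show ?thesis
  proof (rule that[OF lS])
    fix s assume s: "s \<in> S"
    let ?c = "(x - l) \<bullet> s"
    show "?c = 0"
    proof (cases "s = 0")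
      case False
      \<comment> \<open>The value of \<open>t\<close> that minimises the distance of
        \<open>x\<close> to \<open>l + t *\<^sub>R s\<close>. The gain over \<open>l\<close> is the
        square of the inner product divided by \<open>s \<bullet> s\<close>, which minimality of
        \<open>l\<close> forces to be 0.\<close>
      define t where "t = ?c / (s \<bullet> s)"
      have ss: "s \<bullet> s > 0" using False by simp
      have "l + t *\<^sub>R s \<in> S" using lS s S(1) by (intro subspace_add subspace_scale)
      from order_trans[OF min D[OF this]]
      have "(norm (x - l))\<^sup>2 \<le> (norm ((x - l) - t *\<^sub>R s))\<^sup>2" by (simp add: diff_diff_eq)
      also have "\<dots> = (norm (x - l))\<^sup>2 - 2 * t * ?c + t * t * (s \<bullet> s)"
        unfolding power2_norm_eq_inner
        by (simp add: inner_diff_left[of "x - l" "t *\<^sub>R s"] inner_diff_right[of _ "x - l" "t *\<^sub>R s"] inner_commute[of s "x - l"], simp add: algebra_simps)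
      also have "\<dots> = (norm (x - l))\<^sup>2 - ?c\<^sup>2 / (s \<bullet> s)"
        using ss by (simp add: t_def power2_eq_square)
      finally have "?c\<^sup>2 / (s \<bullet> s) \<le> 0" by simp
      then show ?thesis using ss by (simp add: divide_le_0_iff)
    qed simp
  qed
qed

section \<open>The complex inner product, linear graphs and their adjoints\<close>

lemma cinner_add_right: "cinner \<xi> (\<phi> + \<psi>) = cinner \<xi> \<phi> + cinner \<xi> \<psi>"
  unfolding cinner_commute[of \<xi>] by (simp add: cinner_add_left)

lemma cinner_scaleC_right: "cinner \<psi> (c *\<^sub>C \<phi>) = c * cinner \<psi> \<phi>"
  unfolding cinner_commute[of \<psi>] by (simp add: cinner_scaleC_left)

lemma cinner_zero_left [simp]: "cinner 0 \<phi> = 0"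
  using cinner_scaleC_left[of 0 0 \<phi>] by simp

lemma cinner_minus_left: "cinner (- \<phi>) \<psi> = - cinner \<phi> \<psi>"
  by (simp only: uminus_L2_def cinner_scaleC_left) simp

lemma cinner_minus_right: "cinner \<psi> (- \<phi>) = - cinner \<psi> \<phi>"
  by (simp only: uminus_L2_def cinner_scaleC_right) simp

lemma cinner_diff_left: "cinner (\<phi> - \<psi>) \<xi> = cinner \<phi> \<xi> - cinner \<psi> \<xi>"
  by (simp only: minus_L2_def cinner_add_left cinner_minus_left) simp

text \<open>The imaginary part is a real inner product with a rotated vector. So continuity passes
  from the real to the complex inner product, and real orthogonality to a complex subspace is
  complex orthogonality.\<close>

lemma cinner_eq_Complex: "cinner \<psi> \<phi> = Complex (\<psi> \<bullet> \<phi>) (\<psi> \<bullet> (- \<i>) *\<^sub>C \<phi>)"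
  by (simp add: inner_L2_def cinner_scaleC_right cinner_minus_right complex_eq_iff)

lemma continuous_on_cinner_left [continuous_intros]:
  assumes "continuous_on S f"
  shows "continuous_on S (\<lambda>x. cinner (f x) \<phi>)"
  unfolding cinner_eq_Complex Complex_eq using assms by (intro continuous_intros)

lemma continuous_on_cinner_right [continuous_intros]:
  assumes "continuous_on S f"
  shows "continuous_on S (\<lambda>x. cinner \<phi> (f x))"
  unfolding cinner_commute[of \<phi>] using assms by (intro continuous_intros)

lemma norm_scaleC_L2: "norm (c *\<^sub>C \<phi> :: L2) = cmod c * norm \<phi>"
proof -
  have "complex_of_real (c *\<^sub>C \<phi> \<bullet> c *\<^sub>C \<phi>) = (c * cnj c) * of_real (\<phi> \<bullet> \<phi>)"
    by (simp only: cinner_self[symmetric] cinner_scaleC_left cinner_scaleC_right) (simp only: mult_ac)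
  also have "\<dots> = of_real ((cmod c)\<^sup>2 * (\<phi> \<bullet> \<phi>))"
    by (simp only: complex_norm_square[symmetric] of_real_mult)
  finally have "c *\<^sub>C \<phi> \<bullet> c *\<^sub>C \<phi> = (cmod c)\<^sup>2 * (\<phi> \<bullet> \<phi>)" by (simp only: of_real_eq_iff)
  then show ?thesis by (simp add: norm_eq_sqrt_inner real_sqrt_mult)
qed

lemma scaleR_scaleC_L2: "r *\<^sub>R \<phi> = of_real r *\<^sub>C (\<phi> :: L2)"
  by (fact scaleR_L2_def)

lemma bounded_linear_scaleC_L2: "bounded_linear (\<lambda>\<phi> :: L2. c *\<^sub>C \<phi>)"
  by (rule bounded_linear_intro[of _ "cmod c"])
    (simp_all add: scaleR_scaleC_L2 scaleC_add_right_L2 scaleC_scaleC_L2 norm_scaleC_L2 mult.commute)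

lemma linear_graphD:
  assumes "linear_graph T"
  shows "(0, 0) \<in> T" "(\<phi>, \<phi>') \<in> T \<Longrightarrow> (\<psi>, \<psi>') \<in> T \<Longrightarrow> (\<phi> + \<psi>, \<phi>' + \<psi>') \<in> T"
    "(\<phi>, \<phi>') \<in> T \<Longrightarrow> (c *\<^sub>C \<phi>, c *\<^sub>C \<phi>') \<in> T"
    "(\<phi>, \<phi>') \<in> T \<Longrightarrow> (\<psi>, \<psi>') \<in> T \<Longrightarrow> (\<phi> - \<psi>, \<phi>' - \<psi>') \<in> T"
proof -
  show 1: "(0, 0) \<in> T" "(\<phi>, \<phi>') \<in> T \<Longrightarrow> (\<psi>, \<psi>') \<in> T \<Longrightarrow> (\<phi> + \<psi>, \<phi>' + \<psi>') \<in> T"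
    "(\<phi>, \<phi>') \<in> T \<Longrightarrow> (c *\<^sub>C \<phi>, c *\<^sub>C \<phi>') \<in> T" for \<phi> \<phi>' \<psi> \<psi>' c
    using assms unfolding linear_graph_def by blast+
  show "(\<phi> - \<psi>, \<phi>' - \<psi>') \<in> T" if "(\<phi>, \<phi>') \<in> T" "(\<psi>, \<psi>') \<in> T"
    unfolding minus_L2_def uminus_L2_def using that by (intro 1)
qed

lemma linear_graph_subspace: "linear_graph T \<Longrightarrow> subspace T"
  by (auto simp: subspace_def zero_prod_def scaleR_scaleC_L2 intro: linear_graphD)

lemma subspace_closure:
  fixes S :: "'a::real_normed_vector set"
  assumes S: "subspace S"
  shows "subspace (closure S)"
proof (rule subspaceI)
  show "0 \<in> closure S" using subspace_0[OF S] closure_subset by blast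
  have "continuous_on (closure (S \<times> S)) (\<lambda>p. fst p + snd p)" by (intro continuous_intros)
  then have "(\<lambda>p. fst p + snd p) ` closure (S \<times> S) \<subseteq> closure S"
    by (rule image_closure_subset) (use S closure_subset[of S] subspace_add in \<open>auto, blast\<close>)
  then show "x + y \<in> closure S" if "x \<in> closure S" "y \<in> closure S" for x y
    using that by (force simp: closure_Times)
  have "(\<lambda>x. c *\<^sub>R x) ` closure S \<subseteq> closure S" for c
  proof (rule image_closure_subset)
    show "continuous_on (closure S) (\<lambda>x. c *\<^sub>R x)" by (intro continuous_intros)
    show "(\<lambda>x. c *\<^sub>R x) ` S \<subseteq> closure S"
      using subspace_scale[OF S] closure_subset[of S] by blast
  qed simp
  then show "c *\<^sub>R x \<in> closure S" if "x \<in> closure S" for c x using that by blast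
qed

lemma linear_graph_closure:
  assumes "linear_graph T"
  shows "linear_graph (closure T)"
proof -
  have sub: "subspace (closure T)"
    using linear_graph_subspace[OF assms] by (rule subspace_closure)
  have "(c *\<^sub>C \<phi>, c *\<^sub>C \<phi>') \<in> closure T" if "(\<phi>, \<phi>') \<in> closure T" for c \<phi> \<phi>'
  proof -
    let ?f = "\<lambda>p :: L2 \<times> L2. (c *\<^sub>C fst p, c *\<^sub>C snd p)"
    have "continuous_on (closure T) ?f"
      by (intro continuous_intros bounded_linear.continuous_on[OF bounded_linear_scaleC_L2])
    moreover have "?f ` T \<subseteq> closure T"
      using linear_graphD(3)[OF assms] closure_subset[of T] by auto
    ultimately have "?f ` closure T \<subseteq> closure T"
      by (intro image_closure_subset) auto
    with that show ?thesis by force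
  qed
  with sub show ?thesis
    unfolding linear_graph_def
    by (auto simp: zero_prod_def dest: subspace_0 subspace_add[of "closure T"])
qed

lemma mem_adjoint_op:
  "(\<psi>, \<eta>) \<in> adjoint_op T \<longleftrightarrow> (\<forall>\<phi> \<phi>'. (\<phi>, \<phi>') \<in> T \<longrightarrow> cinner \<psi> \<phi>' = cinner \<eta> \<phi>)"
  unfolding adjoint_op_def by auto

lemma linear_graph_adjoint: "linear_graph (adjoint_op T)"
  unfolding linear_graph_def by (auto simp: mem_adjoint_op cinner_add_left cinner_scaleC_left)

lemma closed_adjoint: "closed (adjoint_op T)"
proof -
  have "adjoint_op T = (\<Inter>q\<in>T. {p. cinner (fst p) (snd q) = cinner (snd p) (fst q)})"
    unfolding adjoint_op_def case_prod_beta by auto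
  moreover have "closed {p. cinner (fst p) (snd q) = cinner (snd p) (fst q)}" for q :: "L2 \<times> L2"
    by (intro closed_Collect_eq continuous_intros)
  ultimately show ?thesis by auto
qed

lemma adjoint_closure: "adjoint_op (closure T) = adjoint_op T"
proof
  show "adjoint_op (closure T) \<subseteq> adjoint_op T"
    using closure_subset[of T] by (fastforce simp: adjoint_op_def)
  show "adjoint_op T \<subseteq> adjoint_op (closure T)"
  proof clarify
    fix \<psi> \<eta> assume *: "(\<psi>, \<eta>) \<in> adjoint_op T"
    have "closed {p. cinner \<psi> (snd p) = cinner \<eta> (fst p)}"
      by (intro closed_Collect_eq continuous_intros)
    moreover have "T \<subseteq> {p. cinner \<psi> (snd p) = cinner \<eta> (fst p)}"
      using * by (auto simp: adjoint_op_def)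
    ultimately have "closure T \<subseteq> {p. cinner \<psi> (snd p) = cinner \<eta> (fst p)}"
      by (rule closure_minimal[rotated])
    then show "(\<psi>, \<eta>) \<in> adjoint_op (closure T)" by (auto simp: adjoint_op_def)
  qed
qed

lemma adjoint_antimono: "S \<subseteq> T \<Longrightarrow> adjoint_op T \<subseteq> adjoint_op S"
  by (fastforce simp: adjoint_op_def)

lemma adjointD: "(\<psi>, \<eta>) \<in> adjoint_op T \<Longrightarrow> (\<phi>, \<phi>') \<in> T \<Longrightarrow> cinner \<psi> \<phi>' = cinner \<eta> \<phi>"
  by (auto simp: adjoint_op_def)

lemma single_valued_adjoint:
  assumes "closure (Domain T) = UNIV"
  shows "single_valued (adjoint_op T)"
proof (rule single_valuedI)
  fix \<psi> \<eta> \<eta>' assume *: "(\<psi>, \<eta>) \<in> adjoint_op T" "(\<psi>, \<eta>') \<in> adjoint_op T"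
  have "Domain T \<subseteq> {\<phi>. cinner \<eta> \<phi> = cinner \<eta>' \<phi>}"
    using * by (fastforce simp: adjoint_op_def)
  moreover have "closed {\<phi>. cinner \<eta> \<phi> = cinner \<eta>' \<phi>}"
    by (intro closed_Collect_eq continuous_intros)
  ultimately have "UNIV \<subseteq> {\<phi>. cinner \<eta> \<phi> = cinner \<eta>' \<phi>}"
    unfolding assms[symmetric] by (rule closure_minimal)
  then have "cinner (\<eta> - \<eta>') (\<eta> - \<eta>') = 0" by (auto simp: cinner_diff_left)
  then show "\<eta> = \<eta>'" by (simp add: cinner_self)
qed

lemma mem_ker_shift_op: "\<phi> \<in> ker_op (shift_op A z) \<longleftrightarrow> (\<phi>, z *\<^sub>C \<phi>) \<in> A"
  by (auto simp: ker_op_def shift_op_def)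

text \<open>Von Neumann's formula for the domain of the adjoint. Subtracting from the given pair its
  projection onto the closed graph leaves a pair \<open>(c, d)\<close> in the adjoint graph,
  orthogonal to the graph of \<open>T\<close>. The two eigenvectors are half of
  \<open>c - \<i> d\<close> and half of \<open>c + \<i> d\<close>.\<close>

lemma von_Neumann_decomposition:
  assumes T: "linear_graph T" and sym: "T \<subseteq> adjoint_op T" and mem: "(\<psi>, \<eta>) \<in> adjoint_op T"
  obtains a b p m where "(a, b) \<in> closure T" "(p, \<i> *\<^sub>C p) \<in> adjoint_op T"
    "(m, (- \<i>) *\<^sub>C m) \<in> adjoint_op T" "\<psi> = a + p + m" "\<eta> = b + \<i> *\<^sub>C p + (- \<i>) *\<^sub>C m"
proof -
  note adj = linear_graphD[OF linear_graph_adjoint[of T]]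
  have cl: "closure T \<subseteq> adjoint_op T" using closed_adjoint sym by (rule closure_minimal[rotated])
  obtain y where y: "y \<in> closure T" "\<And>s. s \<in> closure T \<Longrightarrow> ((\<psi>, \<eta>) - y) \<bullet> s = 0"
    using closed_subspace_projection[OF linear_graph_subspace[OF linear_graph_closure[OF T]] closed_closure]
    by blast
  obtain a b where ab: "y = (a, b)" by force
  define c d where "c = \<psi> - a" and "d = \<eta> - b"
  have cd: "(c, d) \<in> adjoint_op T"
    unfolding c_def d_def using y(1) ab cl by (intro adj mem) auto
  have perp: "c \<bullet> \<phi> + d \<bullet> \<phi>' = 0" if "(\<phi>, \<phi>') \<in> T" for \<phi> \<phi>'
    using y(2)[of "(\<phi>, \<phi>')"] that closure_subset[of T] by (auto simp: ab c_def d_def inner_prod_def)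
  \<comment> \<open>orthogonality to the graph of \<open>T\<close> means that \<open>(d, -c)\<close> is in the graph of the adjoint, as is \<open>(c, d)\<close>;
    so \<open>c \<mp> \<i> d\<close> are eigenvectors\<close>
  have dc: "(d, - c) \<in> adjoint_op T"
    unfolding adjoint_op_def
  proof clarify
    fix \<phi> \<phi>' assume t: "(\<phi>, \<phi>') \<in> T"
    \<comment> \<open>Real orthogonality to the pair and to its multiple by \<open>- \<i>\<close>
      gives the real and the imaginary part of the complex relation.\<close>
    from perp[OF t] perp[OF linear_graphD(3)[OF T t, of "-\<i>"]]
    have "cinner c \<phi> + cinner d \<phi>' = 0"
      by (simp add: cinner_eq_Complex complex_eq_iff)
    then show "cinner d \<phi>' = cinner (- c) \<phi>"
      by (simp add: cinner_minus_left add_eq_0_iff)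
  qed
  have eig: "((1/2) *\<^sub>C (c + (- z) *\<^sub>C d), z *\<^sub>C (1/2) *\<^sub>C (c + (- z) *\<^sub>C d)) \<in> adjoint_op T" if "z * z = -1" for z
  proof -
    have "((1/2) *\<^sub>C (c + (- z) *\<^sub>C d), (1/2) *\<^sub>C (d + (- z) *\<^sub>C (- c))) \<in> adjoint_op T"
      by (intro adj cd dc)
    moreover have "(1/2) *\<^sub>C (d + (- z) *\<^sub>C (- c)) = z *\<^sub>C (1/2) *\<^sub>C (c + (- z) *\<^sub>C d)"
      using that by (simp add: scaleC_add_right_L2 scaleC_scaleC_L2 algebra_simps)
    ultimately show ?thesis by simp
  qed
  show ?thesis
  proof (rule that[of a b "(1/2) *\<^sub>C (c + (- \<i>) *\<^sub>C d)" "(1/2) *\<^sub>C (c + \<i> *\<^sub>C d)"])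
    show "(a, b) \<in> closure T" using y(1) ab by simp
    show "((1/2) *\<^sub>C (c + (- \<i>) *\<^sub>C d), \<i> *\<^sub>C (1/2) *\<^sub>C (c + (- \<i>) *\<^sub>C d)) \<in> adjoint_op T"
      by (rule eig) simp
    show "((1/2) *\<^sub>C (c + \<i> *\<^sub>C d), (- \<i>) *\<^sub>C (1/2) *\<^sub>C (c + \<i> *\<^sub>C d)) \<in> adjoint_op T"
      using eig[of "- \<i>"] by simp
    have half: "(1/2) *\<^sub>C x + (1/2) *\<^sub>C x = x" for x :: L2
      by (simp flip: scaleC_add_left_L2)
    have "(1/2) *\<^sub>C (c + (- \<i>) *\<^sub>C d) + (1/2) *\<^sub>C (c + \<i> *\<^sub>C d) = (1/2) *\<^sub>C c + (1/2) *\<^sub>C c"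
      by (simp add: scaleC_add_right_L2 scaleC_scaleC_L2 algebra_simps)
    then show "\<psi> = a + (1/2) *\<^sub>C (c + (- \<i>) *\<^sub>C d) + (1/2) *\<^sub>C (c + \<i> *\<^sub>C d)"
      by (simp add: half add.assoc c_def)
    have "\<i> *\<^sub>C (1/2) *\<^sub>C (c + (- \<i>) *\<^sub>C d) + (- \<i>) *\<^sub>C (1/2) *\<^sub>C (c + \<i> *\<^sub>C d) = (1/2) *\<^sub>C d + (1/2) *\<^sub>C d"
      by (simp add: scaleC_add_right_L2 scaleC_scaleC_L2 algebra_simps)
    then show "\<eta> = b + \<i> *\<^sub>C (1/2) *\<^sub>C (c + (- \<i>) *\<^sub>C d) + (- \<i>) *\<^sub>C (1/2) *\<^sub>C (c + \<i> *\<^sub>C d)"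
      by (simp only: half add.assoc) (simp add: d_def)
  qed
qed

lemma symmetric_op_subset_adjoint: "symmetric_op T \<Longrightarrow> T \<subseteq> adjoint_op T"
  unfolding symmetric_op_def adjoint_op_def by fastforce

text \<open>The closure is again symmetric, so \<open>cinner a b\<close> is real, and the two cross
  terms are complex conjugates of each other. Only the contribution of the eigenvector has an
  imaginary part.\<close>

lemma Im_cinner_closure_plus_eigenvector:
  assumes sym: "T \<subseteq> adjoint_op T" and ab: "(a, b) \<in> closure T" and k: "(k, z *\<^sub>C k) \<in> adjoint_op T"
  shows "Im (cinner (a + k) (b + z *\<^sub>C k)) = Im z * (norm k)\<^sup>2"
proof -
  have cl: "closure T \<subseteq> adjoint_op (closure T)"
    unfolding adjoint_closure using closed_adjoint sym by (rule closure_minimal[rotated])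
  have "cinner a b = cnj (cinner a b)"
    using adjointD[of a b "closure T" a b] cl ab cinner_commute[of b a] by auto
  then have 1: "Im (cinner a b) = 0" by (metis Im_complex_of_real Reals_cases Reals_cnj_iff)
  have "cinner k b = cinner (z *\<^sub>C k) a"
    using k ab by (intro adjointD[of _ _ "closure T"]) (auto simp: adjoint_closure)
  then have 2: "cinner k b = cnj (cinner a (z *\<^sub>C k))" using cinner_commute by metis
  have "cinner k (z *\<^sub>C k) = z * of_real ((norm k)\<^sup>2)"
    by (simp add: cinner_scaleC_right cinner_self power2_norm_eq_inner)
  with 1 2 show ?thesis
    by (simp add: cinner_add_left cinner_add_right)
qed

text \<open>Without eigenvectors the decomposition says that the adjoint equals the closure. A
  self-adjoint extension S is closed and hence contains the closure; taking adjoints of the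
  inclusion of \<open>T\<close> in S gives the converse inclusion.\<close>

lemma essentially_self_adjoint_of_trivial_kernels:
  assumes sym: "symmetric_op T"
    and plus: "\<And>\<phi>. (\<phi>, \<i> *\<^sub>C \<phi>) \<in> adjoint_op T \<Longrightarrow> \<phi> = 0"
    and minus: "\<And>\<phi>. (\<phi>, (- \<i>) *\<^sub>C \<phi>) \<in> adjoint_op T \<Longrightarrow> \<phi> = 0"
  shows "essentially_self_adjoint_op T" "self_adjoint_op S \<and> T \<subseteq> S \<longleftrightarrow> S = closure T"
proof -
  have T: "linear_graph T" "closure (Domain T) = UNIV"
    using sym by (auto simp: symmetric_op_def densely_defined_op_def)
  note sub = symmetric_op_subset_adjoint[OF sym]
  have adj: "adjoint_op T = closure T"
  proof
    show "closure T \<subseteq> adjoint_op T" using closed_adjoint sub by (rule closure_minimal[rotated])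
    show "adjoint_op T \<subseteq> closure T"
    proof clarify
      fix \<psi> \<eta> assume "(\<psi>, \<eta>) \<in> adjoint_op T"
      from von_Neumann_decomposition[OF T(1) sub this] obtain a b p m where
        "(a, b) \<in> closure T" "(p, \<i> *\<^sub>C p) \<in> adjoint_op T"
        "(m, (- \<i>) *\<^sub>C m) \<in> adjoint_op T" "\<psi> = a + p + m" "\<eta> = b + \<i> *\<^sub>C p + (- \<i>) *\<^sub>C m" .
      then show "(\<psi>, \<eta>) \<in> closure T" using plus[of p] minus[of m] by simp
    qed
  qed
  have "closure (Domain (closure T)) = UNIV"
    using closure_mono[OF Domain_mono[OF closure_subset[of T]]] T(2) by auto
  then have sa: "self_adjoint_op (closure T)"
    using linear_graph_closure[OF T(1)] single_valued_adjoint[OF T(2)]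
    by (simp add: self_adjoint_op_def densely_defined_op_def adjoint_closure adj)
  with sym show "essentially_self_adjoint_op T" by (simp add: essentially_self_adjoint_op_def)
  show "self_adjoint_op S \<and> T \<subseteq> S \<longleftrightarrow> S = closure T"
  proof
    assume S: "self_adjoint_op S \<and> T \<subseteq> S"
    then have eq: "adjoint_op S = S" by (simp add: self_adjoint_op_def)
    have "S \<subseteq> closure T" using adjoint_antimono[of T S] S eq adj by simp
    moreover have "closure T \<subseteq> S"
      using S closed_adjoint[of S] eq by (intro closure_minimal) auto
    ultimately show "S = closure T" by blast
  next
    assume "S = closure T"
    then show "self_adjoint_op S \<and> T \<subseteq> S" using sa closure_subset[of T] by simp
  qed
qed

section \<open>Dimensions of eigenspaces, and independent eigenvectors from a definite plane\<close>

lemma edim_eq_2: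
  assumes k: "k1 \<in> V" "k2 \<in> V"
    and indep: "\<And>\<alpha> \<beta>. \<alpha> *\<^sub>C k1 + \<beta> *\<^sub>C k2 = 0 \<Longrightarrow> \<alpha> = 0 \<and> \<beta> = 0"
    and span: "\<And>k. k \<in> V \<Longrightarrow> \<exists>\<alpha> \<beta>. k = \<alpha> *\<^sub>C k1 + \<beta> *\<^sub>C k2"
  shows "edim V = 2"
proof -
  have "k1 \<noteq> k2" using indep[of 1 "-1"] by auto
  have "k2 \<noteq> 0" using indep[of 0 1] by auto
  have "k1 \<notin> L2.span {k2}"
  proof
    assume "k1 \<in> L2.span {k2}"
    then obtain c where "k1 = c *\<^sub>C k2" by (auto simp: L2.span_singleton)
    then show False using indep[of 1 "-c"] by simp
  qed
  then have ind: "L2.independent {k1, k2}"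
    using \<open>k1 \<noteq> k2\<close> \<open>k2 \<noteq> 0\<close> by (simp add: L2.independent_insert)
  have sp: "V \<subseteq> L2.span {k1, k2}"
  proof
    fix k assume "k \<in> V"
    from span[OF this] obtain \<alpha> \<beta> where k: "k = \<alpha> *\<^sub>C k1 + \<beta> *\<^sub>C k2" by blast
    show "k \<in> L2.span {k1, k2}"
      unfolding k by (intro L2.span_add L2.span_scale L2.span_base) auto
  qed
  have "L2.dim V = 2"
    using L2.dim_unique[OF _ sp ind, of 2] k \<open>k1 \<noteq> k2\<close> by auto
  moreover have "\<exists>B. finite B \<and> V \<subseteq> L2.span B" using sp by (intro exI[of _ "{k1, k2}"]) auto
  ultimately show ?thesis by (simp add: edim_def numeral_eq_enat)
qed

lemma edim_eq_0:
  assumes "V = {0}"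
  shows "edim V = 0"
proof -
  have "\<exists>B. finite B \<and> V \<subseteq> L2.span B" using assms by (intro exI[of _ "{}"]) auto
  moreover have "L2.dim V = 0"
    using L2.dim_unique[of "{}" V 0] assms by (auto simp: L2.independent_empty)
  ultimately show ?thesis by (simp add: edim_def zero_enat_def)
qed

text \<open>The eigenvectors are the components of \<open>e1\<close> and \<open>e2\<close> for the
  eigenvalue \<open>s \<i>\<close>. If a nontrivial combination of them vanished, the same
  combination of \<open>e1\<close> and \<open>e2\<close> would be an element of the closure plus an
  eigenvector for the opposite eigenvalue, where \<open>s\<close> times the form is at most
  0.\<close>

lemma definite_pair_imp_independent_eigenvectors:
  assumes T: "linear_graph T" and sym: "T \<subseteq> adjoint_op T"
    and e: "(e1, f1) \<in> adjoint_op T" "(e2, f2) \<in> adjoint_op T" and s: "s = 1 \<or> s = - 1"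
    and pos: "\<And>\<alpha> \<beta>. \<alpha> \<noteq> 0 \<or> \<beta> \<noteq> 0 \<Longrightarrow>
      s * Im (cinner (\<alpha> *\<^sub>C e1 + \<beta> *\<^sub>C e2) (\<alpha> *\<^sub>C f1 + \<beta> *\<^sub>C f2)) > 0"
  obtains k1 k2 where "(k1, (of_real s * \<i>) *\<^sub>C k1) \<in> adjoint_op T" "(k2, (of_real s * \<i>) *\<^sub>C k2) \<in> adjoint_op T"
    "\<And>\<alpha> \<beta>. \<alpha> *\<^sub>C k1 + \<beta> *\<^sub>C k2 = 0 \<Longrightarrow> \<alpha> = 0 \<and> \<beta> = 0"
proof -
  let ?z = "of_real s * \<i>"
  \<comment> \<open>Here \<open>p\<close> always belongs to the eigenvalue \<open>s \<i>\<close>, so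
    for \<open>s = - 1\<close> the two eigenvectors of the decomposition change places.\<close>
  have dec: "\<exists>a b p m. (a, b) \<in> closure T \<and> (p, ?z *\<^sub>C p) \<in> adjoint_op T \<and>
      (m, (- ?z) *\<^sub>C m) \<in> adjoint_op T \<and> \<psi> = a + p + m \<and> \<eta> = b + ?z *\<^sub>C p + (- ?z) *\<^sub>C m"
    if "(\<psi>, \<eta>) \<in> adjoint_op T" for \<psi> \<eta>
  proof -
    from von_Neumann_decomposition[OF T sym that] obtain a b p m where *:
        "(a, b) \<in> closure T" "(p, \<i> *\<^sub>C p) \<in> adjoint_op T"
        "(m, (- \<i>) *\<^sub>C m) \<in> adjoint_op T" "\<psi> = a + p + m" "\<eta> = b + \<i> *\<^sub>C p + (- \<i>) *\<^sub>C m" .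
    show ?thesis
    proof (cases "s = 1")
      case True
      then show ?thesis using * by (intro exI[of _ a] exI[of _ b] exI[of _ p] exI[of _ m]) simp
    next
      case False
      then have "s = -1" using s by simp
      then show ?thesis using * by (intro exI[of _ a] exI[of _ b] exI[of _ m] exI[of _ p]) (simp add: add_ac)
    qed
  qed
  from dec[OF e(1)] obtain a1 b1 p1 m1 where 1: "(a1, b1) \<in> closure T" "(p1, ?z *\<^sub>C p1) \<in> adjoint_op T"
      "(m1, (- ?z) *\<^sub>C m1) \<in> adjoint_op T" "e1 = a1 + p1 + m1" "f1 = b1 + ?z *\<^sub>C p1 + (- ?z) *\<^sub>C m1" by blast
  from dec[OF e(2)] obtain a2 b2 p2 m2 where 2: "(a2, b2) \<in> closure T" "(p2, ?z *\<^sub>C p2) \<in> adjoint_op T"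
      "(m2, (- ?z) *\<^sub>C m2) \<in> adjoint_op T" "e2 = a2 + p2 + m2" "f2 = b2 + ?z *\<^sub>C p2 + (- ?z) *\<^sub>C m2" by blast
  show ?thesis
  proof (rule that[OF 1(2) 2(2)], rule ccontr)
    fix \<alpha> \<beta> assume 0: "\<alpha> *\<^sub>C p1 + \<beta> *\<^sub>C p2 = 0" and "\<not> (\<alpha> = 0 \<and> \<beta> = 0)"
    then have gt: "s * Im (cinner (\<alpha> *\<^sub>C e1 + \<beta> *\<^sub>C e2) (\<alpha> *\<^sub>C f1 + \<beta> *\<^sub>C f2)) > 0"
      by (intro pos) auto
    define a b m where "a = \<alpha> *\<^sub>C a1 + \<beta> *\<^sub>C a2" and "b = \<alpha> *\<^sub>C b1 + \<beta> *\<^sub>C b2"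
      and "m = \<alpha> *\<^sub>C m1 + \<beta> *\<^sub>C m2"
    have "\<alpha> *\<^sub>C e1 + \<beta> *\<^sub>C e2 = a + m + (\<alpha> *\<^sub>C p1 + \<beta> *\<^sub>C p2)"
      by (simp add: 1 2 a_def m_def scaleC_add_right_L2 add_ac)
    then have e12: "\<alpha> *\<^sub>C e1 + \<beta> *\<^sub>C e2 = a + m" by (simp add: 0)
    have "\<alpha> *\<^sub>C f1 + \<beta> *\<^sub>C f2 = b + (- ?z) *\<^sub>C m + ?z *\<^sub>C (\<alpha> *\<^sub>C p1 + \<beta> *\<^sub>C p2)"
      unfolding 1 2 b_def m_def scaleC_add_right_L2 scaleC_scaleC_L2 by (simp only: add_ac mult_ac)
    then have f12: "\<alpha> *\<^sub>C f1 + \<beta> *\<^sub>C f2 = b + (- ?z) *\<^sub>C m" by (simp only: 0) simp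
    have "(a, b) \<in> closure T"
      unfolding a_def b_def by (intro linear_graphD[OF linear_graph_closure[OF T]] 1 2)
    moreover have "(m, (- ?z) *\<^sub>C m) \<in> adjoint_op T"
    proof -
      have "(m, \<alpha> *\<^sub>C (- ?z) *\<^sub>C m1 + \<beta> *\<^sub>C (- ?z) *\<^sub>C m2) \<in> adjoint_op T"
        unfolding m_def by (intro linear_graphD[OF linear_graph_adjoint] 1 2)
      then show ?thesis
        unfolding m_def scaleC_add_right_L2 scaleC_scaleC_L2 by (simp only: mult_ac)
    qed
    ultimately have "Im (cinner (a + m) (b + (- ?z) *\<^sub>C m)) = Im (- ?z) * (norm m)\<^sup>2"
      by (rule Im_cinner_closure_plus_eigenvector[OF sym])
    with gt have "s * (- s * (norm m)\<^sup>2) > 0" unfolding e12 f12 by simp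
    then show False using s zero_le_power2[of "norm m"] by auto
  qed
qed

subsection \<open>The weak form of the eigenvalue equation\<close>

definition vanishes_off :: "real \<Rightarrow> real \<Rightarrow> (real \<Rightarrow> 'a::zero) \<Rightarrow> bool" where
  "vanishes_off c d f \<longleftrightarrow> (\<forall>x. x \<notin> {c..d} \<longrightarrow> f x = 0)"

lemma vanishes_off_deriv:
  fixes \<phi> :: "real \<Rightarrow> real"
  assumes "vanishes_off c d \<phi>"
  shows "vanishes_off c d (deriv \<phi>)"
  unfolding vanishes_off_def
proof (intro allI impI DERIV_imp_deriv)
  fix x assume x: "x \<notin> {c..d}"
  have "((\<lambda>x. 0) has_real_derivative 0) (at x)" by simp
  then show "(\<phi> has_real_derivative 0) (at x)"
    by (rule has_field_derivative_transform_within_open[of _ _ _ "- {c..d}"])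
      (use x assms in \<open>auto simp: vanishes_off_def simp del: atLeastAtMost_iff\<close>)
qed

lemma smooth_real_iterated_deriv:
  assumes "smooth_real \<phi>"
  shows "((deriv ^^ n) \<phi> has_real_derivative (deriv ^^ Suc n) \<phi> x) (at x)"
proof -
  have "smooth_real ((deriv ^^ n) \<phi>)"
    using assms by (induction n) (auto intro: smooth_real_deriv)
  then show ?thesis using smooth_real_deriv(1) by simp
qed

lemma axis_component: "axis i z $ k = (if k = i then z else 0)"
  by (simp add: axis_def)

lemma bounded_linear_axis_of_real: "bounded_linear (\<lambda>r::real. axis i (of_real r) :: complex ^ 2)"
proof -
  have "axis i (complex_of_real r) = r *\<^sub>R axis i 1" for r
    by (simp add: axis_def vec_eq_iff of_real_def)
  then show ?thesis using bounded_linear_scaleR_left by simp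
qed

lemma has_vector_derivative_axis:
  assumes "(\<phi> has_real_derivative \<phi>') (at x)"
  shows "((\<lambda>x. axis i (complex_of_real (\<phi> x)) :: complex ^ 2) has_vector_derivative axis i (of_real \<phi>')) (at x)"
  using bounded_linear.has_vector_derivative[OF bounded_linear_axis_of_real] assms
  by (simp add: has_real_derivative_iff_has_vector_derivative)

text \<open>Real scalar functions times a basis vector are the only test functions that the weak
  arguments insert; together they determine both components.\<close>

lemma test_function_axis:
  assumes "smooth_real \<phi>" "vanishes_off c d \<phi>" "- (pi/2) < c" "d < pi/2"
  shows "test_function (\<lambda>x. axis i (complex_of_real (\<phi> x)))"
  unfolding test_function_def
proof (intro conjI)
  let ?F = "\<lambda>n x. axis i (complex_of_real ((deriv ^^ n) \<phi> x)) :: complex ^ 2"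
  show "smooth (\<lambda>x. axis i (complex_of_real (\<phi> x)) :: complex ^ 2)"
    unfolding smooth_def
    by (intro exI[of _ ?F] conjI allI has_vector_derivative_axis smooth_real_iterated_deriv assms) simp
  have "{x. (axis i (complex_of_real (\<phi> x)) :: complex ^ 2) \<noteq> 0} \<subseteq> {c..d}"
    using assms(2) by (auto simp: vanishes_off_def axis_eq_0_iff)
  then have sub: "closure {x. (axis i (complex_of_real (\<phi> x)) :: complex ^ 2) \<noteq> 0} \<subseteq> {c..d}"
    by (rule closure_minimal) simp
  then show "closure {x. (axis i (complex_of_real (\<phi> x)) :: complex ^ 2) \<noteq> 0} \<subseteq> I0"
    using assms by auto
  show "compact (closure {x. (axis i (complex_of_real (\<phi> x)) :: complex ^ 2) \<noteq> 0})"
    using bounded_subset[OF bounded_closed_interval sub] by (simp add: compact_eq_bounded_closed)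
qed

section \<open>Weak derivatives on the open interval and regularity\<close>

definition mass :: "real \<Rightarrow> real \<Rightarrow> real" where
  "mass M x = M * (1 / cos x)"

lemma cos_pos_I0: "x \<in> I0 \<Longrightarrow> cos x > 0"
  by (rule cos_gt_zero_pi) auto

lemma continuous_on_mass: "S \<subseteq> I0 \<Longrightarrow> continuous_on S (mass M)"
  unfolding mass_def[abs_def] using cos_pos_I0 by (intro continuous_intros) force

lemma dirac_expr_nth:
  assumes "(\<Phi> has_vector_derivative \<Phi>') (at x)"
  shows "dirac_expr M \<Phi> x $ 1 = - \<Phi>' $ 2 + mass M x * \<Phi> x $ 2"
    "dirac_expr M \<Phi> x $ 2 = \<Phi>' $ 1 + mass M x * \<Phi> x $ 1"
  using vector_derivative_at[OF assms] by (simp_all add: dirac_expr_def Let_def mass_def)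

lemma dirac_opI: "test_function \<Phi> \<Longrightarrow> (abs_L2 \<Phi>, abs_L2 (dirac_expr M \<Phi>)) \<in> dirac_op M"
  by (auto simp: dirac_op_def)

text \<open>The interval has finite length, and t is at most 1 + t^2.\<close>

lemma square_integrable_nth:
  assumes "square_integrable f"
  shows "(\<lambda>x. f x $ i) absolutely_integrable_on I0"
proof -
  have m: "f \<in> borel_measurable (lebesgue_on I0)" "integrable (lebesgue_on I0) (\<lambda>x. (norm (f x))\<^sup>2)"
    using assms by (auto simp: square_integrable_def)
  have "integrable (lebesgue_on I0) (\<lambda>x. f x $ i)"
  proof (rule Bochner_Integration.integrable_bound)
    show "integrable (lebesgue_on I0) (\<lambda>x. 1 + (norm (f x))\<^sup>2)"
      by (intro Bochner_Integration.integrable_add m(2) finite_measure.integrable_const finite_measure_lebesgue_on) auto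
    show "(\<lambda>x. f x $ i) \<in> borel_measurable (lebesgue_on I0)"
      using m(1) by (rule measurable_vec_nth')
    show "AE x in lebesgue_on I0. norm (f x $ i) \<le> norm (1 + (norm (f x))\<^sup>2)"
    proof (rule AE_I2)
      fix x
      have "norm (f x $ i) \<le> norm (f x)" by (rule Finite_Cartesian_Product.norm_nth_le)
      also have "2 * norm (f x) \<le> 1 + (norm (f x))\<^sup>2"
        using zero_le_power2[of "norm (f x) - 1"] by (simp add: power2_diff)
      then have "norm (f x) \<le> 1 + (norm (f x))\<^sup>2"
        using norm_ge_zero[of "f x"] by linarith
      finally show "norm (f x $ i) \<le> norm (1 + (norm (f x))\<^sup>2)" by simp
    qed
  qed
  then show ?thesis by (simp add: set_integrable_def integrable_restrict_space)
qed

lemma integral_lebesgue_on_vanishes_off: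
  fixes f :: "real \<Rightarrow> complex"
  assumes "integrable (lebesgue_on I0) f" "vanishes_off c d f" "- (pi/2) < c" "d < pi/2"
  shows "(\<integral>x. f x \<partial>lebesgue_on I0) = integral {c..d} f"
proof -
  have "(\<integral>x. f x \<partial>lebesgue_on I0) = integral I0 f"
    using assms(1) by (intro lebesgue_integral_eq_integral) auto
  also have "\<dots> = integral I0 (\<lambda>x. if x \<in> {c..d} then f x else 0)"
    using assms(2) by (intro integral_cong) (auto simp: vanishes_off_def)
  also have "\<dots> = integral {c..d} f"
    using assms(3,4) by (subst integral_restrict_Int) (simp add: Int_absorb2 subset_eq)
  finally show ?thesis .
qed

text \<open>Integrability is demanded on compact subintervals only, because the product of the mass
  with a square-integrable function need not be integrable up to the endpoints.\<close>

definition weak_deriv_on_I0 :: "(real \<Rightarrow> complex) \<Rightarrow> (real \<Rightarrow> complex) \<Rightarrow> bool" where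
  "weak_deriv_on_I0 f g \<longleftrightarrow> (\<forall>c d. - (pi/2) < c \<longrightarrow> d < pi/2 \<longrightarrow>
     f absolutely_integrable_on {c..d} \<and> g absolutely_integrable_on {c..d} \<and>
     (\<forall>\<phi> \<phi>'. smooth_real \<phi> \<longrightarrow> (\<forall>x. (\<phi> has_real_derivative \<phi>' x) (at x)) \<longrightarrow> vanishes_off c d \<phi> \<longrightarrow>
        integral {c..d} (\<lambda>x. \<phi>' x *\<^sub>R f x) = - integral {c..d} (\<lambda>x. \<phi> x *\<^sub>R g x)))"

text \<open>The intervals \<open>{- r n..r n}\<close> exhaust the open interval, and the union of
  the countably many exceptional sets is a single null set that serves all pairs of points.\<close>

lemma weak_deriv_imp_primitive:
  assumes "weak_deriv_on_I0 f g"
  obtains N where "negligible N"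
    "\<And>a b. \<lbrakk>a \<in> I0; b \<in> I0; a < b; a \<notin> N; b \<notin> N\<rbrakk> \<Longrightarrow> f b - f a = integral {a..b} g"
proof -
  define r where "r n = (pi/2) * (real n / (real n + 1))" for n
  have r: "- (pi/2) < - r n" "r n < pi/2" for n
    by (auto simp: r_def field_simps)
  have "\<exists>N. negligible N \<and> (\<forall>a b. - r n < a \<longrightarrow> a < b \<longrightarrow> b < r n \<longrightarrow> a \<notin> N \<longrightarrow> b \<notin> N \<longrightarrow>
      f b - f a = integral {a..b} g)" for n
  proof -
    have w: "f absolutely_integrable_on {- r n..r n}" "g absolutely_integrable_on {- r n..r n}"
      "\<And>\<phi> \<phi>'. \<lbrakk>smooth_real \<phi>; \<And>x. (\<phi> has_real_derivative \<phi>' x) (at x); vanishes_off (- r n) (r n) \<phi>\<rbrakk> \<Longrightarrow>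
        integral {- r n..r n} (\<lambda>x. \<phi>' x *\<^sub>R f x) = - integral {- r n..r n} (\<lambda>x. \<phi> x *\<^sub>R g x)"
      using assms r[of n] unfolding weak_deriv_on_I0_def by auto
    show ?thesis
      by (rule weak_derivative_imp_primitive[OF w(1,2) w(3)]) (auto simp: vanishes_off_def)
  qed
  then obtain N where N: "\<And>n. negligible (N n)"
    "\<And>n a b. \<lbrakk>- r n < a; a < b; b < r n; a \<notin> N n; b \<notin> N n\<rbrakk> \<Longrightarrow> f b - f a = integral {a..b} g"
    by metis
  show ?thesis
  proof (rule that[of "\<Union>n. N n"])
    show "negligible (\<Union>n. N n)" using N(1) by (intro negligible_countable_Union) auto
    fix a b assume ab: "a \<in> I0" "b \<in> I0" "a < b" "a \<notin> (\<Union>n. N n)" "b \<notin> (\<Union>n. N n)"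
    have "r \<longlonglongrightarrow> (pi/2) * 1"
      unfolding r_def by (intro tendsto_intros LIMSEQ_n_over_Suc_n[unfolded of_nat_Suc add.commute[of 1]])
    then have "\<forall>\<^sub>F n in sequentially. r n > max b (- a)"
      using ab by (intro order_tendstoD) auto
    then obtain n where "r n > max b (- a)" by (auto simp: eventually_sequentially)
    then show "f b - f a = integral {a..b} g" using ab by (intro N(2)[of n]) auto
  qed
qed

lemma not_negligible_I0: "\<not> negligible I0"
  using negligible_interval(2)[of "-(pi/2)" "pi/2"] pi_gt_zero by (simp add: box_real not_le)

text \<open>A base point \<open>z\<close> outside the null set fixes the constant of integration,
  and \<open>F\<close> is the primitive of \<open>g\<close> with the value of \<open>f\<close>
  there. Additivity of the integral then gives the increments between arbitrary points.\<close>

lemma weak_deriv_continuous_representative: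
  assumes w: "weak_deriv_on_I0 f g"
  shows "\<exists>F N. negligible N \<and> (\<forall>x\<in>I0. x \<notin> N \<longrightarrow> F x = f x) \<and>
    (\<forall>a\<in>I0. \<forall>b\<in>I0. a \<le> b \<longrightarrow> F b - F a = integral {a..b} g)"
proof -
  obtain N where N: "negligible N"
    "\<And>a b. \<lbrakk>a \<in> I0; b \<in> I0; a < b; a \<notin> N; b \<notin> N\<rbrakk> \<Longrightarrow> f b - f a = integral {a..b} g"
    using weak_deriv_imp_primitive[OF w] by blast
  have "\<not> I0 \<subseteq> N" using negligible_subset[OF N(1)] not_negligible_I0 by blast
  then obtain z where z: "z \<in> I0" "z \<notin> N" by blast
  define F where "F x = f z + (if z \<le> x then integral {z..x} g else - integral {x..z} g)" for x
  have gi: "g integrable_on {a..b}" if "a \<in> I0" "b \<in> I0" for a b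
    using w that unfolding weak_deriv_on_I0_def by (auto simp: absolutely_integrable_on_def)
  have comb: "integral {a..b} g + integral {b..c} g = integral {a..c} g" if "a \<in> I0" "c \<in> I0" "a \<le> b" "b \<le> c" for a b c
    using that by (intro Henstock_Kurzweil_Integration.integral_combine gi) auto
  show ?thesis
  proof (intro exI[of _ F] exI[of _ N] conjI ballI impI N(1))
    show "F x = f x" if "x \<in> I0" "x \<notin> N" for x
    proof -
      consider "x < z" | "x = z" | "z < x" by linarith
      then show ?thesis
        by cases (use N(2)[of x z] N(2)[of z x] that z in \<open>auto simp: F_def algebra_simps\<close>)
    qed
    show "F b - F a = integral {a..b} g" if "a \<in> I0" "b \<in> I0" "a \<le> b" for a b
    proof -
      consider "z \<le> a" | "a < z" "z \<le> b" | "b < z" by linarith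
      then show ?thesis
      proof cases
        case 1 then show ?thesis using comb[of z b a] that z by (simp add: F_def algebra_simps)
      next
        case 2 then show ?thesis using comb[of a b z] that z by (simp add: F_def algebra_simps)
      next
        case 3 then show ?thesis using comb[of a z b] that z by (simp add: F_def algebra_simps)
      qed
    qed
  qed
qed

text \<open>The second half of the regularity argument: changing the integrand on a null set leaves
  the primitive unchanged, so a continuous version of the integrand is its classical
  derivative.\<close>

lemma has_vector_derivative_of_primitive:
  fixes F g G :: "real \<Rightarrow> complex"
  assumes F: "\<And>a b. a \<in> I0 \<Longrightarrow> b \<in> I0 \<Longrightarrow> a \<le> b \<Longrightarrow> F b - F a = integral {a..b} g"
    and N: "negligible N" "\<And>x. x \<in> I0 \<Longrightarrow> x \<notin> N \<Longrightarrow> g x = G x" and G: "continuous_on I0 G" and x: "x \<in> I0"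
  shows "(F has_vector_derivative G x) (at x)"
proof -
  obtain c d where cd: "- (pi/2) < c" "c < x" "x < d" "d < pi/2"
    using dense[of "-(pi/2)" x] dense[of x "pi/2"] x by auto
  have "((\<lambda>y. integral {c..y} G) has_vector_derivative G x) (at x within {c..d})"
    using cd by (intro integral_has_vector_derivative continuous_on_subset[OF G]) auto
  then have "((\<lambda>y. F c + integral {c..y} G) has_vector_derivative G x) (at x)"
    using cd by (auto intro!: derivative_eq_intros simp: at_within_Icc_at)
  then show ?thesis
  proof (rule has_vector_derivative_transform_within_open[of _ _ _ "{c<..<d}"])
    fix y assume y: "y \<in> {c<..<d}"
    have "integral {c..y} g = integral {c..y} G"
      using N cd y by (intro integral_spike[OF N(1)]) auto
    with F[of c y] y cd show "F c + integral {c..y} G = F y" by (simp add: algebra_simps)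
  qed (use cd in auto)
qed

lemma continuous_on_of_primitive:
  fixes F g :: "real \<Rightarrow> complex"
  assumes F: "\<And>a b. a \<in> I0 \<Longrightarrow> b \<in> I0 \<Longrightarrow> a \<le> b \<Longrightarrow> F b - F a = integral {a..b} g"
    and g: "\<And>c d. - (pi/2) < c \<Longrightarrow> d < pi/2 \<Longrightarrow> g absolutely_integrable_on {c..d}"
  shows "continuous_on I0 F"
proof (rule continuous_at_imp_continuous_on, rule ballI)
  fix x assume x: "x \<in> I0"
  obtain c d where cd: "- (pi/2) < c" "c < x" "x < d" "d < pi/2"
    using dense[of "-(pi/2)" x] dense[of x "pi/2"] x by auto
  have "continuous_on {c..d} (\<lambda>y. F c + integral {c..y} g)"
    using g[of c d] cd
    by (intro continuous_intros indefinite_integral_continuous_1) (auto simp: absolutely_integrable_on_def)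
  moreover have "F c + integral {c..y} g = F y" if "y \<in> {c..d}" for y
    using F[of c y] that cd by (simp add: algebra_simps)
  ultimately have "continuous_on {c..d} F" by (rule continuous_on_eq)
  then show "isCont F x" using cd by (intro continuous_on_interior[of "{c..d}"]) auto
qed

text \<open>The Dirac expression of a test function in one component lives in the other component.
  So testing with the first basis vector yields the equation for the second component of
  \<open>f\<close>, and conversely.\<close>

lemma weak_equations:
  assumes f: "square_integrable f" and g: "square_integrable g"
    and weak: "\<And>\<Phi>. test_function \<Phi> \<Longrightarrow> cinner (abs_L2 (dirac_expr M \<Phi>)) (abs_L2 f) = cinner (abs_L2 \<Phi>) (abs_L2 g)"
  shows "weak_deriv_on_I0 (\<lambda>x. f x $ 1) (\<lambda>x. g x $ 2 - mass M x * f x $ 1)"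
    "weak_deriv_on_I0 (\<lambda>x. f x $ 2) (\<lambda>x. mass M x * f x $ 2 - g x $ 1)"
proof -
  have ai: "(\<lambda>x. h x $ i) absolutely_integrable_on {c..d}"
    if "square_integrable h" "- (pi/2) < c" "d < pi/2" for h i c d
    using square_integrable_nth[OF that(1)] by (rule set_integrable_subset) (use that in auto)
  have aim: "(\<lambda>x. mass M x * h x $ i) absolutely_integrable_on {c..d}"
    if "square_integrable h" "- (pi/2) < c" "d < pi/2" for h i c d
    using absolutely_integrable_scaleR_continuous[OF ai[OF that, of i] continuous_on_mass] that(2,3)
    by (simp add: scaleR_conv_of_real subset_eq)
  have main: "integral {c..d} (\<lambda>x. cdot (dirac_expr M (\<lambda>x. axis i (of_real (\<phi> x))) x) (f x)) =
      integral {c..d} (\<lambda>x. cdot (axis i (of_real (\<phi> x))) (g x))"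
    if cd: "- (pi/2) < c" "d < pi/2" and \<phi>: "smooth_real \<phi>" "vanishes_off c d \<phi>" for c d \<phi> i
  proof -
    let ?\<Phi> = "\<lambda>x. axis i (complex_of_real (\<phi> x)) :: complex ^ 2"
    have t: "test_function ?\<Phi>" by (rule test_function_axis[OF \<phi> cd])
    note si = test_function_square_integrable[OF t]
    have d0: "deriv \<phi> x = 0" if "x \<notin> {c..d}" for x
      using vanishes_off_deriv[OF \<phi>(2)] that by (simp add: vanishes_off_def)
    have "dirac_expr M ?\<Phi> x = 0" if "x \<notin> {c..d}" for x
      using dirac_expr_nth[OF has_vector_derivative_axis[OF smooth_real_deriv(1)[OF \<phi>(1)]], of M i x] d0[OF that] \<phi>(2) that
      by (simp add: vec_eq_iff forall_2 vanishes_off_def axis_component)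
    then have "vanishes_off c d (\<lambda>x. cdot (dirac_expr M ?\<Phi> x) (f x))" "vanishes_off c d (\<lambda>x. cdot (?\<Phi> x) (g x))"
      using \<phi>(2) by (auto simp: vanishes_off_def cdot_def sum_2 axis_component simp del: atLeastAtMost_iff)
    then show ?thesis
      using weak[OF t] cd si f g
      by (simp add: cinner_abs_L2 integral_lebesgue_on_vanishes_off square_integrable_cdot)
  qed
  \<comment> \<open>Both rows at once: \<open>s\<close> is the sign of the derivative in the row,
    and multiplying by it a second time isolates the derivative.\<close>
  have gen: "weak_deriv_on_I0 (\<lambda>x. f x $ j) (\<lambda>x. s *\<^sub>R (mass M x * f x $ j - g x $ i))"
    if s: "s * s = (1::real)" and expr: "\<And>\<phi> x. smooth_real \<phi> \<Longrightarrow>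
      cdot (dirac_expr M (\<lambda>x. axis i (of_real (\<phi> x))) x) (f x) =
        s *\<^sub>R (deriv \<phi> x *\<^sub>R f x $ j) + \<phi> x *\<^sub>R (mass M x * f x $ j)" for s i j
    unfolding weak_deriv_on_I0_def
  proof (intro allI impI conjI)
    fix c d :: real assume cd: "- (pi/2) < c" "d < pi/2"
    show "(\<lambda>x. f x $ j) absolutely_integrable_on {c..d}" by (rule ai[OF f cd])
    show "(\<lambda>x. s *\<^sub>R (mass M x * f x $ j - g x $ i)) absolutely_integrable_on {c..d}"
      by (intro absolutely_integrable_scaleR_left set_integral_diff ai[OF g cd] aim[OF f cd])
    fix \<phi> \<phi>' assume \<phi>: "smooth_real \<phi>" "\<forall>x. (\<phi> has_real_derivative \<phi>' x) (at x)" "vanishes_off c d \<phi>"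
    have d: "deriv \<phi> = \<phi>'" using \<phi>(2) by (auto intro: DERIV_imp_deriv)
    have c: "continuous_on S \<phi>" "continuous_on S \<phi>'" for S
      using smooth_real_isCont[OF \<phi>(1)] smooth_real_isCont[OF smooth_real_deriv(2)[OF \<phi>(1)]] d
      by (auto intro: continuous_at_imp_continuous_on)
    have 1: "(\<lambda>x. \<phi>' x *\<^sub>R f x $ j) integrable_on {c..d}"
      by (rule set_lebesgue_integral_eq_integral(1)[OF absolutely_integrable_scaleR_continuous[OF ai[OF f cd] c(2)]])
    have 2: "(\<lambda>x. \<phi> x *\<^sub>R (mass M x * f x $ j)) integrable_on {c..d}"
      by (rule set_lebesgue_integral_eq_integral(1)[OF absolutely_integrable_scaleR_continuous[OF aim[OF f cd] c(1)]])
    have 3: "(\<lambda>x. \<phi> x *\<^sub>R g x $ i) integrable_on {c..d}"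
      by (rule set_lebesgue_integral_eq_integral(1)[OF absolutely_integrable_scaleR_continuous[OF ai[OF g cd] c(1)]])
    have "cdot (axis i (complex_of_real (\<phi> x))) (g x) = \<phi> x *\<^sub>R g x $ i" for x
      using exhaust_2[of i] by (auto simp: cdot_def sum_2 axis_component scaleR_conv_of_real)
    then have "integral {c..d} (\<lambda>x. s *\<^sub>R (\<phi>' x *\<^sub>R f x $ j) + \<phi> x *\<^sub>R (mass M x * f x $ j)) =
        integral {c..d} (\<lambda>x. \<phi> x *\<^sub>R g x $ i)"
      using main[OF cd \<phi>(1,3), of i] by (simp only: expr[OF \<phi>(1)] d)
    then have eq: "s *\<^sub>R integral {c..d} (\<lambda>x. \<phi>' x *\<^sub>R f x $ j) =
        integral {c..d} (\<lambda>x. \<phi> x *\<^sub>R g x $ i) - integral {c..d} (\<lambda>x. \<phi> x *\<^sub>R (mass M x * f x $ j))"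
      by (simp only: Henstock_Kurzweil_Integration.integral_add[OF integrable_cmul[OF 1] 2] integral_cmul)
        (simp add: algebra_simps)
    have "integral {c..d} (\<lambda>x. \<phi>' x *\<^sub>R f x $ j) = s *\<^sub>R (s *\<^sub>R integral {c..d} (\<lambda>x. \<phi>' x *\<^sub>R f x $ j))"
      using s by simp
    also have "\<dots> = s *\<^sub>R integral {c..d} (\<lambda>x. \<phi> x *\<^sub>R g x $ i - \<phi> x *\<^sub>R (mass M x * f x $ j))"
      by (simp only: eq Henstock_Kurzweil_Integration.integral_diff[OF 3 2])
    also have "\<dots> = integral {c..d} (\<lambda>x. s *\<^sub>R (\<phi> x *\<^sub>R g x $ i - \<phi> x *\<^sub>R (mass M x * f x $ j)))"
      by (simp only: integral_cmul)
    also have "\<dots> = integral {c..d} (\<lambda>x. - (\<phi> x *\<^sub>R s *\<^sub>R (mass M x * f x $ j - g x $ i)))"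
      by (intro integral_cong) (simp add: scaleR_conv_of_real algebra_simps)
    finally show "integral {c..d} (\<lambda>x. \<phi>' x *\<^sub>R f x $ j) =
        - integral {c..d} (\<lambda>x. \<phi> x *\<^sub>R s *\<^sub>R (mass M x * f x $ j - g x $ i))"
      by (simp only: integral_neg)
  qed
  have "weak_deriv_on_I0 (\<lambda>x. f x $ 1) (\<lambda>x. (- 1) *\<^sub>R (mass M x * f x $ 1 - g x $ 2))"
    by (rule gen) (simp_all add: dirac_expr_nth[OF has_vector_derivative_axis[OF smooth_real_deriv(1)]]
        cdot_def sum_2 axis_component scaleR_conv_of_real algebra_simps)
  then show "weak_deriv_on_I0 (\<lambda>x. f x $ 1) (\<lambda>x. g x $ 2 - mass M x * f x $ 1)" by simp
  have "weak_deriv_on_I0 (\<lambda>x. f x $ 2) (\<lambda>x. 1 *\<^sub>R (mass M x * f x $ 2 - g x $ 1))"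
    by (rule gen) (simp_all add: dirac_expr_nth[OF has_vector_derivative_axis[OF smooth_real_deriv(1)]]
        cdot_def sum_2 axis_component scaleR_conv_of_real algebra_simps)
  then show "weak_deriv_on_I0 (\<lambda>x. f x $ 2) (\<lambda>x. mass M x * f x $ 2 - g x $ 1)" by simp
qed

subsection \<open>Symmetry and density\<close>

lemma closed_in_I0_bounds:
  assumes "compact K" "K \<subseteq> I0"
  obtains c d where "- (pi/2) < c" "c < d" "d < pi/2" "K \<subseteq> {c<..<d}"
proof (cases "K = {}")
  case True
  then show ?thesis using that[of 0 1] pi_gt3 by auto
next
  case False
  obtain a where a: "a \<in> K" "\<And>x. x \<in> K \<Longrightarrow> a \<le> x" using compact_attains_inf[OF assms(1) False] by blast
  obtain b where b: "b \<in> K" "\<And>x. x \<in> K \<Longrightarrow> x \<le> b" using compact_attains_sup[OF assms(1) False] by blast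
  have "- (pi/2) < a" "b < pi/2" using a(1) b(1) assms(2) by auto
  obtain c where c: "- (pi/2) < c" "c < a" using dense[OF \<open>- (pi/2) < a\<close>] by blast
  obtain d where d: "b < d" "d < pi/2" using dense[OF \<open>b < pi/2\<close>] by blast
  show ?thesis
  proof (rule that[OF c(1) _ d(2)])
    show "c < d" using c d a(2)[OF b(1)] by linarith
    show "K \<subseteq> {c<..<d}" using a(2) b(2) c d by force
  qed
qed

text \<open>The function vanishes at \<open>c\<close> and \<open>d\<close> themselves, so boundary
  terms at these points drop out.\<close>

lemma test_function_support:
  assumes "test_function \<Phi>"
  obtains c d where "- (pi/2) < c" "c < d" "d < pi/2" "\<And>x. x \<notin> {c<..<d} \<Longrightarrow> \<Phi> x = 0"
    "\<And>x. x \<notin> {c..d} \<Longrightarrow> dirac_expr M \<Phi> x = 0"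
proof -
  obtain c d where cd: "- (pi/2) < c" "c < d" "d < pi/2" "closure {x. \<Phi> x \<noteq> 0} \<subseteq> {c<..<d}"
    using assms closed_in_I0_bounds[of "closure {x. \<Phi> x \<noteq> 0}"] unfolding test_function_def by blast
  have z: "\<Phi> x = 0" if "x \<notin> {c<..<d}" for x
    using cd(4) closure_subset[of "{x. \<Phi> x \<noteq> 0}"] that by auto
  show ?thesis
  proof (rule that[OF cd(1-3) z])
    fix x assume x: "x \<notin> {c..d}"
    have "((\<lambda>x. 0) has_vector_derivative 0) (at x)" by simp
    then have "(\<Phi> has_vector_derivative 0) (at x)"
      by (rule has_vector_derivative_transform_within_open[of _ _ _ "- {c..d}"]) (use x z in auto)
    moreover have "\<Phi> x = 0" using z[of x] x by auto
    ultimately show "dirac_expr M \<Phi> x = 0"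
      by (simp add: vec_eq_iff forall_2 dirac_expr_nth[of \<Phi> 0])
  qed
qed

lemma has_vector_derivative_nth:
  assumes "(f has_vector_derivative f') F"
  shows "((\<lambda>x. f x $ i) has_vector_derivative f' $ i) F"
  using bounded_linear.has_vector_derivative[OF bounded_linear_vec_nth assms] .

lemma test_function_derivative:
  assumes "test_function \<Phi>"
  shows "(\<Phi> has_vector_derivative vector_derivative \<Phi> (at x)) (at x)"
proof -
  obtain F where "F 0 = \<Phi>" "\<And>n x. (F n has_vector_derivative F (Suc n) x) (at x)"
    using assms unfolding test_function_def smooth_def by blast
  then have "(\<Phi> has_vector_derivative F (Suc 0) x) (at x)" by metis
  then show ?thesis by (simp add: vector_derivative_at)
qed

text \<open>Lagrange's identity: the difference of the two integrands is the derivative of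
  \<open>?W\<close>, which vanishes at \<open>c\<close> and \<open>d\<close> by the compact support
  of the test function. The behaviour of \<open>f\<close> at the endpoints is thus unrestricted
  beyond square integrability, which admits the cut-off zero modes.\<close>

lemma differentiable_imp_adjoint:
  assumes f: "square_integrable f" and h: "square_integrable h"
    and der: "\<And>x. x \<in> I0 \<Longrightarrow> (f has_vector_derivative f' x) (at x)"
    and h1: "\<And>x. x \<in> I0 \<Longrightarrow> h x $ 1 = - f' x $ 2 + mass M x * f x $ 2"
    and h2: "\<And>x. x \<in> I0 \<Longrightarrow> h x $ 2 = f' x $ 1 + mass M x * f x $ 1"
  shows "(abs_L2 f, abs_L2 h) \<in> adjoint_op (dirac_op M)"
  unfolding adjoint_op_def
proof clarify
  fix \<phi> \<phi>' assume "(\<phi>, \<phi>') \<in> dirac_op M"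
  then obtain \<Phi> where t: "test_function \<Phi>" and \<phi>: "\<phi> = abs_L2 \<Phi>" "\<phi>' = abs_L2 (dirac_expr M \<Phi>)"
    by (auto simp: dirac_op_def)
  note si = test_function_square_integrable(1)[OF t] test_function_square_integrable(2)[OF t, of M]
  obtain c d where cd: "- (pi/2) < c" "c < d" "d < pi/2" "\<And>x. x \<notin> {c<..<d} \<Longrightarrow> \<Phi> x = 0"
    "\<And>x. x \<notin> {c..d} \<Longrightarrow> dirac_expr M \<Phi> x = 0"
    using test_function_support[OF t] by metis
  let ?W = "\<lambda>x. cnj (f x $ 2) * \<Phi> x $ 1 - cnj (f x $ 1) * \<Phi> x $ 2"
  let ?w = "\<lambda>x. cdot (f x) (dirac_expr M \<Phi> x) - cdot (h x) (\<Phi> x)"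
  have "(?W has_vector_derivative ?w x) (at x)" if x: "x \<in> I0" for x
  proof -
    let ?\<Phi>' = "vector_derivative \<Phi> (at x)"
    have d\<Phi>: "((\<lambda>x. \<Phi> x $ i) has_vector_derivative ?\<Phi>' $ i) (at x)" for i
      by (rule has_vector_derivative_nth[OF test_function_derivative[OF t]])
    have df: "((\<lambda>x. cnj (f x $ i)) has_vector_derivative cnj (f' x $ i)) (at x)" for i
      by (rule has_vector_derivative_cnj[OF has_vector_derivative_nth[OF der[OF x]]])
    have "(?W has_vector_derivative
        (cnj (f x $ 2) * ?\<Phi>' $ 1 + cnj (f' x $ 2) * \<Phi> x $ 1) -
        (cnj (f x $ 1) * ?\<Phi>' $ 2 + cnj (f' x $ 1) * \<Phi> x $ 2)) (at x)"
      by (intro has_vector_derivative_diff has_vector_derivative_mult d\<Phi> df)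
    also have "(cnj (f x $ 2) * ?\<Phi>' $ 1 + cnj (f' x $ 2) * \<Phi> x $ 1) -
        (cnj (f x $ 1) * ?\<Phi>' $ 2 + cnj (f' x $ 1) * \<Phi> x $ 2) = ?w x"
      by (simp add: cdot_def sum_2 h1[OF x] h2[OF x] dirac_expr_nth[OF test_function_derivative[OF t]] algebra_simps)
    finally show ?thesis .
  qed
  then have "(?w has_integral ?W d - ?W c) {c..d}"
    using cd by (intro fundamental_theorem_of_calculus) (auto intro: has_vector_derivative_at_within)
  then have 0: "(?w has_integral 0) {c..d}" using cd(4)[of c] cd(4)[of d] by simp
  have v: "vanishes_off c d (\<lambda>x. cdot (f x) (dirac_expr M \<Phi> x))" "vanishes_off c d (\<lambda>x. cdot (h x) (\<Phi> x))"
    using cd(4,5) by (auto simp: vanishes_off_def cdot_def)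
  have "cinner (abs_L2 f) \<phi>' - cinner (abs_L2 h) \<phi> = (\<integral>x. ?w x \<partial>lebesgue_on I0)"
    unfolding \<phi> by (simp add: cinner_abs_L2 f h si square_integrable_cdot)
  also have "\<dots> = integral {c..d} ?w"
    using v cd f h si
    by (intro integral_lebesgue_on_vanishes_off Bochner_Integration.integrable_diff square_integrable_cdot)
      (auto simp: vanishes_off_def)
  also have "\<dots> = 0" using 0 by (rule integral_unique)
  finally show "cinner (abs_L2 f) \<phi>' = cinner (abs_L2 h) \<phi>" by simp
qed

lemma dirac_op_subset_adjoint: "dirac_op M \<subseteq> adjoint_op (dirac_op M)"
proof clarify
  fix \<phi> \<phi>' assume "(\<phi>, \<phi>') \<in> dirac_op M"
  then obtain \<Phi> where t: "test_function \<Phi>" and \<phi>: "\<phi> = abs_L2 \<Phi>" "\<phi>' = abs_L2 (dirac_expr M \<Phi>)"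
    by (auto simp: dirac_op_def)
  show "(\<phi>, \<phi>') \<in> adjoint_op (dirac_op M)"
    unfolding \<phi>
    by (rule differentiable_imp_adjoint[OF test_function_square_integrable[OF t] test_function_derivative[OF t]])
      (rule dirac_expr_nth[OF test_function_derivative[OF t]])+
qed

section \<open>Linearity of the operator and density of its domain\<close>

lemma test_function_zero: "test_function (\<lambda>x. 0)"
  by (auto simp: test_function_def smooth_def intro!: exI[of _ "\<lambda>n x. 0"])

lemma test_function_add:
  assumes "test_function f" "test_function g"
  shows "test_function (\<lambda>x. f x + g x)"
  unfolding test_function_def
proof (intro conjI)
  obtain F where F: "F 0 = f" "\<And>n x. (F n has_vector_derivative F (Suc n) x) (at x)"
    using assms(1) unfolding test_function_def smooth_def by blast
  obtain G where G: "G 0 = g" "\<And>n x. (G n has_vector_derivative G (Suc n) x) (at x)"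
    using assms(2) unfolding test_function_def smooth_def by blast
  show "smooth (\<lambda>x. f x + g x)"
    unfolding smooth_def
    by (intro exI[of _ "\<lambda>n x. F n x + G n x"] conjI allI has_vector_derivative_add F(2) G(2)) (simp add: F(1) G(1))
  have sub: "closure {x. f x + g x \<noteq> 0} \<subseteq> closure {x. f x \<noteq> 0} \<union> closure {x. g x \<noteq> 0}"
    unfolding closure_Un[symmetric] by (rule closure_mono) auto
  show "closure {x. f x + g x \<noteq> 0} \<subseteq> I0" using sub assms unfolding test_function_def by blast
  have "compact (closure {x. f x \<noteq> 0} \<union> closure {x. g x \<noteq> 0})"
    using assms by (auto simp: test_function_def)
  from bounded_subset[OF compact_imp_bounded[OF this] sub]
  show "compact (closure {x. f x + g x \<noteq> 0})" by (simp add: compact_eq_bounded_closed)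
qed

lemma bounded_linear_vector_scalar_mult: "bounded_linear (\<lambda>v :: complex ^ 2. c *s v)"
  by (rule bounded_linear_intro[of _ "cmod c"])
    (auto simp: vec_eq_iff algebra_simps norm_vec_def L2_set_def norm_mult power_mult_distrib
      real_sqrt_mult scaleR_conv_of_real simp flip: sum_distrib_left)

lemma test_function_scale:
  assumes "test_function f"
  shows "test_function (\<lambda>x. c *s f x)"
  unfolding test_function_def
proof (intro conjI)
  obtain F where F: "F 0 = f" "\<And>n x. (F n has_vector_derivative F (Suc n) x) (at x)"
    using assms unfolding test_function_def smooth_def by blast
  show "smooth (\<lambda>x. c *s f x)"
    unfolding smooth_def
    by (intro exI[of _ "\<lambda>n x. c *s F n x"] conjI allI F(2)
        bounded_linear.has_vector_derivative[OF bounded_linear_vector_scalar_mult]) (simp add: F(1))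
  have sub: "closure {x. c *s f x \<noteq> 0} \<subseteq> closure {x. f x \<noteq> 0}"
    by (rule closure_mono) auto
  show "closure {x. c *s f x \<noteq> 0} \<subseteq> I0" using sub assms unfolding test_function_def by blast
  have "bounded (closure {x. c *s f x \<noteq> 0})"
    using assms by (intro bounded_subset[OF compact_imp_bounded sub]) (simp add: test_function_def)
  then show "compact (closure {x. c *s f x \<noteq> 0})" by (simp add: compact_eq_bounded_closed)
qed

lemma dirac_expr_add:
  assumes "test_function f" "test_function g"
  shows "dirac_expr M (\<lambda>x. f x + g x) x = dirac_expr M f x + dirac_expr M g x"
  by (simp add: vec_eq_iff forall_2 algebra_simps
      dirac_expr_nth[OF has_vector_derivative_add[OF assms[THEN test_function_derivative]]]
      dirac_expr_nth[OF test_function_derivative[OF assms(1)]]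
      dirac_expr_nth[OF test_function_derivative[OF assms(2)]])

lemma dirac_expr_scale:
  assumes "test_function f"
  shows "dirac_expr M (\<lambda>x. c *s f x) x = c *s dirac_expr M f x"
  by (simp add: vec_eq_iff forall_2 algebra_simps dirac_expr_nth[OF test_function_derivative[OF assms]]
      dirac_expr_nth[OF bounded_linear.has_vector_derivative[OF bounded_linear_vector_scalar_mult test_function_derivative[OF assms]]])

lemma linear_graph_dirac_op: "linear_graph (dirac_op M)"
  unfolding linear_graph_def
proof safe
  have "dirac_expr M (\<lambda>x. 0) = (\<lambda>x. 0)"
    using dirac_expr_nth[OF has_vector_derivative_const, of M "0 :: complex ^ 2"]
    by (auto simp: vec_eq_iff forall_2)
  then show "(0, 0) \<in> dirac_op M"
    using dirac_opI[OF test_function_zero, of M] by (simp add: abs_L2_zero)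
next
  fix \<phi> \<phi>' \<psi> \<psi>' assume "(\<phi>, \<phi>') \<in> dirac_op M" "(\<psi>, \<psi>') \<in> dirac_op M"
  then obtain \<Phi> \<Psi> where *: "test_function \<Phi>" "test_function \<Psi>" "\<phi> = abs_L2 \<Phi>" "\<phi>' = abs_L2 (dirac_expr M \<Phi>)"
    "\<psi> = abs_L2 \<Psi>" "\<psi>' = abs_L2 (dirac_expr M \<Psi>)"
    by (auto simp: dirac_op_def)
  have "dirac_expr M (\<lambda>x. \<Phi> x + \<Psi> x) = (\<lambda>x. dirac_expr M \<Phi> x + dirac_expr M \<Psi> x)"
    by (intro ext dirac_expr_add *)
  with * show "(\<phi> + \<psi>, \<phi>' + \<psi>') \<in> dirac_op M"
    using dirac_opI[OF test_function_add[OF *(1,2)], of M]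
    by (simp add: abs_L2_add test_function_square_integrable)
next
  fix \<phi> \<phi>' c assume "(\<phi>, \<phi>') \<in> dirac_op M"
  then obtain \<Phi> where *: "test_function \<Phi>" "\<phi> = abs_L2 \<Phi>" "\<phi>' = abs_L2 (dirac_expr M \<Phi>)"
    by (auto simp: dirac_op_def)
  have "dirac_expr M (\<lambda>x. c *s \<Phi> x) = (\<lambda>x. c *s dirac_expr M \<Phi> x)"
    by (intro ext dirac_expr_scale *)
  with * show "(c *\<^sub>C \<phi>, c *\<^sub>C \<phi>') \<in> dirac_op M"
    using dirac_opI[OF test_function_scale[OF *(1), of c], of M]
    by (simp add: abs_L2_scaleC test_function_square_integrable)
qed

text \<open>Both \<open>0' = f\<close> and \<open>f' = 0\<close> hold weakly, so \<open>f\<close> is a constant with vanishing integrals.\<close>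

lemma weak_deriv_zero_imp_AE_zero:
  assumes f: "f absolutely_integrable_on I0"
    and orth: "\<And>c d \<phi>. \<lbrakk>- (pi/2) < c; d < pi/2; smooth_real \<phi>; vanishes_off c d \<phi>\<rbrakk> \<Longrightarrow>
      integral {c..d} (\<lambda>x. \<phi> x *\<^sub>R f x) = 0"
  obtains N where "negligible N" "\<And>x. x \<in> I0 \<Longrightarrow> x \<notin> N \<Longrightarrow> f x = (0::complex)"
proof -
  have ai: "f absolutely_integrable_on {c..d}" if "- (pi/2) < c" "d < pi/2" for c d
    using f by (rule set_integrable_subset) (use that in auto)
  define h where "h = (\<lambda>x :: real. 0 :: complex)"
  have w1: "weak_deriv_on_I0 h f"
    unfolding weak_deriv_on_I0_def h_def
    by (intro allI impI conjI ai absolutely_integrable_zero) (simp_all add: orth)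
  have w2: "weak_deriv_on_I0 f h"
    unfolding weak_deriv_on_I0_def h_def
  proof (intro allI impI conjI)
    fix c d :: real and \<phi> \<phi>' assume cd: "- (pi/2) < c" "d < pi/2"
      and \<phi>: "smooth_real \<phi>" "\<forall>x. (\<phi> has_real_derivative \<phi>' x) (at x)" "vanishes_off c d \<phi>"
    have d: "deriv \<phi> = \<phi>'" using \<phi>(2) by (auto intro: DERIV_imp_deriv)
    have "vanishes_off c d \<phi>'" using vanishes_off_deriv[OF \<phi>(3)] d by simp
    with orth[OF cd, of \<phi>'] smooth_real_deriv(2)[OF \<phi>(1)] d
    show "integral {c..d} (\<lambda>x. \<phi>' x *\<^sub>R f x) = - integral {c..d} (\<lambda>x. \<phi> x *\<^sub>R 0)" by simp
  qed (use ai in \<open>auto simp: absolutely_integrable_zero\<close>)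
  obtain N1 where N1: "negligible N1"
    "\<And>a b. \<lbrakk>a \<in> I0; b \<in> I0; a < b; a \<notin> N1; b \<notin> N1\<rbrakk> \<Longrightarrow> h b - h a = integral {a..b} f"
    using weak_deriv_imp_primitive[OF w1] by blast
  obtain N2 where N2: "negligible N2"
    "\<And>a b. \<lbrakk>a \<in> I0; b \<in> I0; a < b; a \<notin> N2; b \<notin> N2\<rbrakk> \<Longrightarrow> f b - f a = integral {a..b} h"
    using weak_deriv_imp_primitive[OF w2] by blast
  show ?thesis
  proof (rule that[of "N1 \<union> N2"])
    show N: "negligible (N1 \<union> N2)" using N1 N2 by (intro negligible_Un)
    fix x assume x: "x \<in> I0" "x \<notin> N1 \<union> N2"
    have const: "f y = f x" if "y \<in> I0" "y \<notin> N2" for y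
    proof (cases x y rule: linorder_cases)
      case less
      then show ?thesis using N2(2)[of x y] that x by (simp add: h_def)
    next
      case greater
      then show ?thesis using N2(2)[of y x] that x by (simp add: h_def)
    qed simp
    have "\<not> {x<..<pi/2} \<subseteq> N1 \<union> N2"
      using negligible_subset[OF N, of "{x<..<pi/2}"] negligible_interval(2)[of x "pi/2"] x by auto
    then obtain y where "y \<in> {x<..<pi/2}" and y': "y \<notin> N1 \<union> N2" by blast
    then have y: "x < y" "y < pi/2" "y \<notin> N1 \<union> N2" by auto
    have "integral {x..y} f = integral {x..y} (\<lambda>_. f x)"
    proof (rule integral_spike[OF N2(1)])
      fix t assume "t \<in> {x..y} - N2"
      then have "t \<in> I0" "t \<notin> N2" using x y by auto
      then show "f x = f t" by (rule const[symmetric])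
    qed
    also have "\<dots> = (y - x) *\<^sub>R f x" using y by simp
    finally have "(y - x) *\<^sub>R f x = integral {x..y} f" by (rule sym)
    also have "\<dots> = 0" using N1(2)[of x y] x y by (simp add: h_def)
    finally have "(y - x) *\<^sub>R f x = 0" .
    then show "f x = 0" using y by simp
  qed
qed

lemma AE_lebesgue_on_negligible:
  assumes "negligible N" "\<And>x. x \<in> I0 \<Longrightarrow> x \<notin> N \<Longrightarrow> P x"
  shows "AE x in lebesgue_on I0. P x"
proof -
  have "AE x in lebesgue. x \<notin> N"
    using assms(1) by (auto simp: negligible_iff_null_sets intro: AE_not_in)
  then have "AE x in lebesgue. x \<in> I0 \<longrightarrow> P x" by eventually_elim (use assms(2) in auto)
  then show ?thesis by (simp add: AE_restrict_space_iff)
qed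

text \<open>A vector outside the closure of the domain would leave a nonzero remainder after
  projection. This remainder is orthogonal to all test functions, so both of its components vanish
  almost everywhere.\<close>

lemma dense_dirac_op: "closure (Domain (dirac_op M)) = UNIV"
proof (rule ccontr)
  let ?D = "Domain (dirac_op M)"
  assume "closure ?D \<noteq> UNIV"
  then obtain \<xi> where \<xi>: "\<xi> \<notin> closure ?D" by blast
  have "subspace ?D"
  proof (rule subspaceI)
    note lin = linear_graphD[OF linear_graph_dirac_op[of M]]
    show "0 \<in> ?D" using lin(1) by blast
    show "\<phi> + \<psi> \<in> ?D" if "\<phi> \<in> ?D" "\<psi> \<in> ?D" for \<phi> \<psi> using that lin(2) by blast
    show "c *\<^sub>R \<phi> \<in> ?D" if "\<phi> \<in> ?D" for c \<phi>
      unfolding scaleR_scaleC_L2 using that lin(3) by blast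
  qed
  then have sub: "subspace (closure ?D)" by (rule subspace_closure)
  obtain y where y: "y \<in> closure ?D" "\<And>s. s \<in> closure ?D \<Longrightarrow> (\<xi> - y) \<bullet> s = 0"
    using closed_subspace_projection[OF sub closed_closure, of \<xi>] by blast
  obtain f where f: "square_integrable f" "\<xi> - y = abs_L2 f" by (rule L2_cases)
  have orth: "cinner (abs_L2 \<Phi>) (abs_L2 f) = 0" if t: "test_function \<Phi>" for \<Phi>
  proof -
    \<comment> \<open>The projection gives real orthogonality; the rotated test function supplies
      the imaginary part.\<close>
    have m: "abs_L2 \<Phi> \<in> ?D" "(- \<i>) *\<^sub>C abs_L2 \<Phi> \<in> ?D"
      using dirac_opI[OF t, of M] linear_graphD(3)[OF linear_graph_dirac_op dirac_opI[OF t], of "- \<i>" M] by blast+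
    then have z: "(\<xi> - y) \<bullet> abs_L2 \<Phi> = 0" "(\<xi> - y) \<bullet> (- \<i>) *\<^sub>C abs_L2 \<Phi> = 0"
      using closure_subset[of ?D] by (intro y(2); blast)+
    have "cinner (abs_L2 f) (abs_L2 \<Phi>) = 0"
      unfolding cinner_eq_Complex f(2)[symmetric] z by (simp add: complex_eq_iff)
    then show ?thesis by (subst cinner_commute) simp
  qed
  have "\<exists>N. negligible N \<and> (\<forall>x\<in>I0 - N. f x $ i = 0)" for i
  proof -
    have *: "integral {c..d} (\<lambda>x. \<phi> x *\<^sub>R f x $ i) = 0"
      if cd: "- (pi/2) < c" "d < pi/2" and \<phi>: "smooth_real \<phi>" "vanishes_off c d \<phi>" for c d \<phi>
    proof -
      have t: "test_function (\<lambda>x. axis i (of_real (\<phi> x)))" by (rule test_function_axis[OF \<phi> cd])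
      have eq: "cdot (axis i (complex_of_real (\<phi> x))) (f x) = \<phi> x *\<^sub>R f x $ i" for x
        using exhaust_2[of i] by (auto simp: cdot_def sum_2 axis_component scaleR_conv_of_real)
      have "vanishes_off c d (\<lambda>x. \<phi> x *\<^sub>R f x $ i)" using \<phi>(2) by (simp add: vanishes_off_def)
      moreover have "integrable (lebesgue_on I0) (\<lambda>x. \<phi> x *\<^sub>R f x $ i)"
        using square_integrable_cdot[OF test_function_square_integrable(1)[OF t] f(1)] by (simp add: eq)
      ultimately show ?thesis
        using orth[OF t] cd f(1) test_function_square_integrable(1)[OF t]
        by (simp add: cinner_abs_L2 eq integral_lebesgue_on_vanishes_off)
    qed
    show ?thesis
      by (rule weak_deriv_zero_imp_AE_zero[OF square_integrable_nth[OF f(1), of i] *]) auto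
  qed
  then obtain N where N': "\<And>i. negligible (N i) \<and> (\<forall>x\<in>I0 - N i. f x $ i = 0)" by metis
  then have N: "\<And>i. negligible (N i)" "\<And>i x. x \<in> I0 \<Longrightarrow> x \<notin> N i \<Longrightarrow> f x $ i = 0"
    by blast+
  have "AE x in lebesgue_on I0. f x = 0"
    by (rule AE_lebesgue_on_negligible[of "N 1 \<union> N 2"])
      (use N in \<open>auto simp: vec_eq_iff forall_2 intro: negligible_Un\<close>)
  then have "abs_L2 f = 0"
    using abs_L2_eq_iff[OF f(1) square_integrable_zero] by (simp add: abs_L2_zero)
  then have "\<xi> = y" using f(2) by simp
  then show False using \<xi> y(1) by simp
qed

text \<open>Single-valuedness says that the operator is well defined on classes of functions. It is
  inherited from the adjoint, which contains the graph and is single valued because the domain is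
  dense.\<close>

lemma symmetric_dirac_op: "symmetric_op (dirac_op M)"
proof -
  have "single_valued (dirac_op M)"
    using single_valued_subset[OF dirac_op_subset_adjoint single_valued_adjoint[OF dense_dirac_op]] .
  then show ?thesis
    using dirac_op_subset_adjoint[of M] linear_graph_dirac_op dense_dirac_op
    by (auto simp: symmetric_op_def densely_defined_op_def adjoint_op_def)
qed

subsection \<open>Square-integrable solutions for large mass\<close>

definition solves :: "real \<Rightarrow> complex \<Rightarrow> (real \<Rightarrow> complex) \<Rightarrow> (real \<Rightarrow> complex) \<Rightarrow> bool" where
  "solves M z u v \<longleftrightarrow> (\<forall>x\<in>I0.
     (u has_vector_derivative z * v x - of_real (mass M x) * u x) (at x) \<and>
     (v has_vector_derivative of_real (mass M x) * v x - z * u x) (at x))"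

abbreviation spinor :: "(real \<Rightarrow> complex) \<Rightarrow> (real \<Rightarrow> complex) \<Rightarrow> real \<Rightarrow> complex ^ 2" where
  "spinor u v x \<equiv> vector [u x, v x]"

lemma continuous_on_spinor:
  assumes "continuous_on S u" "continuous_on S v"
  shows "continuous_on S (spinor u v)"
proof -
  have "continuous_on S (\<lambda>x. spinor u v x $ i)" for i
    using exhaust_2[of i] assms by auto
  then have "continuous_on S (\<lambda>x. \<chi> i. spinor u v x $ i)" by (intro continuous_on_vec_lambda)
  then show ?thesis by simp
qed

lemma has_vector_derivative_spinor:
  assumes "(u has_vector_derivative u') (at x)" "(v has_vector_derivative v') (at x)"
  shows "(spinor u v has_vector_derivative vector [u', v']) (at x)"
proof -
  have eq: "vector [a, b] = axis 1 a + (axis 2 b :: complex ^ 2)" for a b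
    by (simp add: vec_eq_iff forall_2 axis_component)
  have bl: "bounded_linear (\<lambda>a :: complex. axis i a :: complex ^ 2)" for i
    by (simp add: linear_conv_bounded_linear[symmetric] linear_iff vec_eq_iff axis_component)
  show ?thesis
    unfolding eq
    by (intro has_vector_derivative_add bounded_linear.has_vector_derivative[OF bl] assms)
qed

text \<open>Regularity in two rounds: the weak equations give continuous representatives
  \<open>u\<close> and \<open>v\<close>, and then the right-hand sides agree almost everywhere with
  continuous functions of \<open>u\<close> and \<open>v\<close>, so the equations hold
  classically.\<close>

lemma adjoint_eigenvector_solves:
  assumes "(\<psi>, z *\<^sub>C \<psi>) \<in> adjoint_op (dirac_op M)"
  obtains u v where "solves M z u v" "square_integrable (spinor u v)" "\<psi> = abs_L2 (spinor u v)"
proof -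
  obtain f where f: "square_integrable f" "\<psi> = abs_L2 f" by (rule L2_cases)
  have weak: "cinner (abs_L2 (dirac_expr M \<Phi>)) (abs_L2 f) = cinner (abs_L2 \<Phi>) (abs_L2 (\<lambda>x. z *s f x))"
    if "test_function \<Phi>" for \<Phi>
  proof -
    have "cinner (abs_L2 (dirac_expr M \<Phi>)) (abs_L2 f) = cnj (cinner (abs_L2 f) (abs_L2 (dirac_expr M \<Phi>)))"
      by (rule cinner_commute)
    also have "\<dots> = cnj (cinner (z *\<^sub>C abs_L2 f) (abs_L2 \<Phi>))"
      using adjointD[OF assms dirac_opI[OF that]] by (simp only: f(2))
    also have "\<dots> = cinner (abs_L2 \<Phi>) (z *\<^sub>C abs_L2 f)"
      by (rule cinner_commute[symmetric])
    finally show ?thesis by (simp only: abs_L2_scaleC[OF f(1)])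
  qed
  define g1 where "g1 = (\<lambda>x. z * f x $ 2 - of_real (mass M x) * f x $ 1)"
  define g2 where "g2 = (\<lambda>x. of_real (mass M x) * f x $ 2 - z * f x $ 1)"
  have w: "weak_deriv_on_I0 (\<lambda>x. f x $ 1) g1" "weak_deriv_on_I0 (\<lambda>x. f x $ 2) g2"
    using weak_equations[OF f(1) square_integrable_scaleC[OF f(1)] weak] by (simp_all add: g1_def g2_def)
  have ai: "g1 absolutely_integrable_on {c..d}" "g2 absolutely_integrable_on {c..d}"
    if "- (pi/2) < c" "d < pi/2" for c d
    using w that unfolding weak_deriv_on_I0_def by blast+
  obtain u N1 where "negligible N1 \<and> (\<forall>x\<in>I0. x \<notin> N1 \<longrightarrow> u x = f x $ 1) \<and>
      (\<forall>a\<in>I0. \<forall>b\<in>I0. a \<le> b \<longrightarrow> u b - u a = integral {a..b} g1)"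
    using weak_deriv_continuous_representative[OF w(1)] by (elim exE)
  then have u: "negligible N1" "\<And>x. x \<in> I0 \<Longrightarrow> x \<notin> N1 \<Longrightarrow> u x = f x $ 1"
    "\<And>a b. a \<in> I0 \<Longrightarrow> b \<in> I0 \<Longrightarrow> a \<le> b \<Longrightarrow> u b - u a = integral {a..b} g1"
    by auto
  obtain v N2 where "negligible N2 \<and> (\<forall>x\<in>I0. x \<notin> N2 \<longrightarrow> v x = f x $ 2) \<and>
      (\<forall>a\<in>I0. \<forall>b\<in>I0. a \<le> b \<longrightarrow> v b - v a = integral {a..b} g2)"
    using weak_deriv_continuous_representative[OF w(2)] by (elim exE)
  then have v: "negligible N2" "\<And>x. x \<in> I0 \<Longrightarrow> x \<notin> N2 \<Longrightarrow> v x = f x $ 2"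
    "\<And>a b. a \<in> I0 \<Longrightarrow> b \<in> I0 \<Longrightarrow> a \<le> b \<Longrightarrow> v b - v a = integral {a..b} g2"
    by auto
  have cu: "continuous_on I0 u" and cv: "continuous_on I0 v"
    by (rule continuous_on_of_primitive[OF u(3) ai(1)] continuous_on_of_primitive[OF v(3) ai(2)]; assumption)+
  have N: "negligible (N1 \<union> N2)" using u v by (intro negligible_Un)
  have cm: "continuous_on I0 (\<lambda>x. complex_of_real (mass M x))"
    by (intro continuous_intros continuous_on_mass) simp
  have solves: "solves M z u v"
    unfolding solves_def
  proof (intro ballI conjI)
    fix x assume x: "x \<in> I0"
    have "(u has_vector_derivative (\<lambda>x. z * v x - of_real (mass M x) * u x) x) (at x)"
    proof (rule has_vector_derivative_of_primitive[where g = g1, OF _ N _ _ x])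
      show "u b - u a = integral {a..b} g1" if "a \<in> I0" "b \<in> I0" "a \<le> b" for a b
        using that by (rule u(3))
      show "g1 y = z * v y - of_real (mass M y) * u y" if "y \<in> I0" "y \<notin> N1 \<union> N2" for y
        using u(2)[of y] v(2)[of y] that by (simp add: g1_def)
    qed (intro continuous_intros cu cv cm)
    then show "(u has_vector_derivative z * v x - of_real (mass M x) * u x) (at x)" .
    have "(v has_vector_derivative (\<lambda>x. of_real (mass M x) * v x - z * u x) x) (at x)"
    proof (rule has_vector_derivative_of_primitive[where g = g2, OF _ N _ _ x])
      show "v b - v a = integral {a..b} g2" if "a \<in> I0" "b \<in> I0" "a \<le> b" for a b
        using that by (rule v(3))
      show "g2 y = of_real (mass M y) * v y - z * u y" if "y \<in> I0" "y \<notin> N1 \<union> N2" for y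
        using u(2)[of y] v(2)[of y] that by (simp add: g2_def)
    qed (intro continuous_intros cu cv cm)
    then show "(v has_vector_derivative of_real (mass M x) * v x - z * u x) (at x)" .
  qed
  have ae: "AE x in lebesgue_on I0. f x = spinor u v x"
  proof (rule AE_lebesgue_on_negligible[OF N])
    show "f x = spinor u v x" if "x \<in> I0" "x \<notin> N1 \<union> N2" for x
      using u(2)[of x] v(2)[of x] that by (simp add: vec_eq_iff forall_2)
  qed
  have sq: "square_integrable (spinor u v)"
  proof -
    have m: "spinor u v \<in> borel_measurable (lebesgue_on I0)"
      by (intro continuous_imp_measurable_on_sets_lebesgue continuous_on_spinor cu cv) simp
    have "integrable (lebesgue_on I0) (\<lambda>x. (norm (f x))\<^sup>2) = integrable (lebesgue_on I0) (\<lambda>x. (norm (spinor u v x))\<^sup>2)"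
    proof (rule integrable_cong_AE)
      show "AE x in lebesgue_on I0. (norm (f x))\<^sup>2 = (norm (spinor u v x))\<^sup>2"
        using ae by eventually_elim simp
    qed (use square_integrable_measurable[OF f(1)] m in measurable)
    then show ?thesis using m f(1) by (simp add: square_integrable_def)
  qed
  have "\<psi> = abs_L2 (spinor u v)" using f sq ae by (simp add: abs_L2_eq_iff)
  then show ?thesis by (rule that[OF solves sq])
qed

text \<open>Reflection reverses the sign of the derivatives and leaves the even mass unchanged;
  exchanging the components restores the system. Arguments at the right endpoint thereby carry over
  to the left one.\<close>

lemma solves_reflect:
  assumes "solves M z u v"
  shows "solves M z (\<lambda>x. v (- x)) (\<lambda>x. u (- x))"
  unfolding solves_def
proof (intro ballI conjI)
  fix x assume x: "x \<in> I0"
  have d: "(uminus has_vector_derivative (- 1 :: real)) (at x)"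
    by (auto intro!: derivative_eq_intros simp flip: has_real_derivative_iff_has_vector_derivative)
  have mx: "- x \<in> I0" using x by auto
  have m: "mass M (- x) = mass M x" by (simp add: mass_def)
  have du: "(u has_vector_derivative z * v (- x) - of_real (mass M x) * u (- x)) (at (- x))"
    and dv: "(v has_vector_derivative of_real (mass M x) * v (- x) - z * u (- x)) (at (- x))"
    using assms mx unfolding solves_def m[symmetric] by blast+
  show "((\<lambda>x. v (- x)) has_vector_derivative z * u (- x) - of_real (mass M x) * v (- x)) (at x)"
    using vector_diff_chain_at[OF d dv] by (simp add: o_def)
  show "((\<lambda>x. u (- x)) has_vector_derivative of_real (mass M x) * u (- x) - z * v (- x)) (at x)"
    using vector_diff_chain_at[OF d du] by (simp add: o_def)
qed

lemma has_real_derivative_Re_cnj_mult: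
  assumes "(f has_vector_derivative f') (at x)" "(g has_vector_derivative g') (at x)"
  shows "((\<lambda>x. Re (cnj (f x) * g x)) has_real_derivative Re (cnj f' * g x + cnj (f x) * g')) (at x)"
proof -
  have "((\<lambda>x. cnj (f x) * g x) has_vector_derivative cnj (f x) * g' + cnj f' * g x) (at x)"
    by (intro has_vector_derivative_mult has_vector_derivative_cnj assms)
  from bounded_linear.has_vector_derivative[OF bounded_linear_Re this] show ?thesis
    by (simp add: has_real_derivative_iff_has_vector_derivative add.commute)
qed

definition flux :: "complex \<Rightarrow> (real \<Rightarrow> complex) \<Rightarrow> (real \<Rightarrow> complex) \<Rightarrow> real \<Rightarrow> real" where
  "flux z u v x = Re (cnj (u x) * (z * v x))"

lemma cmod_sq_eq_Re: "(cmod a)\<^sup>2 = Re (cnj a * a)"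
  by (simp add: cmod_power2) (simp add: power2_eq_square)

text \<open>In the derivative of the flux the mass terms cancel, and \<open>z * z = - 1\<close>
  together with \<open>cmod z = 1\<close> gives both squares the same positive sign. This is where
  the eigenvalue being imaginary matters.\<close>

lemma solves_derivatives:
  assumes s: "solves M z u v" and z: "z = \<i> \<or> z = - \<i>" and x: "x \<in> I0"
  shows "((\<lambda>x. flux z u v x) has_real_derivative (cmod (u x))\<^sup>2 + (cmod (v x))\<^sup>2) (at x)"
    "((\<lambda>x. (cmod (u x))\<^sup>2) has_real_derivative 2 * flux z u v x - 2 * mass M x * (cmod (u x))\<^sup>2) (at x)"
    "((\<lambda>x. (cmod (v x))\<^sup>2) has_real_derivative 2 * flux z u v x + 2 * mass M x * (cmod (v x))\<^sup>2) (at x)"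
proof -
  have du: "(u has_vector_derivative z * v x - mass M x * u x) (at x)"
    and dv: "(v has_vector_derivative mass M x * v x - z * u x) (at x)"
    using s x by (auto simp: solves_def)
  have dzv: "((\<lambda>x. z * v x) has_vector_derivative z * (mass M x * v x - z * u x)) (at x)"
    by (rule has_vector_derivative_mult_right[OF dv])
  show "((\<lambda>x. flux z u v x) has_real_derivative (cmod (u x))\<^sup>2 + (cmod (v x))\<^sup>2) (at x)"
    unfolding flux_def
    by (rule DERIV_cong[OF has_real_derivative_Re_cnj_mult[OF du dzv]])
      (use z in \<open>auto simp: cmod_sq_eq_Re algebra_simps\<close>)
  show "((\<lambda>x. (cmod (u x))\<^sup>2) has_real_derivative 2 * flux z u v x - 2 * mass M x * (cmod (u x))\<^sup>2) (at x)"
    unfolding flux_def cmod_sq_eq_Re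
    by (rule DERIV_cong[OF has_real_derivative_Re_cnj_mult[OF du du]])
      (use z in \<open>auto simp: algebra_simps\<close>)
  show "((\<lambda>x. (cmod (v x))\<^sup>2) has_real_derivative 2 * flux z u v x + 2 * mass M x * (cmod (v x))\<^sup>2) (at x)"
    unfolding flux_def cmod_sq_eq_Re
    by (rule DERIV_cong[OF has_real_derivative_Re_cnj_mult[OF dv dv]])
      (use z in \<open>auto simp: algebra_simps\<close>)
qed

lemma nonneg_derivative_imp_le:
  fixes f :: "real \<Rightarrow> real"
  assumes "\<And>x. a \<le> x \<Longrightarrow> x \<le> b \<Longrightarrow> (f has_real_derivative f' x) (at x)" "\<And>x. a \<le> x \<Longrightarrow> x \<le> b \<Longrightarrow> f' x \<ge> 0" "a \<le> b"
  shows "f a \<le> f b"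
proof (rule DERIV_nonneg_imp_nondecreasing[OF assms(3)])
  fix x assume "a \<le> x" "x \<le> b"
  then show "\<exists>y. (f has_real_derivative y) (at x) \<and> 0 \<le> y"
    using assms(1)[of x] assms(2)[of x] by auto
qed

lemma not_integrable_inverse_distance:
  fixes Q :: "real \<Rightarrow> real"
  assumes Q: "Q integrable_on I0" "\<And>x. x \<in> I0 \<Longrightarrow> 0 \<le> Q x"
    and c: "c > 0" and a: "a \<in> I0" and le: "\<And>x. x \<in> I0 \<Longrightarrow> a \<le> x \<Longrightarrow> c / (pi/2 - x) \<le> Q x"
  shows False
proof -
  define I where "I = integral I0 Q"
  have I: "I \<ge> 0" unfolding I_def using Q by (intro integral_nonneg) auto
  \<comment> \<open>Chosen such that the integral of \<open>c / (pi/2 - x)\<close> over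
    \<open>{a..b}\<close> is exactly \<open>I + 1\<close>, more than the whole integral of
    \<open>Q\<close>.\<close>
  define b where "b = pi/2 - exp (ln (pi/2 - a) - (I + 1) / c)"
  have a': "- (pi/2) < a" "a < pi/2" using a by auto
  have b2: "b < pi/2" by (simp add: b_def)
  have "exp (ln (pi/2 - a) - (I + 1) / c) < exp (ln (pi/2 - a))"
    using I c by (subst exp_less_cancel_iff) (simp add: field_simps)
  then have ab: "a < b" using a' by (simp add: b_def)
  have sub: "{a..b} \<subseteq> I0" using a' b2 by auto
  have der: "((\<lambda>x. - c * ln (pi/2 - x)) has_real_derivative c / (pi/2 - x)) (at x)" if "x < pi/2" for x
    using that by (auto intro!: derivative_eq_intros simp: field_simps)
  have hi: "((\<lambda>x. c / (pi/2 - x)) has_integral (- c * ln (pi/2 - b) - - c * ln (pi/2 - a))) {a..b}"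
  proof (rule fundamental_theorem_of_calculus)
    fix x assume "x \<in> {a..b}"
    then have "x < pi/2" using b2 by auto
    from has_field_derivative_at_within[OF der[OF this]]
    show "((\<lambda>x. - c * ln (pi/2 - x)) has_vector_derivative c / (pi/2 - x)) (at x within {a..b})"
      by (simp only: has_real_derivative_iff_has_vector_derivative)
  qed (use ab in simp)
  have Qi: "Q integrable_on {a..b}"
    using integrable_on_subinterval[of Q I0 a b] Q(1) sub by auto
  have "- c * ln (pi/2 - b) - - c * ln (pi/2 - a) \<le> integral {a..b} Q"
    using hi Qi le sub by (intro has_integral_le[OF hi integrable_integral[OF Qi]]) auto
  also have "\<dots> \<le> I"
    unfolding I_def using Q Qi sub by (intro integral_subset_le) auto
  finally have "c * ln (pi/2 - a) - c * ln (pi/2 - b) \<le> I" by simp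
  moreover have "c * ln (pi/2 - b) = c * ln (pi/2 - a) - (I + 1)"
    using c by (simp add: b_def right_diff_distrib)
  ultimately show False by linarith
qed

lemma cos_le_distance: "x \<in> I0 \<Longrightarrow> cos x \<le> pi/2 - x"
  using sin_x_le_x[of "pi/2 - x"] by (simp add: sin_cos_eq[symmetric] cos_sin_eq)

text \<open>The mass term enters the equation of \<open>v\<close> with a positive sign and that of
  \<open>u\<close> with a negative one, so towards the right endpoint it is \<open>v\<close> whose
  size is bounded from below.\<close>

lemma flux_nonpos:
  assumes s: "solves M z u v" and z: "z = \<i> \<or> z = - \<i>" and M: "M \<ge> 1/2"
    and int: "(\<lambda>x. (cmod (v x))\<^sup>2) integrable_on I0" and x0: "x0 \<in> I0"
  shows "flux z u v x0 \<le> 0"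
proof (rule ccontr)
  assume pos: "\<not> flux z u v x0 \<le> 0"
  let ?Q = "\<lambda>x. (cmod (v x))\<^sup>2"
  let ?R = "\<lambda>x. (pi/2 - x) * ?Q x"
  have w: "flux z u v x > 0" if "x0 \<le> x" "x < pi/2" for x
  proof -
    have "flux z u v x0 \<le> flux z u v x"
      by (rule nonneg_derivative_imp_le[OF solves_derivatives(1)[OF s z]]) (use x0 that in auto)
    with pos show ?thesis by simp
  qed
  \<comment> \<open>uses \<open>2 M \<ge> 1\<close> and \<open>cos y = sin (\<pi>/2 - y) \<le> \<pi>/2 - y\<close>\<close>
  have mono: "?R x0 \<le> ?R x" if "x0 \<le> x" "x < pi/2" for x
  proof (rule nonneg_derivative_imp_le[OF _ _ that(1)])
    fix y assume y: "x0 \<le> y" "y \<le> x"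
    have yI: "y \<in> I0" using y x0 that by auto
    show "(?R has_real_derivative (pi/2 - y) * (2 * flux z u v y + 2 * mass M y * ?Q y) - ?Q y) (at y)"
      by (rule derivative_eq_intros solves_derivatives(3)[OF s z yI] refl | simp)+
    have "0 \<le> (pi/2 - y) * (2 * flux z u v y)"
      using w[of y] y that yI by (intro mult_nonneg_nonneg) auto
    moreover have "?Q y \<le> (pi/2 - y) * (2 * mass M y) * ?Q y"
    proof -
      have "1 \<le> (pi/2 - y) / cos y"
        using cos_le_distance[OF yI] cos_pos_I0[OF yI] by (simp add: le_divide_eq)
      also have "1 / cos y \<le> 2 * mass M y"
        using mult_right_mono[of 1 "2 * M" "1 / cos y"] cos_pos_I0[OF yI] M by (simp add: mass_def)
      then have "(pi/2 - y) / cos y \<le> (pi/2 - y) * (2 * mass M y)"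
        using mult_left_mono[of "1 / cos y" "2 * mass M y" "pi/2 - y"] yI by simp
      finally show ?thesis using mult_right_mono[of 1 _ "?Q y"] by simp
    qed
    ultimately show "0 \<le> (pi/2 - y) * (2 * flux z u v y + 2 * mass M y * ?Q y) - ?Q y"
      by (simp add: algebra_simps)
  qed
  have "v x0 \<noteq> 0" using pos by (auto simp: flux_def)
  then have c: "?R x0 > 0" using x0 by auto
  show False
  proof (rule not_integrable_inverse_distance[OF int _ c x0])
    fix x assume "x \<in> I0" "x0 \<le> x"
    then show "?R x0 / (pi/2 - x) \<le> ?Q x" using mono[of x] by (simp add: divide_le_eq mult.commute)
  qed simp
qed

lemma square_integrable_spinorD:
  assumes "square_integrable (spinor u v)"
  shows "(\<lambda>x. (cmod (u x))\<^sup>2) integrable_on I0" "(\<lambda>x. (cmod (v x))\<^sup>2) integrable_on I0"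
proof -
  have i: "integrable (lebesgue_on I0) (\<lambda>x. (norm (spinor u v x))\<^sup>2)"
    and m: "spinor u v \<in> borel_measurable (lebesgue_on I0)"
    using assms by (auto simp: square_integrable_def)
  have "integrable (lebesgue_on I0) (\<lambda>x. (cmod (spinor u v x $ i))\<^sup>2)" for i
  proof (rule Bochner_Integration.integrable_bound[OF i])
    show "(\<lambda>x. (cmod (spinor u v x $ i))\<^sup>2) \<in> borel_measurable (lebesgue_on I0)"
      using measurable_vec_nth'[OF m, of i] by measurable
    show "AE x in lebesgue_on I0. norm ((cmod (spinor u v x $ i))\<^sup>2) \<le> norm ((norm (spinor u v x))\<^sup>2)"
      by (auto intro!: AE_I2 power_mono Finite_Cartesian_Product.norm_nth_le)
  qed
  from integrable_on_lebesgue_on[OF this[of 1]] integrable_on_lebesgue_on[OF this[of 2]]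
  show "(\<lambda>x. (cmod (u x))\<^sup>2) integrable_on I0" "(\<lambda>x. (cmod (v x))\<^sup>2) integrable_on I0"
    by simp_all
qed

lemma square_integrable_solution_zero:
  assumes s: "solves M z u v" and z: "z = \<i> \<or> z = - \<i>" and M: "M \<ge> 1/2"
    and sq: "square_integrable (spinor u v)" and x: "x \<in> I0"
  shows "u x = 0" "v x = 0"
proof -
  have le: "flux z u v y \<le> 0" if "y \<in> I0" for y
    by (rule flux_nonpos[OF s z M square_integrable_spinorD(2)[OF sq] that])
  have "(\<lambda>x. (cmod (u (- x)))\<^sup>2) integrable_on I0"
    using Henstock_Kurzweil_Integration.integrable_reflect_real[where f = "\<lambda>x. (cmod (u x))\<^sup>2" and a = "-(pi/2)" and b = "pi/2"] square_integrable_spinorD(1)[OF sq]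
    by (simp add: integrable_on_Icc_iff_Ioo)
  from flux_nonpos[OF solves_reflect[OF s] z M this]
  have "flux z (\<lambda>x. v (- x)) (\<lambda>x. u (- x)) (- y) \<le> 0" if "y \<in> I0" for y
    using that by auto
  \<comment> \<open>Exchanging \<open>u\<close> and \<open>v\<close> conjugates the product apart
    from \<open>z\<close>, and the conjugate of \<open>z\<close> is \<open>- z\<close>.\<close>
  moreover have "flux z (\<lambda>x. v (- x)) (\<lambda>x. u (- x)) (- y) = - flux z u v y" for y
    using z by (auto simp: flux_def)
  ultimately have 0: "flux z u v y = 0" if "y \<in> I0" for y using le that by force
  have "((\<lambda>x. 0) has_real_derivative (0::real)) (at x)" by simp
  then have "(flux z u v has_real_derivative 0) (at x)"
    by (rule has_field_derivative_transform_within_open[of _ _ _ I0]) (use x 0 in auto)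
  with solves_derivatives(1)[OF s z x] have "(cmod (u x))\<^sup>2 + (cmod (v x))\<^sup>2 = 0"
    using DERIV_unique by blast
  then show "u x = 0" "v x = 0" by (auto simp: add_nonneg_eq_0_iff)
qed

lemma abs_L2_spinor_zero:
  assumes "square_integrable (spinor u v)" "\<And>x. x \<in> I0 \<Longrightarrow> u x = 0" "\<And>x. x \<in> I0 \<Longrightarrow> v x = 0"
  shows "abs_L2 (spinor u v) = 0"
proof -
  have "AE x in lebesgue_on I0. spinor u v x = 0"
    by (rule AE_lebesgue_on_negligible[of "{}"]) (auto simp: assms vec_eq_iff forall_2)
  then show ?thesis
    using abs_L2_eq_iff[OF assms(1) square_integrable_zero] by (simp add: abs_L2_zero)
qed

lemma trivial_kernel:
  assumes "(\<psi>, z *\<^sub>C \<psi>) \<in> adjoint_op (dirac_op M)" and z: "z = \<i> \<or> z = - \<i>" and M: "M \<ge> 1/2"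
  shows "\<psi> = 0"
proof -
  obtain u v where uv: "solves M z u v" "square_integrable (spinor u v)" "\<psi> = abs_L2 (spinor u v)"
    using adjoint_eigenvector_solves[OF assms(1)] .
  show ?thesis
    unfolding uv(3) using uv by (intro abs_L2_spinor_zero square_integrable_solution_zero[OF uv(1) z M]) auto
qed

subsection \<open>Solutions for small mass\<close>

lemma solves_combination:
  assumes "solves M z u1 v1" "solves M z u2 v2"
  shows "solves M z (\<lambda>x. \<alpha> * u1 x + \<beta> * u2 x) (\<lambda>x. \<alpha> * v1 x + \<beta> * v2 x)"
  unfolding solves_def
proof (intro ballI conjI)
  fix x assume x: "x \<in> I0"
  note d = assms(1)[unfolded solves_def, rule_format, OF x] assms(2)[unfolded solves_def, rule_format, OF x]
  have "((\<lambda>x. \<alpha> * u1 x + \<beta> * u2 x) has_vector_derivative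
      \<alpha> * (z * v1 x - of_real (mass M x) * u1 x) + \<beta> * (z * v2 x - of_real (mass M x) * u2 x)) (at x)"
    using d by (intro has_vector_derivative_add has_vector_derivative_mult_right) auto
  then show "((\<lambda>x. \<alpha> * u1 x + \<beta> * u2 x) has_vector_derivative
      z * (\<alpha> * v1 x + \<beta> * v2 x) - of_real (mass M x) * (\<alpha> * u1 x + \<beta> * u2 x)) (at x)"
    by (simp add: algebra_simps)
  have "((\<lambda>x. \<alpha> * v1 x + \<beta> * v2 x) has_vector_derivative
      \<alpha> * (of_real (mass M x) * v1 x - z * u1 x) + \<beta> * (of_real (mass M x) * v2 x - z * u2 x)) (at x)"
    using d by (intro has_vector_derivative_add has_vector_derivative_mult_right) auto
  then show "((\<lambda>x. \<alpha> * v1 x + \<beta> * v2 x) has_vector_derivative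
      of_real (mass M x) * (\<alpha> * v1 x + \<beta> * v2 x) - z * (\<alpha> * u1 x + \<beta> * u2 x)) (at x)"
    by (simp add: algebra_simps)
qed

lemma abs_flux_le:
  assumes "z = \<i> \<or> z = - \<i>"
  shows "2 * \<bar>flux z u v x\<bar> \<le> (cmod (u x))\<^sup>2 + (cmod (v x))\<^sup>2"
proof -
  have "\<bar>flux z u v x\<bar> \<le> cmod (cnj (u x) * (z * v x))"
    unfolding flux_def by (rule abs_Re_le_cmod)
  also have "\<dots> = cmod (u x) * cmod (v x)" using assms by (auto simp: norm_mult)
  finally show ?thesis using sum_squares_bound[of "cmod (u x)" "cmod (v x)"] by simp
qed

text \<open>Gronwall's argument: \<open>E' \<le> K E\<close> makes
  \<open>E x * exp (- K * x)\<close> nonincreasing, and it starts at 0.\<close>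

lemma solves_zero_right:
  assumes s: "solves M z u v" and z: "z = \<i> \<or> z = - \<i>" and M: "M \<ge> 0"
    and init: "u 0 = 0" "v 0 = 0" and b: "0 \<le> b" "b < pi/2"
  shows "u b = 0 \<and> v b = 0"
proof -
  \<comment> \<open>One 2 comes from \<open>4 * flux \<le> 2 * E\<close>; the other term bounds
    twice the mass, which on \<open>{0..b}\<close> is largest at \<open>b\<close>.\<close>
  define K where "K = 2 + 2 * (M / cos b)"
  define E where "E x = (cmod (u x))\<^sup>2 + (cmod (v x))\<^sup>2" for x
  define E' where "E' x = 4 * flux z u v x + 2 * mass M x * ((cmod (v x))\<^sup>2 - (cmod (u x))\<^sup>2)" for x
  have cb: "cos b > 0" using b by (intro cos_pos_I0) auto
  have "- (E 0 * exp (- K * 0)) \<le> - (E b * exp (- K * b))"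
  proof (rule nonneg_derivative_imp_le[OF _ _ b(1)])
    fix x assume x: "0 \<le> x" "x \<le> b"
    have xI: "x \<in> I0" using x b pi_gt_zero by auto
    have dE: "(E has_real_derivative E' x) (at x)"
      unfolding E_def E'_def
      by (rule DERIV_cong[OF DERIV_add[OF solves_derivatives(2)[OF s z xI] solves_derivatives(3)[OF s z xI]]])
        (simp add: algebra_simps)
    show "((\<lambda>x. - (E x * exp (- K * x))) has_real_derivative exp (- K * x) * (K * E x - E' x)) (at x)"
      by (rule derivative_eq_intros dE refl | simp add: algebra_simps)+
    have "cos b \<le> cos x" using x b by (intro cos_monotone_0_pi_le) auto
    then have m: "0 \<le> mass M x" "mass M x \<le> M / cos b"
      using cb M by (auto simp: mass_def frac_le)
    have "mass M x * ((cmod (v x))\<^sup>2 - (cmod (u x))\<^sup>2) \<le> mass M x * E x"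
      using m by (intro mult_left_mono) (auto simp: E_def)
    also have "\<dots> \<le> (M / cos b) * E x"
      using m by (intro mult_right_mono) (auto simp: E_def)
    finally have "mass M x * ((cmod (v x))\<^sup>2 - (cmod (u x))\<^sup>2) \<le> (M / cos b) * E x" .
    moreover have "4 * flux z u v x \<le> 2 * E x"
      using abs_flux_le[OF z, of u v x] unfolding E_def by (simp add: abs_le_iff)
    moreover have "E' x = 4 * flux z u v x + 2 * (mass M x * ((cmod (v x))\<^sup>2 - (cmod (u x))\<^sup>2))"
      by (simp add: E'_def)
    moreover have "K * E x = 2 * E x + 2 * ((M / cos b) * E x)"
      by (simp add: K_def distrib_right)
    ultimately have "E' x \<le> K * E x" by linarith
    then show "0 \<le> exp (- K * x) * (K * E x - E' x)" by simp
  qed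
  then have "E b * exp (- K * b) \<le> 0" by (simp add: E_def init)
  then have "E b \<le> 0" by (simp add: mult_le_0_iff)
  then show ?thesis
    unfolding E_def by (simp add: sum_power2_le_zero_iff)
qed

lemma solves_zero:
  assumes s: "solves M z u v" and z: "z = \<i> \<or> z = - \<i>" and M: "M \<ge> 0"
    and init: "u 0 = 0" "v 0 = 0" and x: "x \<in> I0"
  shows "u x = 0" "v x = 0"
proof -
  have "u x = 0 \<and> v x = 0"
  proof (cases "0 \<le> x")
    case True
    then show ?thesis using solves_zero_right[OF s z M init] x by auto
  next
    case False
    then show ?thesis using solves_zero_right[OF solves_reflect[OF s] z M, of "- x"] init x by auto
  qed
  then show "u x = 0" "v x = 0" by auto
qed

lemma abs_L2_combination:
  assumes "square_integrable (spinor u1 v1)" "square_integrable (spinor u2 v2)"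
  shows "square_integrable (spinor (\<lambda>x. \<alpha> * u1 x + \<beta> * u2 x) (\<lambda>x. \<alpha> * v1 x + \<beta> * v2 x))"
    "\<alpha> *\<^sub>C abs_L2 (spinor u1 v1) + \<beta> *\<^sub>C abs_L2 (spinor u2 v2) =
      abs_L2 (spinor (\<lambda>x. \<alpha> * u1 x + \<beta> * u2 x) (\<lambda>x. \<alpha> * v1 x + \<beta> * v2 x))"
proof -
  have eq: "(\<lambda>x. \<alpha> *s spinor u1 v1 x + \<beta> *s spinor u2 v2 x) =
      spinor (\<lambda>x. \<alpha> * u1 x + \<beta> * u2 x) (\<lambda>x. \<alpha> * v1 x + \<beta> * v2 x)"
    by (auto simp: vec_eq_iff forall_2)
  note sq = square_integrable_scaleC[OF assms(1), of \<alpha>] square_integrable_scaleC[OF assms(2), of \<beta>]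
  show "square_integrable (spinor (\<lambda>x. \<alpha> * u1 x + \<beta> * u2 x) (\<lambda>x. \<alpha> * v1 x + \<beta> * v2 x))"
    using square_integrable_add[OF sq] by (simp only: eq)
  show "\<alpha> *\<^sub>C abs_L2 (spinor u1 v1) + \<beta> *\<^sub>C abs_L2 (spinor u2 v2) =
      abs_L2 (spinor (\<lambda>x. \<alpha> * u1 x + \<beta> * u2 x) (\<lambda>x. \<alpha> * v1 x + \<beta> * v2 x))"
    by (simp only: abs_L2_scaleC[OF assms(1)] abs_L2_scaleC[OF assms(2)] abs_L2_add[OF sq] eq)
qed

text \<open>A solution is determined by its two values at 0. Independence of \<open>k1\<close> and
  \<open>k2\<close> therefore makes the determinant of their initial values nonzero, and Cramer's
  rule gives the coefficients that match the initial values of the third solution.\<close>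

lemma eigenvector_in_span:
  assumes z: "z = \<i> \<or> z = - \<i>" and M: "M \<ge> 0"
    and k1: "(k1, z *\<^sub>C k1) \<in> adjoint_op (dirac_op M)" and k2: "(k2, z *\<^sub>C k2) \<in> adjoint_op (dirac_op M)"
    and indep: "\<And>\<alpha> \<beta>. \<alpha> *\<^sub>C k1 + \<beta> *\<^sub>C k2 = 0 \<Longrightarrow> \<alpha> = 0 \<and> \<beta> = 0"
    and k: "(k, z *\<^sub>C k) \<in> adjoint_op (dirac_op M)"
  shows "\<exists>\<alpha> \<beta>. k = \<alpha> *\<^sub>C k1 + \<beta> *\<^sub>C k2"
proof -
  obtain u1 v1 where 1: "solves M z u1 v1" "square_integrable (spinor u1 v1)" "k1 = abs_L2 (spinor u1 v1)"
    using adjoint_eigenvector_solves[OF k1] .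
  obtain u2 v2 where 2: "solves M z u2 v2" "square_integrable (spinor u2 v2)" "k2 = abs_L2 (spinor u2 v2)"
    using adjoint_eigenvector_solves[OF k2] .
  obtain u v where 0: "solves M z u v" "square_integrable (spinor u v)" "k = abs_L2 (spinor u v)"
    using adjoint_eigenvector_solves[OF k] .
  have zero: "abs_L2 (spinor f g) = 0"
    if "solves M z f g" "square_integrable (spinor f g)" "f 0 = 0" "g 0 = 0" for f g
    using that(2) by (rule abs_L2_spinor_zero) (rule solves_zero[OF that(1) z M that(3,4)], assumption)+
  have det: "u1 0 * v2 0 - u2 0 * v1 0 \<noteq> 0"
  proof
    assume det0: "u1 0 * v2 0 - u2 0 * v1 0 = 0"
    have "\<exists>\<alpha> \<beta>. (\<alpha> \<noteq> 0 \<or> \<beta> \<noteq> 0) \<and> \<alpha> * u1 0 + \<beta> * u2 0 = 0 \<and> \<alpha> * v1 0 + \<beta> * v2 0 = 0"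
    proof (cases "u1 0 = 0")
      case True
      show ?thesis
      proof (cases "v1 0 = 0")
        case True
        with \<open>u1 0 = 0\<close> show ?thesis by (intro exI[of _ 1] exI[of _ 0]) simp
      next
        case False
        with \<open>u1 0 = 0\<close> det0 show ?thesis
          by (intro exI[of _ "v2 0"] exI[of _ "- v1 0"]) (simp add: mult.commute)
      qed
    next
      case False
      with det0 show ?thesis
        by (intro exI[of _ "u2 0"] exI[of _ "- u1 0"]) (simp add: algebra_simps)
    qed
    then obtain \<alpha> \<beta> where ab: "\<alpha> \<noteq> 0 \<or> \<beta> \<noteq> 0" "\<alpha> * u1 0 + \<beta> * u2 0 = 0" "\<alpha> * v1 0 + \<beta> * v2 0 = 0"
      by blast
    have "\<alpha> *\<^sub>C k1 + \<beta> *\<^sub>C k2 = 0"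
      unfolding 1(3) 2(3) abs_L2_combination(2)[OF 1(2) 2(2)]
      by (rule zero[OF solves_combination[OF 1(1) 2(1)] abs_L2_combination(1)[OF 1(2) 2(2)] ab(2,3)])
    with indep ab(1) show False by blast
  qed
  define d where "d = u1 0 * v2 0 - u2 0 * v1 0"
  define \<alpha> where "\<alpha> = (u 0 * v2 0 - u2 0 * v 0) / d"
  define \<beta> where "\<beta> = (u1 0 * v 0 - u 0 * v1 0) / d"
  have d: "d \<noteq> 0" using det by (simp add: d_def)
  have e1: "\<alpha> * u1 0 + \<beta> * u2 0 = u 0"
  proof -
    have "\<alpha> * u1 0 + \<beta> * u2 0 = u 0 * d / d"
      unfolding \<alpha>_def \<beta>_def d_def by (simp add: add_divide_distrib[symmetric] algebra_simps)
    then show ?thesis using d by simp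
  qed
  have e2: "\<alpha> * v1 0 + \<beta> * v2 0 = v 0"
  proof -
    have "\<alpha> * v1 0 + \<beta> * v2 0 = v 0 * d / d"
      unfolding \<alpha>_def \<beta>_def d_def by (simp add: add_divide_distrib[symmetric] algebra_simps)
    then show ?thesis using d by simp
  qed
  let ?f = "\<lambda>x. \<alpha> * u1 x + \<beta> * u2 x" and ?g = "\<lambda>x. \<alpha> * v1 x + \<beta> * v2 x"
  note c = solves_combination[OF 1(1) 2(1), of \<alpha> \<beta>] abs_L2_combination[OF 1(2) 2(2), of \<alpha> \<beta>]
  have "1 *\<^sub>C abs_L2 (spinor ?f ?g) + (- 1) *\<^sub>C abs_L2 (spinor u v) = 0"
    unfolding abs_L2_combination(2)[OF c(2) 0(2)]
    by (rule zero[OF solves_combination[OF c(1) 0(1)] abs_L2_combination(1)[OF c(2) 0(2)]])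
      (simp_all add: e1 e2)
  then have "k = \<alpha> *\<^sub>C k1 + \<beta> *\<^sub>C k2" unfolding 0(3) 1(3) 2(3) c(3) by simp
  then show ?thesis by blast
qed

section \<open>Explicit zero modes and their integrability\<close>

text \<open>This is \<open>tan (\<pi>/4 + x/2)\<close>, the exponential of a primitive of the secant; its powers \<open>\<plusminus>M\<close> solve \<open>D\<^sup>\<dagger> \<psi> = 0\<close>.\<close>

definition half_tan :: "real \<Rightarrow> real" where
  "half_tan x = (1 + sin x) / cos x"

lemma one_plus_sin_times_one_minus_sin: "(1 + sin x) * (1 - sin x) = cos x * cos (x::real)"
proof -
  have *: "c * c + s * s = 1 \<Longrightarrow> (1 + s) * (1 - s) = c * c" for s c :: real
    by (simp add: algebra_simps)
  show ?thesis by (rule *) (rule sin_cos_squared_add3)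
qed

lemma one_plus_sin_pos:
  assumes "x \<in> I0"
  shows "1 + sin x > 0"
proof -
  have "1 + sin x \<noteq> 0"
    using one_plus_sin_times_one_minus_sin[of x] cos_pos_I0[OF assms] by auto
  moreover have "- 1 \<le> sin x" by simp
  ultimately show ?thesis by linarith
qed

lemma half_tan_pos: "x \<in> I0 \<Longrightarrow> half_tan x > 0"
  unfolding half_tan_def using cos_pos_I0 one_plus_sin_pos by simp

lemma half_tan_minus:
  assumes "x \<in> I0"
  shows "half_tan (- x) = inverse (half_tan x)"
proof -
  have "(1 - sin x) * (1 + sin x) = cos x * cos x"
    using one_plus_sin_times_one_minus_sin[of x] by (simp only: mult.commute)
  then show ?thesis
    using cos_pos_I0[OF assms] one_plus_sin_pos[OF assms]
    by (simp add: half_tan_def frac_eq_eq)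
qed

text \<open>The inverse of \<open>half_tan x\<close> is the tangent of half the distance from x to
  pi/2, and a tangent is at least its angle.\<close>

lemma half_tan_le:
  assumes x: "x \<in> I0"
  shows "half_tan x \<le> 2 / (pi/2 - x)"
proof -
  let ?y = "(pi/2 - x) / 2"
  have y: "0 < ?y" "?y < pi/2" using x by auto
  have "tan ?y = sin (pi/2 - x) / (cos (pi/2 - x) + 1)"
  proof -
    have "2 * ?y = pi/2 - x" by simp
    then show ?thesis by (simp only: tan_half)
  qed
  also have "\<dots> = inverse (half_tan x)"
    by (simp add: half_tan_def sin_diff cos_diff add.commute)
  finally have t: "tan ?y = inverse (half_tan x)" .
  have "?y = arctan (tan ?y)" using y by (intro arctan_tan[symmetric]) auto
  also have "\<dots> \<le> tan ?y"
    using half_tan_pos[OF x] by (intro arctan_le_self) (simp add: t)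
  finally have "(pi/2 - x) / 2 \<le> inverse (half_tan x)" unfolding t .
  then show ?thesis
    using half_tan_pos[OF x] x by (simp add: field_simps)
qed

text \<open>The logarithmic derivative of \<open>half_tan\<close> is the secant. The exponent thus
  takes the place of the mass, and it may be negative.\<close>

lemma has_real_derivative_half_tan_powr:
  assumes x: "x \<in> I0"
  shows "((\<lambda>x. half_tan x powr a) has_real_derivative mass a x * half_tan x powr a) (at x)"
proof -
  have c: "cos x \<noteq> 0" using cos_pos_I0[OF x] by simp
  have "(half_tan has_real_derivative (cos x * cos x + (1 + sin x) * sin x) / (cos x * cos x)) (at x)"
    unfolding half_tan_def by (rule derivative_eq_intros refl c | simp)+
  also have "cos x * cos x + (1 + sin x) * sin x = 1 + sin x"
    using one_plus_sin_times_one_minus_sin[of x] by (simp add: algebra_simps)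
  finally have d: "(half_tan has_real_derivative (1 + sin x) / (cos x * cos x)) (at x)" .
  have "((\<lambda>x. half_tan x powr a) has_real_derivative
      half_tan x powr a * (0 * ln (half_tan x) + (1 + sin x) / (cos x * cos x) * a / half_tan x)) (at x)"
    by (rule has_real_derivative_powr'[OF d DERIV_const half_tan_pos[OF x]])
  also have "half_tan x powr a * (0 * ln (half_tan x) + (1 + sin x) / (cos x * cos x) * a / half_tan x) =
      mass a x * half_tan x powr a"
    using c one_plus_sin_pos[OF x] by (simp add: half_tan_def mass_def)
  finally show ?thesis .
qed

lemma continuous_on_half_tan_powr: "continuous_on I0 (\<lambda>x. half_tan x powr a)"
  by (intro continuous_at_imp_continuous_on ballI DERIV_isCont[OF has_real_derivative_half_tan_powr])

text \<open>The majorant is a constant times the power -a of the distance to the right endpoint,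
  which is integrable for \<open>a < 1\<close>.\<close>

lemma half_tan_powr_integrable_nonneg:
  assumes a: "0 \<le> a" "a < 1"
  shows "(\<lambda>x. half_tan x powr a) integrable_on I0"
proof (rule measurable_bounded_by_integrable_imp_integrable)
  show "(\<lambda>x. half_tan x powr a) \<in> borel_measurable (lebesgue_on I0)"
    by (intro continuous_imp_measurable_on_sets_lebesgue continuous_on_half_tan_powr) simp
  \<comment> \<open>The singularity at 0 is moved to the right endpoint by a reflection and a shift
    by pi/2.\<close>
  have "(\<lambda>x. x powr (- a)) integrable_on {0..pi}"
    using has_integral_powr_from_0[of "- a" pi] a by auto
  then have "(\<lambda>x. (- x) powr (- a)) integrable_on {- pi..- 0}"
    by (subst Henstock_Kurzweil_Integration.integrable_reflect_real)
  then have "((\<lambda>x. (- x) powr (- a)) \<circ> (+) (- (pi/2))) integrable_on {- (pi/2)..pi/2}"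
    by (subst integrable_on_shift_Icc_real) simp
  then have "(\<lambda>x. (pi/2 - x) powr (- a)) integrable_on {- (pi/2)..pi/2}"
    by (simp add: o_def add.commute)
  from integrable_cmul[OF this, of "2 powr a"]
  show "(\<lambda>x. 2 powr a * (pi/2 - x) powr (- a)) integrable_on I0"
    by (simp add: integrable_on_Icc_iff_Ioo)
  fix x assume x: "x \<in> I0"
  have "half_tan x powr a \<le> (2 / (pi/2 - x)) powr a"
    by (rule powr_mono2[OF a(1) less_imp_le[OF half_tan_pos[OF x]] half_tan_le[OF x]])
  also have "\<dots> = 2 powr a / (pi/2 - x) powr a"
    by (rule powr_divide)
  also have "\<dots> = 2 powr a * (pi/2 - x) powr (- a)"
    by (simp only: powr_minus divide_inverse)
  finally show "norm (half_tan x powr a) \<le> 2 powr a * (pi/2 - x) powr (- a)" by simp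
qed simp

text \<open>Negative exponents follow by reflection, which inverts \<open>half_tan\<close>. The
  exponents in use are 2M and -2M, and this is where \<open>M < 1/2\<close> enters.\<close>

lemma half_tan_powr_integrable:
  assumes "\<bar>a\<bar> < 1"
  shows "integrable (lebesgue_on I0) (\<lambda>x. half_tan x powr a)"
proof -
  have "(\<lambda>x. half_tan x powr a) integrable_on I0"
  proof (cases "a \<ge> 0")
    case True
    then show ?thesis using assms by (intro half_tan_powr_integrable_nonneg) auto
  next
    case False
    then have "(\<lambda>x. half_tan x powr (- a)) integrable_on I0"
      using assms by (intro half_tan_powr_integrable_nonneg) auto
    then have "(\<lambda>x. half_tan (- x) powr (- a)) integrable_on I0"
      using Henstock_Kurzweil_Integration.integrable_reflect_real
        [where f = "\<lambda>x. half_tan x powr (- a)" and a = "-(pi/2)" and b = "pi/2"]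
      by (simp add: integrable_on_Icc_iff_Ioo)
    moreover have "half_tan (- x) powr (- a) = half_tan x powr a" if "x \<in> I0" for x
      using half_tan_pos[OF that] by (simp add: half_tan_minus[OF that] powr_minus inverse_powr)
    ultimately show ?thesis by (rule integrable_eq)
  qed
  then have "(\<lambda>x. half_tan x powr a) absolutely_integrable_on I0"
    by (rule nonnegative_absolutely_integrable_1) simp
  then show ?thesis by (simp add: set_integrable_def integrable_restrict_space)
qed

section \<open>Cut-off zero modes and definiteness of the form\<close>

lemma square_integrable_spinorI:
  assumes M: "0 \<le> M" "M < 1/2" and c: "continuous_on I0 a" "continuous_on I0 b"
    and le: "\<And>x. x \<in> I0 \<Longrightarrow> (cmod (a x))\<^sup>2 + (cmod (b x))\<^sup>2 \<le> (half_tan x powr M)\<^sup>2 + (half_tan x powr (- M))\<^sup>2"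
  shows "square_integrable (spinor a b)"
proof -
  have m: "spinor a b \<in> borel_measurable (lebesgue_on I0)"
    by (intro continuous_imp_measurable_on_sets_lebesgue continuous_on_spinor c) simp
  have sq: "(half_tan x powr t)\<^sup>2 = half_tan x powr (2 * t)" for x t
    by (simp only: power2_eq_square mult_2 powr_add)
  have "integrable (lebesgue_on I0) (\<lambda>x. (norm (spinor a b x))\<^sup>2)"
  proof (rule Bochner_Integration.integrable_bound)
    show "integrable (lebesgue_on I0) (\<lambda>x. half_tan x powr (2 * M) + half_tan x powr (2 * - M))"
      using M by (intro Bochner_Integration.integrable_add half_tan_powr_integrable) auto
    show "(\<lambda>x. (norm (spinor a b x))\<^sup>2) \<in> borel_measurable (lebesgue_on I0)" using m by measurable
    show "AE x in lebesgue_on I0. norm ((norm (spinor a b x))\<^sup>2) \<le> norm (half_tan x powr (2 * M) + half_tan x powr (2 * - M))"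
    proof (rule AE_I2)
      fix x assume "x \<in> space (lebesgue_on I0)"
      then have "x \<in> I0" by (simp add: space_restrict_space)
      from le[OF this] show "norm ((norm (spinor a b x))\<^sup>2) \<le> norm (half_tan x powr (2 * M) + half_tan x powr (2 * - M))"
        unfolding sq by (simp add: norm_vec2_sq)
    qed
  qed
  with m show ?thesis by (simp add: square_integrable_def)
qed

text \<open>The Dirac expression annihilates \<open>(wm, 0)\<close> and \<open>(0, wp)\<close>, so
  only the derivatives of the coefficients \<open>p\<close> and \<open>q\<close> survive. The bounds
  by 1 then leave a function and an image that are both dominated by the zero modes.\<close>

lemma boundary_pair_in_adjoint:
  fixes p q p' q' :: "real \<Rightarrow> complex"
  assumes M: "0 \<le> M" "M < 1/2"
    and d: "\<And>x. (p has_vector_derivative p' x) (at x)" "\<And>x. (q has_vector_derivative q' x) (at x)"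
    and c: "continuous_on I0 p'" "continuous_on I0 q'"
    and le: "\<And>x. cmod (p x) \<le> 1" "\<And>x. cmod (q x) \<le> 1" "\<And>x. cmod (p' x) \<le> 1" "\<And>x. cmod (q' x) \<le> 1"
  defines "wp \<equiv> \<lambda>x. complex_of_real (half_tan x powr M)"
    and "wm \<equiv> \<lambda>x. complex_of_real (half_tan x powr (- M))"
  shows "square_integrable (spinor (\<lambda>x. p x * wm x) (\<lambda>x. q x * wp x))"
    "square_integrable (spinor (\<lambda>x. - q' x * wp x) (\<lambda>x. p' x * wm x))"
    "(abs_L2 (spinor (\<lambda>x. p x * wm x) (\<lambda>x. q x * wp x)),
      abs_L2 (spinor (\<lambda>x. - q' x * wp x) (\<lambda>x. p' x * wm x))) \<in> adjoint_op (dirac_op M)"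
proof -
  have cw: "continuous_on I0 wp" "continuous_on I0 wm"
    unfolding wp_def wm_def by (intro continuous_intros continuous_on_half_tan_powr)+
  have cpq: "continuous_on I0 p" "continuous_on I0 q"
    using d by (auto intro!: continuous_at_imp_continuous_on has_vector_derivative_continuous)
  have bound: "(cmod (a * w))\<^sup>2 \<le> (cmod w)\<^sup>2" if "cmod a \<le> 1" for a w :: complex
    unfolding norm_mult using that by (intro power_mono) (auto intro: mult_left_le_one_le)
  have nw: "cmod (wp x) = half_tan x powr M" "cmod (wm x) = half_tan x powr (- M)" for x
    unfolding wp_def wm_def norm_of_real by simp_all
  show f: "square_integrable (spinor (\<lambda>x. p x * wm x) (\<lambda>x. q x * wp x))"
  proof (rule square_integrable_spinorI[OF M])
    fix x show "(cmod (p x * wm x))\<^sup>2 + (cmod (q x * wp x))\<^sup>2 \<le> (half_tan x powr M)\<^sup>2 + (half_tan x powr (- M))\<^sup>2"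
      using bound[OF le(1), of x "wm x"] bound[OF le(2), of x "wp x"] unfolding nw by linarith
  qed (intro continuous_intros cpq cw)+
  show h: "square_integrable (spinor (\<lambda>x. - q' x * wp x) (\<lambda>x. p' x * wm x))"
  proof (rule square_integrable_spinorI[OF M])
    fix x
    have "cmod (- q' x) \<le> 1" using le(4) by simp
    then show "(cmod (- q' x * wp x))\<^sup>2 + (cmod (p' x * wm x))\<^sup>2 \<le> (half_tan x powr M)\<^sup>2 + (half_tan x powr (- M))\<^sup>2"
      using bound[of "- q' x" "wp x"] bound[OF le(3), of x "wm x"] unfolding nw by linarith
  qed (intro continuous_intros c cw)+
  have dw: "(wp has_vector_derivative of_real (mass M x) * wp x) (at x)"
    "(wm has_vector_derivative - of_real (mass M x) * wm x) (at x)" if "x \<in> I0" for x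
  proof -
    have neg: "mass (- M) x = - mass M x" by (simp add: mass_def)
    show "(wp has_vector_derivative of_real (mass M x) * wp x) (at x)"
      using has_vector_derivative_of_real[OF has_real_derivative_half_tan_powr[OF that, of M]]
      unfolding wp_def by simp
    show "(wm has_vector_derivative - of_real (mass M x) * wm x) (at x)"
      using has_vector_derivative_of_real[OF has_real_derivative_half_tan_powr[OF that, of "- M"]]
      unfolding wm_def neg by simp
  qed
  show "(abs_L2 (spinor (\<lambda>x. p x * wm x) (\<lambda>x. q x * wp x)),
      abs_L2 (spinor (\<lambda>x. - q' x * wp x) (\<lambda>x. p' x * wm x))) \<in> adjoint_op (dirac_op M)"
  proof (rule differentiable_imp_adjoint[OF f h])
    fix x assume x: "x \<in> I0"
    show "(spinor (\<lambda>x. p x * wm x) (\<lambda>x. q x * wp x) has_vector_derivative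
        vector [p x * (- of_real (mass M x) * wm x) + p' x * wm x, q x * (of_real (mass M x) * wp x) + q' x * wp x]) (at x)"
      by (intro has_vector_derivative_spinor has_vector_derivative_mult d dw[OF x])
  qed (simp_all add: algebra_simps)
qed

text \<open>Each of the weights cos x (1 + sin x)/2 and cos x (1 - sin x)/2 has integral 1. The
  coefficients will be the squared moduli of \<alpha> and \<beta>.\<close>

lemma integral_cos_times_affine_sin:
  "(\<integral>x. complex_of_real (cos x * (A * ((1 + sin x) / 2) + B * ((1 - sin x) / 2))) \<partial>lebesgue_on I0) = of_real (A + B)"
proof -
  let ?F = "\<lambda>x. A * (sin x / 2 + (sin x)\<^sup>2 / 4) + B * (sin x / 2 - (sin x)\<^sup>2 / 4)"
  let ?f = "\<lambda>x. cos x * (A * ((1 + sin x) / 2) + B * ((1 - sin x) / 2))"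
  have "(?f has_integral (?F (pi/2) - ?F (- (pi/2)))) {- (pi/2)..pi/2}"
  proof (rule fundamental_theorem_of_calculus)
    fix x :: real
    have "(?F has_real_derivative ?f x) (at x within {- (pi/2)..pi/2})"
      by (rule derivative_eq_intros refl | simp)+ (simp add: field_simps)
    then show "(?F has_vector_derivative ?f x) (at x within {- (pi/2)..pi/2})"
      by (simp only: has_real_derivative_iff_has_vector_derivative)
  qed simp
  moreover have "?F (pi/2) - ?F (- (pi/2)) = A + B" by (simp add: field_simps)
  ultimately have "(?f has_integral (A + B)) {- (pi/2)..pi/2}" by (simp only:)
  then have i: "integral I0 ?f = A + B"
    unfolding integral_open_interval_real[symmetric] by (rule integral_unique)
  have "continuous_on {- (pi/2)..pi/2} ?f" by (intro continuous_intros) simp_all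
  then have "?f absolutely_integrable_on {- (pi/2)..pi/2}" by (rule absolutely_integrable_continuous_real)
  then have "?f absolutely_integrable_on I0" by (rule set_integrable_subset) auto
  then have "integrable (lebesgue_on I0) ?f" by (simp add: set_integrable_def integrable_restrict_space)
  from lebesgue_integral_eq_integral[OF this] i show ?thesis
    by (simp only: integral_complex_of_real) simp
qed

text \<open>The boundary terms of the form have opposite signs at the two endpoints. The vector
  concentrated on the right has component ratio \<open>t\<close>, the one on the left
  \<open>- t\<close>, so that both contribute with the sign \<open>s\<close>; the two together span
  the definite plane.\<close>

lemma dirac_eigenvectors_independent:
  assumes M: "0 \<le> M" "M < 1/2" and s: "s = 1 \<or> s = - 1"
  obtains k1 k2 where "(k1, (of_real s * \<i>) *\<^sub>C k1) \<in> adjoint_op (dirac_op M)"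
    "(k2, (of_real s * \<i>) *\<^sub>C k2) \<in> adjoint_op (dirac_op M)"
    "\<And>\<alpha> \<beta>. \<alpha> *\<^sub>C k1 + \<beta> *\<^sub>C k2 = 0 \<Longrightarrow> \<alpha> = 0 \<and> \<beta> = 0"
proof -
  \<comment> \<open>the weights \<open>X\<close> and \<open>Y = 1 - X\<close> serve as cut-offs near the right and the left endpoint\<close>
  define t where "t = - (of_real s * \<i>)"
  define wp wm where "wp x = complex_of_real (half_tan x powr M)"
    and "wm x = complex_of_real (half_tan x powr (- M))" for x
  define X Y D where "X x = complex_of_real ((1 + sin x) / 2)" and "Y x = complex_of_real ((1 - sin x) / 2)"
    and "D x = complex_of_real (cos x / 2)" for x
  have ct: "cnj t = - t" "t * t = - 1" "cmod t = 1" using s by (auto simp: t_def norm_mult)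
  have dX: "(X has_vector_derivative D x) (at x)" for x
  proof -
    have "((\<lambda>x. (1 + sin x) / 2) has_real_derivative cos x / 2) (at x)"
      by (auto intro!: derivative_eq_intros)
    from has_vector_derivative_of_real[OF this] show ?thesis unfolding X_def D_def .
  qed
  have dY: "(Y has_vector_derivative - D x) (at x)" for x
  proof -
    have "((\<lambda>x. (1 - sin x) / 2) has_real_derivative - (cos x / 2)) (at x)"
      by (auto intro!: derivative_eq_intros)
    from has_vector_derivative_of_real[OF this] show ?thesis unfolding Y_def D_def by (simp only: of_real_minus)
  qed
  have cD: "continuous_on I0 D" unfolding D_def by (intro continuous_intros) auto
  have le: "cmod (X x) \<le> 1" "cmod (Y x) \<le> 1" "cmod (D x) \<le> 1" for x
  proof -
    have "\<bar>(1 + a) / 2\<bar> \<le> 1 \<and> \<bar>(1 - a) / 2\<bar> \<le> 1 \<and> \<bar>b / 2\<bar> \<le> 1"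
      if "- 1 \<le> a" "a \<le> 1" "- 1 \<le> b" "b \<le> 1" for a b :: real
      using that by (simp add: abs_le_iff)
    from this[of "sin x" "cos x"]
    have "\<bar>(1 + sin x) / 2\<bar> \<le> 1 \<and> \<bar>(1 - sin x) / 2\<bar> \<le> 1 \<and> \<bar>cos x / 2\<bar> \<le> 1"
      by simp
    then show "cmod (X x) \<le> 1" "cmod (Y x) \<le> 1" "cmod (D x) \<le> 1"
      unfolding X_def Y_def D_def norm_of_real by blast+
  qed
  note e1 = boundary_pair_in_adjoint[OF M, of X D "\<lambda>x. t * X x" "\<lambda>x. t * D x", folded wp_def wm_def,
      OF dX has_vector_derivative_mult_right[OF dX] cD continuous_on_mult[OF continuous_on_const cD] le(1)]
  note e2 = boundary_pair_in_adjoint[OF M, of Y "\<lambda>x. - D x" "\<lambda>x. - t * Y x" "\<lambda>x. - t * - D x", folded wp_def wm_def,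
      OF dY has_vector_derivative_mult_right[OF dY] continuous_on_minus[OF cD]
        continuous_on_mult[OF continuous_on_const continuous_on_minus[OF cD]] le(2)]
  let ?u1 = "\<lambda>x. X x * wm x" and ?v1 = "\<lambda>x. t * X x * wp x"
  let ?g1 = "\<lambda>x. - (t * D x) * wp x" and ?h1 = "\<lambda>x. D x * wm x"
  let ?u2 = "\<lambda>x. Y x * wm x" and ?v2 = "\<lambda>x. - t * Y x * wp x"
  let ?g2 = "\<lambda>x. - (- t * - D x) * wp x" and ?h2 = "\<lambda>x. - D x * wm x"
  have 1: "square_integrable (spinor ?u1 ?v1)" "square_integrable (spinor ?g1 ?h1)"
    "(abs_L2 (spinor ?u1 ?v1), abs_L2 (spinor ?g1 ?h1)) \<in> adjoint_op (dirac_op M)"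
    by (rule e1; simp add: norm_mult ct le)+
  have 2: "square_integrable (spinor ?u2 ?v2)" "square_integrable (spinor ?g2 ?h2)"
    "(abs_L2 (spinor ?u2 ?v2), abs_L2 (spinor ?g2 ?h2)) \<in> adjoint_op (dirac_op M)"
    by (rule e2; simp add: norm_mult ct le)+
  have "s * Im (cinner (\<alpha> *\<^sub>C abs_L2 (spinor ?u1 ?v1) + \<beta> *\<^sub>C abs_L2 (spinor ?u2 ?v2))
      (\<alpha> *\<^sub>C abs_L2 (spinor ?g1 ?h1) + \<beta> *\<^sub>C abs_L2 (spinor ?g2 ?h2))) > 0"
    if ab: "\<alpha> \<noteq> 0 \<or> \<beta> \<noteq> 0" for \<alpha> \<beta>
  proof -
    let ?u = "\<lambda>x. \<alpha> * ?u1 x + \<beta> * ?u2 x" and ?v = "\<lambda>x. \<alpha> * ?v1 x + \<beta> * ?v2 x"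
    let ?g = "\<lambda>x. \<alpha> * ?g1 x + \<beta> * ?g2 x" and ?h = "\<lambda>x. \<alpha> * ?h1 x + \<beta> * ?h2 x"
    let ?k = "\<lambda>x. cos x * ((cmod \<alpha>)\<^sup>2 * ((1 + sin x) / 2) + (cmod \<beta>)\<^sup>2 * ((1 - sin x) / 2))"
    note c1 = abs_L2_combination[OF 1(1) 2(1), of \<alpha> \<beta>]
    note c2 = abs_L2_combination[OF 1(2) 2(2), of \<alpha> \<beta>]
    have "cinner (abs_L2 (spinor ?u ?v)) (abs_L2 (spinor ?g ?h)) =
        (\<integral>x. cdot (spinor ?u ?v x) (spinor ?g ?h x) \<partial>lebesgue_on I0)"
      by (rule cinner_abs_L2[OF c1(1) c2(1)])
    also have "\<dots> = (\<integral>x. - t * complex_of_real (?k x) \<partial>lebesgue_on I0)"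
    proof (rule Bochner_Integration.integral_cong[OF refl])
      fix x assume "x \<in> space (lebesgue_on I0)"
      then have x: "x \<in> I0" by (simp add: space_restrict_space)
      have w: "wm x * wp x = 1"
        using half_tan_pos[OF x] unfolding wm_def wp_def of_real_mult[symmetric] powr_add[symmetric] by simp
      have cn: "cnj (wm x) = wm x" "cnj (wp x) = wp x" "cnj (X x) = X x" "cnj (Y x) = Y x"
        by (simp_all add: wm_def wp_def X_def Y_def)
      \<comment> \<open>Since \<open>cnj t = - t\<close>, the two contributions to each diagonal
        term add up, which is the factor 2, while those to the mixed terms in \<alpha> and \<beta>
        cancel.\<close>
      have "cdot (spinor ?u ?v x) (spinor ?g ?h x) =
          (wm x * wp x) * (- t * (2 * D x) * ((\<alpha> * cnj \<alpha>) * X x + (\<beta> * cnj \<beta>) * Y x))"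
        by (simp add: cdot_def sum_2 cn ct(1) algebra_simps)
      also have "\<dots> = - t * complex_of_real (?k x)"
        unfolding w complex_norm_square[symmetric] X_def Y_def D_def by simp
      finally show "cdot (spinor ?u ?v x) (spinor ?g ?h x) = - t * complex_of_real (?k x)" .
    qed
    also have "\<dots> = - t * of_real ((cmod \<alpha>)\<^sup>2 + (cmod \<beta>)\<^sup>2)"
      by (simp only: integral_mult_right_zero integral_cos_times_affine_sin)
    finally have "Im (cinner (abs_L2 (spinor ?u ?v)) (abs_L2 (spinor ?g ?h))) = s * ((cmod \<alpha>)\<^sup>2 + (cmod \<beta>)\<^sup>2)"
      by (simp add: t_def del: of_real_add of_real_power)
    moreover have "(cmod \<alpha>)\<^sup>2 + (cmod \<beta>)\<^sup>2 > 0" using ab by (auto simp: sum_power2_gt_zero_iff)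
    ultimately show ?thesis using s unfolding c1(2) c2(2) by auto
  qed
  from definite_pair_imp_independent_eigenvectors[OF linear_graph_dirac_op dirac_op_subset_adjoint 1(3) 2(3) s this]
  show ?thesis using that by blast
qed

section \<open>The deficiency indices and the self-adjoint extension\<close>

lemma dirac_deficiency_eq_2:
  assumes M: "0 \<le> M" "M < 1/2" and s: "s = 1 \<or> s = - 1"
  shows "edim (ker_op (shift_op (adjoint_op (dirac_op M)) (of_real s * \<i>))) = 2"
proof (rule dirac_eigenvectors_independent[OF M s])
  fix k1 k2
  assume k: "(k1, (of_real s * \<i>) *\<^sub>C k1) \<in> adjoint_op (dirac_op M)"
    "(k2, (of_real s * \<i>) *\<^sub>C k2) \<in> adjoint_op (dirac_op M)"
    and indep: "\<And>\<alpha> \<beta>. \<alpha> *\<^sub>C k1 + \<beta> *\<^sub>C k2 = 0 \<Longrightarrow> \<alpha> = 0 \<and> \<beta> = 0"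
  have z: "of_real s * \<i> = \<i> \<or> of_real s * \<i> = - \<i>" using s by auto
  show ?thesis
  proof (rule edim_eq_2[of k1 _ k2])
    show "\<exists>\<alpha> \<beta>. k = \<alpha> *\<^sub>C k1 + \<beta> *\<^sub>C k2"
      if "k \<in> ker_op (shift_op (adjoint_op (dirac_op M)) (of_real s * \<i>))" for k
    proof -
      have "(k, (of_real s * \<i>) *\<^sub>C k) \<in> adjoint_op (dirac_op M)"
        using that by (simp only: mem_ker_shift_op)
      then show ?thesis by (rule eigenvector_in_span[OF z M(1) k indep, rotated -1])
    qed
    show "\<alpha> = 0 \<and> \<beta> = 0" if "\<alpha> *\<^sub>C k1 + \<beta> *\<^sub>C k2 = 0" for \<alpha> \<beta>
      using that by (rule indep)
  qed (simp_all only: mem_ker_shift_op k)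
qed

lemma dirac_deficiency_eq_0:
  assumes M: "M \<ge> 1/2" and z: "z = \<i> \<or> z = - \<i>"
  shows "edim (ker_op (shift_op (adjoint_op (dirac_op M)) z)) = 0"
proof (rule edim_eq_0)
  have "\<phi> = 0" if "\<phi> \<in> ker_op (shift_op (adjoint_op (dirac_op M)) z)" for \<phi>
    using that unfolding mem_ker_shift_op by (rule trivial_kernel[OF _ z M])
  moreover have "0 \<in> ker_op (shift_op (adjoint_op (dirac_op M)) z)"
    unfolding mem_ker_shift_op using linear_graphD(1)[OF linear_graph_adjoint] by simp
  ultimately show "ker_op (shift_op (adjoint_op (dirac_op M)) z) = {0}" by blast
qed

theorem mainTheorem1:
  fixes M :: real
  assumes "M \<ge> 0"
  shows "symmetric_op (dirac_op M) \<and>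
    (M < 1/2 \<longrightarrow> deficiency_plus (dirac_op M) = 2 \<and> deficiency_minus (dirac_op M) = 2) \<and>
    (M \<ge> 1/2 \<longrightarrow> deficiency_plus (dirac_op M) = 0 \<and> deficiency_minus (dirac_op M) = 0 \<and>
       essentially_self_adjoint_op (dirac_op M) \<and>
       (\<forall>T. self_adjoint_op T \<and> dirac_op M \<subseteq> T \<longleftrightarrow> T = closure (dirac_op M)))"
proof (intro conjI impI allI)
  show "symmetric_op (dirac_op M)" by (rule symmetric_dirac_op)
next
  assume M: "M < 1/2"
  show "deficiency_plus (dirac_op M) = 2"
    using dirac_deficiency_eq_2[OF assms M, of 1] by (simp add: deficiency_plus_def)
  show "deficiency_minus (dirac_op M) = 2"
    using dirac_deficiency_eq_2[OF assms M, of "- 1"] by (simp add: deficiency_minus_def)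
next
  assume M: "1/2 \<le> M"
  show "deficiency_plus (dirac_op M) = 0" "deficiency_minus (dirac_op M) = 0"
    unfolding deficiency_plus_def deficiency_minus_def by (simp_all add: dirac_deficiency_eq_0[OF M])
  have plus: "\<phi> = 0" if "(\<phi>, \<i> *\<^sub>C \<phi>) \<in> adjoint_op (dirac_op M)" for \<phi>
    using that by (rule trivial_kernel) (use M in auto)
  have minus: "\<phi> = 0" if "(\<phi>, (- \<i>) *\<^sub>C \<phi>) \<in> adjoint_op (dirac_op M)" for \<phi>
    using that by (rule trivial_kernel) (use M in auto)
  show "essentially_self_adjoint_op (dirac_op M)"
    by (rule essentially_self_adjoint_of_trivial_kernels(1)[OF symmetric_dirac_op plus minus])
  show "self_adjoint_op T \<and> dirac_op M \<subseteq> T \<longleftrightarrow> T = closure (dirac_op M)" for T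
    by (rule essentially_self_adjoint_of_trivial_kernels(2)[OF symmetric_dirac_op plus minus])
qed

end
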